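(* Let $T=(T_1,\ldots,T_n)\in\mathfrak{B}^n_0(\mathcal{H})$. Then there exist a Hilbert space $\mathcal{E}$, an isometry $\Pi:\mathcal{H}\to H^2_{\mathcal{E}}(\mathbb{D})$, and a BCL $n$-tuple $(M_{\Phi_1},\ldots,M_{\Phi_n})\in\mathfrak{B}^n_0(H^2_{\mathcal{E}}(\mathbb{D}))$ such that $$\Pi T_i^*=M_{\Phi_i}^*\Pi\qquad\text{for all } i=1,\ldots,n.$$
   Context: All Hilbert spaces are complex and separable; $n\ge 2$; $\mathbb{D}$ is the open unit disc. A contraction $S$ is called pure if $S^{*k}\to 0$ in the strong operator topology as $k\to\infty$. The class $\mathfrak{B}^n_0(\mathcal{H})$ is the set of all $n$-tuples $T=(T_1,\ldots,T_n)$ of commuting contractions on $\mathcal{H}$ such that $I-T_iT_i^*-T_jT_j^*+T_iT_jT_i^*T_j^*=0$ for all $i\neq j$, and the product $T_1\cdots T_n$ is pure. $H^2_{\mathcal{E}}(\mathbb{D})$ is the $\mathcal{E}$-valued Hardy space on $\mathbb{D}$, and for a bounded analytic function $\Phi:\mathbb{D}\to\mathcal{B}(\mathcal{E})$, $M_\Phi$ is the multiplication operator $(M_\Phi f)(z)=\Phi(z)f(z)$. A BCL $n$-tuple on $H^2_{\mathcal{E}}(\mathbb{D})$ is an $n$-tuple of commuting isometries $(M_{\Phi_1},\ldots,M_{\Phi_n})$, with $\Phi_i$ bounded analytic $\mathcal{B}(\mathcal{E})$-valued functions on $\mathbb{D}$, such that $M_{\Phi_1}\cdots M_{\Phi_n}=M_z$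 (the shift). *)

theory Defs
  imports "HOL-Analysis.Analysis" "HOL-Algebra.Module"
begin

section \<open>Complex separable Hilbert spaces\<close>

text \<open>
  Hilbert spaces are treated as objects (structures with an explicit carrier), since one of them
  is existentially quantified and another one, the vector-valued Hardy space, is built from it.
  The underlying vector space is a module, in the sense of HOL-Algebra, over the complex numbers.
  The library's module record carries two fields that modules do not use (the multiplication and
  the unit of the ring record it extends); they are irrelevant throughout.
\<close>

definition complex_field :: "complex ring" where
  "complex_field = \<lparr>carrier = UNIV, mult = (*), one = 1, zero = 0, add = (+)\<rparr>"

lemma cring_complex_field: "cring complex_field"
proof (rule cringI)
  show "abelian_group complex_field"
  proof (rule abelian_groupI)
    fix x :: complex
    show "\<exists>y\<in>carrier complex_field. y \<oplus>\<^bsub>complex_field\<^esub> x = \<zero>\<^bsub>complex_field\<^esub>"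
      by (rule bexI[of _ "- x"]) (simp_all add: complex_field_def)
  qed (simp_all add: complex_field_def)
  show "comm_monoid complex_field"
    by (rule comm_monoidI) (simp_all add: complex_field_def)
qed (simp add: complex_field_def distrib_right)

record 'a cinner_space = "(complex, 'a) module" +
  cinner :: "'a \<Rightarrow> 'a \<Rightarrow> complex"

definition hnorm :: "'a cinner_space \<Rightarrow> 'a \<Rightarrow> real" where
  "hnorm H x = sqrt (Re (cinner H x x))"

text \<open>The library's metric space locale requires a distance to be symmetric and nonnegative also
  outside of the carrier; hence the default value.\<close>

definition hdist :: "'a cinner_space \<Rightarrow> 'a \<Rightarrow> 'a \<Rightarrow> real" where
  "hdist H x y = (if x \<in> carrier H \<and> y \<in> carrier H then hnorm H (x \<ominus>\<^bsub>H\<^esub> y) else 0)"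

text \<open>The inner product is linear in its first argument. Conjugate symmetry makes
  \<open>cinner H x x\<close> real, so that taking real parts loses nothing.\<close>

locale inner_product_space =
  fixes H :: "'a cinner_space"
  assumes vector_space: "Module.module complex_field H"
    and cinner_add_left: "\<lbrakk>x \<in> carrier H; y \<in> carrier H; z \<in> carrier H\<rbrakk> \<Longrightarrow>
      cinner H (x \<oplus>\<^bsub>H\<^esub> y) z = cinner H x z + cinner H y z"
    and cinner_scale_left: "\<lbrakk>x \<in> carrier H; y \<in> carrier H\<rbrakk> \<Longrightarrow>
      cinner H (c \<odot>\<^bsub>H\<^esub> x) y = c * cinner H x y"
    and cinner_commute: "\<lbrakk>x \<in> carrier H; y \<in> carrier H\<rbrakk> \<Longrightarrow>
      cinner H x y = cnj (cinner H y x)"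
    and cinner_nonneg: "x \<in> carrier H \<Longrightarrow> 0 \<le> Re (cinner H x x)"
    and cinner_definite: "\<lbrakk>x \<in> carrier H; cinner H x x = 0\<rbrakk> \<Longrightarrow> x = \<zero>\<^bsub>H\<^esub>"

context inner_product_space
begin

lemma scale_closed: "x \<in> carrier H \<Longrightarrow> c \<odot>\<^bsub>H\<^esub> x \<in> carrier H"
  using module.smult_closed[OF vector_space, of c x] by (simp add: complex_field_def)

lemma uminus_eq_scale:
  assumes "x \<in> carrier H"
  shows "\<ominus>\<^bsub>H\<^esub> x = (- 1) \<odot>\<^bsub>H\<^esub> x"
proof -
  interpret M: Module.module complex_field H by (rule vector_space)
  have "(1 + (- 1)) \<odot>\<^bsub>H\<^esub> x = x \<oplus>\<^bsub>H\<^esub> (- 1) \<odot>\<^bsub>H\<^esub> x"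
    using M.smult_l_distr[of 1 "-1" x] M.smult_one[of x] assms
    unfolding complex_field_def by simp
  moreover have "0 \<odot>\<^bsub>H\<^esub> x = \<zero>\<^bsub>H\<^esub>"
    using M.smult_l_null[of x] assms by (simp add: complex_field_def)
  ultimately have "x \<oplus>\<^bsub>H\<^esub> (- 1) \<odot>\<^bsub>H\<^esub> x = \<zero>\<^bsub>H\<^esub>" by simp
  then show ?thesis
    using assms scale_closed by (metis M.M.a_comm M.minus_equality)
qed

lemma cinner_add_right:
  assumes "x \<in> carrier H" "y \<in> carrier H" "z \<in> carrier H"
  shows "cinner H z (x \<oplus>\<^bsub>H\<^esub> y) = cinner H z x + cinner H z y"
proof -
  interpret M: Module.module complex_field H by (rule vector_space)
  show ?thesis
    using cinner_add_left[OF assms] assms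
    by (metis M.add.m_closed cinner_commute complex_cnj_add)
qed

lemma cinner_scale_right:
  assumes "x \<in> carrier H" "y \<in> carrier H"
  shows "cinner H x (c \<odot>\<^bsub>H\<^esub> y) = cnj c * cinner H x y"
  using cinner_scale_left[OF assms(2,1), of c] assms
  by (metis scale_closed cinner_commute complex_cnj_mult)

lemma cinner_self: "x \<in> carrier H \<Longrightarrow> cinner H x x = complex_of_real ((hnorm H x)\<^sup>2)"
  using cinner_commute[of x x] cinner_nonneg[of x]
  by (auto simp: hnorm_def complex_eq_iff)

lemma hnorm_nonneg: "x \<in> carrier H \<Longrightarrow> 0 \<le> hnorm H x"
  by (simp add: hnorm_def cinner_nonneg)

lemma hnorm_sq_lincomb:
  assumes "x \<in> carrier H" "y \<in> carrier H"
  shows "(hnorm H (complex_of_real a \<odot>\<^bsub>H\<^esub> x \<oplus>\<^bsub>H\<^esub> complex_of_real b \<odot>\<^bsub>H\<^esub> y))\<^sup>2 =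
    a\<^sup>2 * (hnorm H x)\<^sup>2 + 2 * a * b * Re (cinner H x y) + b\<^sup>2 * (hnorm H y)\<^sup>2"
proof -
  interpret M: Module.module complex_field H by (rule vector_space)
  have "Re (cinner H y x) = Re (cinner H x y)"
    using cinner_commute[of x y] assms by simp
  then have "Re (cinner H (a \<odot>\<^bsub>H\<^esub> x \<oplus>\<^bsub>H\<^esub> b \<odot>\<^bsub>H\<^esub> y) (a \<odot>\<^bsub>H\<^esub> x \<oplus>\<^bsub>H\<^esub> b \<odot>\<^bsub>H\<^esub> y)) =
     a\<^sup>2 * (hnorm H x)\<^sup>2 + 2 * a * b * Re (cinner H x y) + b\<^sup>2 * (hnorm H y)\<^sup>2"
    using assms
    by (simp add: cinner_add_left cinner_add_right cinner_scale_left cinner_scale_right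
        scale_closed cinner_self[OF assms(1)] cinner_self[OF assms(2)] power2_eq_square algebra_simps)
  then show ?thesis
    using assms cinner_self[of "a \<odot>\<^bsub>H\<^esub> x \<oplus>\<^bsub>H\<^esub> b \<odot>\<^bsub>H\<^esub> y"] by (simp add: scale_closed)
qed

lemma scale_one: "x \<in> carrier H \<Longrightarrow> 1 \<odot>\<^bsub>H\<^esub> x = x"
  using module.smult_one[OF vector_space, of x] by (simp add: complex_field_def)

lemma hnorm_eq_0:
  assumes "x \<in> carrier H"
  shows "hnorm H x = 0 \<longleftrightarrow> x = \<zero>\<^bsub>H\<^esub>"
proof -
  interpret M: Module.module complex_field H by (rule vector_space)
  have "cinner H \<zero>\<^bsub>H\<^esub> \<zero>\<^bsub>H\<^esub> = 0"
    using cinner_add_left[of "\<zero>\<^bsub>H\<^esub>" "\<zero>\<^bsub>H\<^esub>" "\<zero>\<^bsub>H\<^esub>"] by simp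
  then have "hnorm H \<zero>\<^bsub>H\<^esub> = 0" by (simp add: hnorm_def)
  moreover have "x = \<zero>\<^bsub>H\<^esub>" if "hnorm H x = 0"
    using cinner_self[OF assms] that by (intro cinner_definite[OF assms]) simp
  ultimately show ?thesis by blast
qed

lemma Re_cinner_le:
  assumes "x \<in> carrier H" "y \<in> carrier H"
  shows "Re (cinner H x y) \<le> hnorm H x * hnorm H y"
proof (cases "hnorm H x = 0 \<or> hnorm H y = 0")
  case True
  interpret M: Module.module complex_field H by (rule vector_space)
  have "cinner H \<zero>\<^bsub>H\<^esub> z = 0 \<and> cinner H z \<zero>\<^bsub>H\<^esub> = 0" if "z \<in> carrier H" for z
    using cinner_add_left[of "\<zero>\<^bsub>H\<^esub>" "\<zero>\<^bsub>H\<^esub>" z] cinner_add_right[of "\<zero>\<^bsub>H\<^esub>" "\<zero>\<^bsub>H\<^esub>" z] that by simp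
  moreover have "x = \<zero>\<^bsub>H\<^esub> \<or> y = \<zero>\<^bsub>H\<^esub>"
    using True hnorm_eq_0[OF assms(1)] hnorm_eq_0[OF assms(2)] by blast
  ultimately have "cinner H x y = 0" using assms by blast
  then show ?thesis using True by auto
next
  case False
  then have pos: "hnorm H x * hnorm H y > 0"
    using hnorm_nonneg[OF assms(1)] hnorm_nonneg[OF assms(2)] by (simp add: less_le)
  have "0 \<le> (hnorm H y)\<^sup>2 * (hnorm H x)\<^sup>2 + 2 * hnorm H y * (- hnorm H x) * Re (cinner H x y)
      + (- hnorm H x)\<^sup>2 * (hnorm H y)\<^sup>2"
    by (metis hnorm_sq_lincomb[OF assms] zero_le_power2)
  then have "(hnorm H x * hnorm H y) * Re (cinner H x y)
      \<le> (hnorm H x * hnorm H y) * (hnorm H x * hnorm H y)"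
    by (simp add: power2_eq_square algebra_simps)
  then show ?thesis by (simp only: mult_le_cancel_left_pos[OF pos])
qed

lemma hnorm_triangle:
  assumes "x \<in> carrier H" "y \<in> carrier H"
  shows "hnorm H (x \<oplus>\<^bsub>H\<^esub> y) \<le> hnorm H x + hnorm H y"
proof (rule power2_le_imp_le)
  show "(hnorm H (x \<oplus>\<^bsub>H\<^esub> y))\<^sup>2 \<le> (hnorm H x + hnorm H y)\<^sup>2"
    using hnorm_sq_lincomb[OF assms, of 1 1] Re_cinner_le[OF assms] assms
    by (simp add: scale_one power2_eq_square algebra_simps)
qed (simp add: hnorm_nonneg assms)

lemma hdist_metric: "Metric_space (carrier H) (hdist H)"
proof -
  interpret M: Module.module complex_field H by (rule vector_space)
  have 1: "hdist H x y \<ge> 0" for x y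
    by (simp add: hdist_def hnorm_nonneg)
  have 2: "hdist H x y = hdist H y x" for x y
  proof (cases "x \<in> carrier H \<and> y \<in> carrier H")
    case True
    have "(hnorm H (x \<ominus>\<^bsub>H\<^esub> y))\<^sup>2 = (hnorm H (y \<ominus>\<^bsub>H\<^esub> x))\<^sup>2"
      using hnorm_sq_lincomb[of x y 1 "-1"] hnorm_sq_lincomb[of y x 1 "-1"]
        cinner_commute[of x y] True
      by (simp add: a_minus_def uminus_eq_scale scale_one)
    then show ?thesis
      using True hnorm_nonneg by (simp add: hdist_def)
  qed (auto simp: hdist_def)
  have 3: "hdist H x y = 0 \<longleftrightarrow> x = y" if "x \<in> carrier H" "y \<in> carrier H" for x y
  proof -
    have "x \<ominus>\<^bsub>H\<^esub> y = \<zero>\<^bsub>H\<^esub> \<longleftrightarrow> x = y"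
      using that by (metis M.M.a_inv_closed M.M.minus_equality M.M.minus_minus M.M.r_neg a_minus_def)
    then show ?thesis
      using that hnorm_eq_0[of "x \<ominus>\<^bsub>H\<^esub> y"] by (simp add: hdist_def)
  qed
  have 4: "hdist H x z \<le> hdist H x y + hdist H y z"
    if "x \<in> carrier H" "y \<in> carrier H" "z \<in> carrier H" for x y z
  proof -
    have "x \<ominus>\<^bsub>H\<^esub> z = (x \<ominus>\<^bsub>H\<^esub> y) \<oplus>\<^bsub>H\<^esub> (y \<ominus>\<^bsub>H\<^esub> z)"
      using that by (simp add: a_minus_def M.a_assoc M.r_neg2 M.r_neg1)
    then show ?thesis
      using that hnorm_triangle[of "x \<ominus>\<^bsub>H\<^esub> y" "y \<ominus>\<^bsub>H\<^esub> z"] by (simp add: hdist_def)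
  qed
  show ?thesis
    by unfold_locales (use 1 2 3 4 in auto)
qed

end

locale hilbert_space = inner_product_space +
  assumes complete: "Metric_space.mcomplete (carrier H) (hdist H)"

locale separable_hilbert_space = hilbert_space +
  assumes separable: "separable_space (Metric_space.mtopology (carrier H) (hdist H))"

section \<open>Operators\<close>

text \<open>Operators are HOL functions of which only the values on the carrier matter.\<close>

definition linear_operator :: "'a cinner_space \<Rightarrow> 'b cinner_space \<Rightarrow> ('a \<Rightarrow> 'b) \<Rightarrow> bool" where
  "linear_operator H K A \<longleftrightarrow>
     A \<in> carrier H \<rightarrow> carrier K \<and>
     (\<forall>x\<in>carrier H. \<forall>y\<in>carrier H. A (x \<oplus>\<^bsub>H\<^esub> y) = A x \<oplus>\<^bsub>K\<^esub> A y) \<and>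
     (\<forall>c. \<forall>x\<in>carrier H. A (c \<odot>\<^bsub>H\<^esub> x) = c \<odot>\<^bsub>K\<^esub> A x)"

definition bounded_operator :: "'a cinner_space \<Rightarrow> ('a \<Rightarrow> 'a) \<Rightarrow> bool" where
  "bounded_operator H A \<longleftrightarrow>
     linear_operator H H A \<and> (\<exists>C. \<forall>x\<in>carrier H. hnorm H (A x) \<le> C * hnorm H x)"

definition contraction :: "'a cinner_space \<Rightarrow> ('a \<Rightarrow> 'a) \<Rightarrow> bool" where
  "contraction H A \<longleftrightarrow>
     linear_operator H H A \<and> (\<forall>x\<in>carrier H. hnorm H (A x) \<le> hnorm H x)"

definition hilbert_isometry :: "'a cinner_space \<Rightarrow> 'b cinner_space \<Rightarrow> ('a \<Rightarrow> 'b) \<Rightarrow> bool" where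
  "hilbert_isometry H K V \<longleftrightarrow>
     linear_operator H K V \<and> (\<forall>x\<in>carrier H. hnorm K (V x) = hnorm H x)"

text \<open>The adjoint; on a Hilbert space the description is proper for every bounded operator
  and every vector of the carrier, by the Riesz representation theorem.\<close>

definition adj :: "'a cinner_space \<Rightarrow> ('a \<Rightarrow> 'a) \<Rightarrow> 'a \<Rightarrow> 'a" where
  "adj H A y = (THE x. x \<in> carrier H \<and> (\<forall>u\<in>carrier H. cinner H (A u) y = cinner H u x))"

definition pure_contraction :: "'a cinner_space \<Rightarrow> ('a \<Rightarrow> 'a) \<Rightarrow> bool" where
  "pure_contraction H S \<longleftrightarrow>
     contraction H S \<and> (\<forall>x\<in>carrier H. (\<lambda>k. hnorm H ((adj H S ^^ k) x)) \<longlonglongrightarrow> 0)"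

text \<open>An \<open>n\<close>-tuple is a family indexed by \<open>{1..n}\<close>; its values at other indices are ignored.\<close>

primrec tuple_prod :: "nat \<Rightarrow> (nat \<Rightarrow> 'a \<Rightarrow> 'a) \<Rightarrow> 'a \<Rightarrow> 'a" where
  "tuple_prod 0 T = id"
| "tuple_prod (Suc n) T = tuple_prod n T \<circ> T (Suc n)"

definition commuting_tuple :: "nat \<Rightarrow> 'a cinner_space \<Rightarrow> (nat \<Rightarrow> 'a \<Rightarrow> 'a) \<Rightarrow> bool" where
  "commuting_tuple n H T \<longleftrightarrow>
     (\<forall>i\<in>{1..n}. \<forall>j\<in>{1..n}. \<forall>x\<in>carrier H. T i (T j x) = T j (T i x))"

definition class_B0 :: "nat \<Rightarrow> 'a cinner_space \<Rightarrow> (nat \<Rightarrow> 'a \<Rightarrow> 'a) set" where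
  "class_B0 n H = {T.
     (\<forall>i\<in>{1..n}. contraction H (T i)) \<and>
     commuting_tuple n H T \<and>
     (\<forall>i\<in>{1..n}. \<forall>j\<in>{1..n}. i \<noteq> j \<longrightarrow> (\<forall>x\<in>carrier H.
        x \<ominus>\<^bsub>H\<^esub> T i (adj H (T i) x) \<ominus>\<^bsub>H\<^esub> T j (adj H (T j) x)
          \<oplus>\<^bsub>H\<^esub> T i (T j (adj H (T i) (adj H (T j) x))) = \<zero>\<^bsub>H\<^esub>)) \<and>
     pure_contraction H (tuple_prod n T)}"

text \<open>Up to isomorphism, every separable Hilbert space has its carrier in the type
  \<open>nat \<Rightarrow> complex\<close>, so that quantifying existentially over the Hilbert space structures on this
  type amounts to quantifying over all separable Hilbert spaces.\<close>

lemma separable_hilbert_space_representable: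
  fixes H :: "'a cinner_space"
  assumes "separable_hilbert_space H"
  shows "\<exists>(E :: (nat \<Rightarrow> complex) cinner_space) V. separable_hilbert_space E \<and>
    hilbert_isometry H E V \<and> V ` carrier H = carrier E"
proof -
  interpret separable_hilbert_space H by fact
  interpret M: Module.module complex_field H by (rule vector_space)
  interpret D: Metric_space "carrier H" "hdist H" by (rule hdist_metric)
  obtain C where C: "countable C" "C \<subseteq> carrier H" "D.mtopology closure_of C = carrier H"
    using separable by (auto simp: separable_space_def)
  have "C \<noteq> {}" using C(3) M.zero_closed by auto
  define c where "c = from_nat_into C"
  have c: "range c = C" using C(1) \<open>C \<noteq> {}\<close> by (simp add: c_def)
  define j where "j x k = complex_of_real (hdist H x (c k))" for x k
  have inj: "inj_on j (carrier H)"
  proof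
    fix x y assume xy: "x \<in> carrier H" "y \<in> carrier H" and eq: "j x = j y"
    have "hdist H x y \<le> 2 * e" if "e > 0" for e
    proof -
      have "x \<in> D.mtopology closure_of C" using C(3) xy by simp
      then obtain u where "u \<in> C" "hdist H x u < e"
        using \<open>e > 0\<close> unfolding D.metric_closure_of by auto
      then obtain k where k: "hdist H x (c k) < e" using c by auto
      moreover have "hdist H y (c k) = hdist H x (c k)"
        using fun_cong[OF eq, of k] by (simp add: j_def)
      moreover have "c k \<in> carrier H" using c C(2) by auto
      ultimately show ?thesis
        using D.triangle[of x "c k" y] xy D.commute[of "c k" y] by simp
    qed
    note le = this
    have "hdist H x y \<le> 0"
    proof (rule field_le_epsilon)
      fix e :: real assume "0 < e"
      then show "hdist H x y \<le> 0 + e" using le[of "e / 2"] by linarith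
    qed
    then show "x = y" using xy D.zero[of x y] D.nonneg[of x y] by linarith
  qed
  define g where "g = inv_into (carrier H) j"
  have gj [simp]: "g (j x) = x" if "x \<in> carrier H" for x
    using inj that by (simp add: g_def)
  define E :: "(nat \<Rightarrow> complex) cinner_space" where
    "E = \<lparr>carrier = j ` carrier H, mult = undefined, one = undefined,
     zero = j \<zero>\<^bsub>H\<^esub>, add = (\<lambda>x y. j (g x \<oplus>\<^bsub>H\<^esub> g y)), smult = (\<lambda>a x. j (a \<odot>\<^bsub>H\<^esub> g x)),
     cinner = (\<lambda>x y. cinner H (g x) (g y))\<rparr>"
  have E [simp]: "carrier E = j ` carrier H" "\<zero>\<^bsub>E\<^esub> = j \<zero>\<^bsub>H\<^esub>"
    "x \<oplus>\<^bsub>E\<^esub> y = j (g x \<oplus>\<^bsub>H\<^esub> g y)" "a \<odot>\<^bsub>E\<^esub> x = j (a \<odot>\<^bsub>H\<^esub> g x)"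
    "cinner E x y = cinner H (g x) (g y)" for x y a
    by (simp_all add: E_def)
  have "abelian_group E"
  proof (rule abelian_groupI)
    fix x assume "x \<in> carrier E"
    then obtain u where "u \<in> carrier H" "x = j u" by auto
    then show "\<exists>y\<in>carrier E. y \<oplus>\<^bsub>E\<^esub> x = \<zero>\<^bsub>E\<^esub>"
      by (auto intro!: bexI[of _ "\<ominus>\<^bsub>H\<^esub> u"] simp: M.l_neg)
  qed (auto simp: M.a_assoc M.a_comm M.M.a_lcomm)
  then have mod: "Module.module complex_field E"
  proof (rule moduleI[OF M.R.is_cring])
    fix a x assume "x \<in> carrier E"
    then show "a \<odot>\<^bsub>E\<^esub> x \<in> carrier E"
      by (auto simp: scale_closed)
  next
    fix a b x assume "a \<in> carrier complex_field" "b \<in> carrier complex_field" "x \<in> carrier E"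
    then show "(a \<oplus>\<^bsub>complex_field\<^esub> b) \<odot>\<^bsub>E\<^esub> x = a \<odot>\<^bsub>E\<^esub> x \<oplus>\<^bsub>E\<^esub> b \<odot>\<^bsub>E\<^esub> x"
      and "(a \<otimes>\<^bsub>complex_field\<^esub> b) \<odot>\<^bsub>E\<^esub> x = a \<odot>\<^bsub>E\<^esub> (b \<odot>\<^bsub>E\<^esub> x)"
      by (auto simp: scale_closed M.smult_l_distr M.smult_assoc1)
  next
    fix a x y assume "a \<in> carrier complex_field" "x \<in> carrier E" "y \<in> carrier E"
    then show "a \<odot>\<^bsub>E\<^esub> (x \<oplus>\<^bsub>E\<^esub> y) = a \<odot>\<^bsub>E\<^esub> x \<oplus>\<^bsub>E\<^esub> a \<odot>\<^bsub>E\<^esub> y"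
      by (auto simp: scale_closed M.smult_r_distr)
  qed auto
  have ips: "inner_product_space E"
  proof (rule inner_product_space.intro)
    fix x y assume "x \<in> carrier E" "y \<in> carrier E"
    then obtain u v where uv: "u \<in> carrier H" "v \<in> carrier H" "x = j u" "y = j v" by auto
    then show "cinner E x y = cnj (cinner E y x)"
      using cinner_commute[of u v] by simp
    show "x = \<zero>\<^bsub>E\<^esub>" if "cinner E x x = 0"
      using that uv cinner_definite[of u] by simp
  qed (use mod in \<open>auto simp: cinner_add_left cinner_scale_left scale_closed cinner_nonneg\<close>)
  interpret E: inner_product_space E by (rule ips)
  interpret D': Metric_space "carrier E" "hdist E" by (rule E.hdist_metric)
  have norm: "hnorm E (j x) = hnorm H x" if "x \<in> carrier H" for x
    using that by (simp add: hnorm_def)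
  have dist: "hdist E (j x) (j y) = hdist H x y" if "x \<in> carrier H" "y \<in> carrier H" for x y
    using that E.uminus_eq_scale[of "j y"] norm[of "x \<ominus>\<^bsub>H\<^esub> y"]
    by (simp add: hdist_def a_minus_def uminus_eq_scale scale_closed)
  have lin: "linear_operator H E j"
    by (auto simp: linear_operator_def)
  have comp: "D'.mcomplete"
    unfolding D'.mcomplete_def
  proof (intro allI impI)
    fix \<sigma> assume \<sigma>: "D'.MCauchy \<sigma>"
    have ran: "\<sigma> n \<in> j ` carrier H" for n using \<sigma>[unfolded D'.MCauchy_def] by auto
    have g: "g (\<sigma> n) \<in> carrier H" "j (g (\<sigma> n)) = \<sigma> n" for n
      using ran[of n] by auto
    have gd: "hdist H (g (\<sigma> m)) (g (\<sigma> n)) = hdist E (\<sigma> m) (\<sigma> n)" for m n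
      using dist[of "g (\<sigma> m)" "g (\<sigma> n)"] g by simp
    have "D.MCauchy (\<lambda>n. g (\<sigma> n))"
      using \<sigma> g(1) unfolding D.MCauchy_def D'.MCauchy_def gd by auto
    then obtain l where l: "limitin D.mtopology (\<lambda>n. g (\<sigma> n)) l sequentially"
      using complete unfolding D.mcomplete_def by blast
    then have "l \<in> carrier H" unfolding D.limitin_metric by blast
    then have "hdist E (\<sigma> n) (j l) = hdist H (g (\<sigma> n)) l" for n
      using dist[of "g (\<sigma> n)" l] g by simp
    then have "limitin D'.mtopology \<sigma> (j l) sequentially"
      using l g(1) ran \<open>l \<in> carrier H\<close> unfolding D.limitin_metric D'.limitin_metric by simp
    then show "\<exists>x. limitin D'.mtopology \<sigma> x sequentially" by blast
  qed
  have dense: "\<exists>v\<in>C. v \<in> carrier H \<and> hdist H u v < r" if "u \<in> carrier H" "r > 0" for u r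
  proof -
    have "u \<in> D.mtopology closure_of C" using C(3) that by simp
    then show ?thesis using \<open>r > 0\<close> unfolding D.metric_closure_of by auto
  qed
  have "D'.mtopology closure_of (j ` C) = carrier E"
  proof (rule equalityI)
    show "carrier E \<subseteq> D'.mtopology closure_of (j ` C)"
    proof
      fix x assume "x \<in> carrier E"
      then obtain u where u: "u \<in> carrier H" "x = j u" by auto
      have "\<exists>y\<in>j ` C. y \<in> D'.mball x r" if "r > 0" for r
      proof -
        from dense[OF u(1) that] obtain v where "v \<in> C" "v \<in> carrier H" "hdist H u v < r"
          by blast
        then have "j v \<in> D'.mball x r"
          unfolding D'.in_mball using u dist[of u v] by auto
        then show ?thesis using \<open>v \<in> C\<close> by blast
      qed
      then show "x \<in> D'.mtopology closure_of (j ` C)"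
        using \<open>x \<in> carrier E\<close> unfolding D'.metric_closure_of by blast
    qed
  qed (metis D'.topspace_mtopology closure_of_subset_topspace)
  then have "separable_space D'.mtopology"
    unfolding separable_space_def
    using C(1,2) unfolding D'.topspace_mtopology by (intro exI[of _ "j ` C"]) auto
  then have "separable_hilbert_space E"
    using comp by unfold_locales
  moreover have "hilbert_isometry H E j"
    using lin norm by (simp add: hilbert_isometry_def)
  ultimately show ?thesis
    using E(1) by (intro exI[of _ E] exI[of _ j]) simp
qed

section \<open>The vector-valued Hardy space of the unit disc\<close>

abbreviation unit_disc :: "complex set" where
  "unit_disc \<equiv> ball 0 1"

definition hardy_series :: "'a cinner_space \<Rightarrow> (nat \<Rightarrow> 'a) \<Rightarrow> (complex \<Rightarrow> 'a) \<Rightarrow> bool" where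
  "hardy_series E a f \<longleftrightarrow>
     range a \<subseteq> carrier E \<and>
     summable (\<lambda>k. (hnorm E (a k))\<^sup>2) \<and>
     (\<forall>z\<in>unit_disc. limitin (Metric_space.mtopology (carrier E) (hdist E))
        (\<lambda>m. \<Oplus>\<^bsub>E\<^esub>k\<in>{..<m}. (z ^ k) \<odot>\<^bsub>E\<^esub> a k) (f z) sequentially)"

text \<open>The sequence of Taylor coefficients of \<open>f\<close>, which is unique.\<close>

definition hardy_coeff :: "'a cinner_space \<Rightarrow> (complex \<Rightarrow> 'a) \<Rightarrow> nat \<Rightarrow> 'a" where
  "hardy_coeff E f = (THE a. hardy_series E a f)"

text \<open>Functions on the disc are represented extensionally, so that equality of elements of the
  carrier is equality of functions on the disc.\<close>

definition hardy :: "'a cinner_space \<Rightarrow> (complex \<Rightarrow> 'a) cinner_space" where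
  "hardy E = \<lparr>
     carrier = {f \<in> unit_disc \<rightarrow>\<^sub>E carrier E. \<exists>a. hardy_series E a f},
     mult = undefined,
     one = undefined,
     zero = (\<lambda>z\<in>unit_disc. \<zero>\<^bsub>E\<^esub>),
     add = (\<lambda>f g. \<lambda>z\<in>unit_disc. f z \<oplus>\<^bsub>E\<^esub> g z),
     smult = (\<lambda>c f. \<lambda>z\<in>unit_disc. c \<odot>\<^bsub>E\<^esub> f z),
     cinner = (\<lambda>f g. \<Sum>k. cinner E (hardy_coeff E f k) (hardy_coeff E g k))\<rparr>"

text \<open>Bounded functions on the disc, with values in the bounded operators on \<open>E\<close>, which are
  complex differentiable at every point with respect to the operator norm (the bound
  \<open>\<epsilon> * hnorm E x\<close> for all \<open>x\<close> says that the operator norm is at most \<open>\<epsilon>\<close>).\<close>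

definition bounded_analytic :: "'a cinner_space \<Rightarrow> (complex \<Rightarrow> 'a \<Rightarrow> 'a) \<Rightarrow> bool" where
  "bounded_analytic E \<Phi> \<longleftrightarrow>
     (\<forall>z\<in>unit_disc. bounded_operator E (\<Phi> z)) \<and>
     (\<exists>C. \<forall>z\<in>unit_disc. \<forall>x\<in>carrier E. hnorm E (\<Phi> z x) \<le> C * hnorm E x) \<and>
     (\<forall>z\<in>unit_disc. \<exists>D. bounded_operator E D \<and>
        (\<forall>\<epsilon>>0. \<forall>\<^sub>F w in at z. \<forall>x\<in>carrier E.
           hnorm E (inverse (w - z) \<odot>\<^bsub>E\<^esub> (\<Phi> w x \<ominus>\<^bsub>E\<^esub> \<Phi> z x) \<ominus>\<^bsub>E\<^esub> D x) \<le> \<epsilon> * hnorm E x))"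

definition mult_op :: "(complex \<Rightarrow> 'a \<Rightarrow> 'a) \<Rightarrow> (complex \<Rightarrow> 'a) \<Rightarrow> complex \<Rightarrow> 'a" where
  "mult_op \<Phi> f = (\<lambda>z\<in>unit_disc. \<Phi> z (f z))"

definition hardy_shift :: "'a cinner_space \<Rightarrow> (complex \<Rightarrow> 'a) \<Rightarrow> complex \<Rightarrow> 'a" where
  "hardy_shift E = mult_op (\<lambda>z x. z \<odot>\<^bsub>E\<^esub> x)"

definition BCL_tuple :: "nat \<Rightarrow> 'a cinner_space \<Rightarrow> (nat \<Rightarrow> complex \<Rightarrow> 'a \<Rightarrow> 'a) \<Rightarrow> bool" where
  "BCL_tuple n E \<Phi> \<longleftrightarrow>
     (\<forall>i\<in>{1..n}. bounded_analytic E (\<Phi> i)) \<and>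
     (\<forall>i\<in>{1..n}. hilbert_isometry (hardy E) (hardy E) (mult_op (\<Phi> i))) \<and>
     commuting_tuple n (hardy E) (\<lambda>i. mult_op (\<Phi> i)) \<and>
     (\<forall>f\<in>carrier (hardy E). tuple_prod n (\<lambda>i. mult_op (\<Phi> i)) f = hardy_shift E f)"

end

(*
Write A_i for the adjoint of T_i, D_i = I - T_i A_i and R = A_1 ... A_n. The hypothesis on the pairs
says that D_i = T_j D_i A_j for i and j distinct, so A_j is isometric for the semi-inner product
<D_i x, y>; moreover I - R^* R telescopes into D_1 + ... + D_n. Let E_i be the Hilbert space obtained
from this semi-inner product by making the commuting isometries A_j (j distinct from i) invertible,
i.e. by inverting their product S_i, and let E be the direct sum of the E_i, with coordinate
projections P_i. Let U_j be the unitary of E that acts as A_j on the E_i with i distinct from j and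
as the inverse of S_j on E_j. These unitaries commute with each other and with the projections, and
their product is the identity. Hence the symbols U_j^{-1} ((I - P_j) + z P_j) define a BCL tuple;
the defect operators of its members are the projections onto the constants in E_j, which gives the
defect identity. If Q : H -> E is induced by h |-> (h, ..., h), then |Q h|^2 = |h|^2 - |R h|^2, so
by purity h |-> sum_k z^k Q R^k h is an isometry, and it intertwines the adjoints because
Q A_j = U_j ((I - P_j) Q + P_j Q R).
*)
theory Submission
  imports Defs
begin

section \<open>Hilbert space preliminaries\<close>

text \<open>Working with the forms \<open><D_i x, y>\<close> avoids square roots of the
  \<open>D_i\<close>. The obstacle is that the \<open>A_j\<close> induce mere isometries for these
  forms, whereas the product of the multipliers is \<open>M_z\<close> only if their constant unitary
  factors multiply to the identity. Hence the isometries are made invertible, and on the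
  \<open>j\<close>-th summand \<open>U_j\<close> has to undo the product of all the others, which is
  the inverse of \<open>S_j\<close>. A single denominator per summand is enough, because every
  \<open>A_j\<close> with \<open>j \<noteq> i\<close> divides \<open>S_i\<close>. The relation for
  \<open>Q A_j\<close> can be seen by coordinates: off \<open>j\<close> both sides are
  \<open>A_j h\<close>, and in coordinate \<open>j\<close> it says that \<open>R = S_j A_j\<close>.

  Null vectors are not divided out. The completion consists of functionals, which cannot see them,
  so the laws of fractions have to hold only up to null vectors. On the Hardy space all identities
  are checked on Taylor coefficients, and these are identified by testing against vectors, which
  leaves scalar power series.\<close>

context inner_product_space
begin

interpretation M: Module.module complex_field H by (rule vector_space)

lemma zero_carrier: "\<zero>\<^bsub>H\<^esub> \<in> carrier H"
  by simp

lemma add_carrier: "\<lbrakk>x \<in> carrier H; y \<in> carrier H\<rbrakk> \<Longrightarrow> x \<oplus>\<^bsub>H\<^esub> y \<in> carrier H"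
  by simp

lemma minus_carrier: "\<lbrakk>x \<in> carrier H; y \<in> carrier H\<rbrakk> \<Longrightarrow> x \<ominus>\<^bsub>H\<^esub> y \<in> carrier H"
  by simp

lemmas carrier_intros = zero_carrier add_carrier minus_carrier scale_closed

lemma cinner_zero_left: "y \<in> carrier H \<Longrightarrow> cinner H \<zero>\<^bsub>H\<^esub> y = 0"
  using cinner_add_left[of "\<zero>\<^bsub>H\<^esub>" "\<zero>\<^bsub>H\<^esub>" y] by simp

lemma cinner_zero_right: "y \<in> carrier H \<Longrightarrow> cinner H y \<zero>\<^bsub>H\<^esub> = 0"
  using cinner_add_right[of "\<zero>\<^bsub>H\<^esub>" "\<zero>\<^bsub>H\<^esub>" y] by simp

lemma cinner_minus_left:
  "\<lbrakk>x \<in> carrier H; y \<in> carrier H; z \<in> carrier H\<rbrakk> \<Longrightarrow>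
    cinner H (x \<ominus>\<^bsub>H\<^esub> y) z = cinner H x z - cinner H y z"
  by (simp add: a_minus_def uminus_eq_scale cinner_add_left cinner_scale_left scale_closed)

lemma cinner_minus_right:
  "\<lbrakk>x \<in> carrier H; y \<in> carrier H; z \<in> carrier H\<rbrakk> \<Longrightarrow>
    cinner H z (x \<ominus>\<^bsub>H\<^esub> y) = cinner H z x - cinner H z y"
  by (simp add: a_minus_def uminus_eq_scale cinner_add_right cinner_scale_right scale_closed)

lemmas cinner_simps = cinner_zero_left cinner_zero_right cinner_add_left cinner_add_right
  cinner_minus_left cinner_minus_right cinner_scale_left cinner_scale_right carrier_intros

text \<open>Testing against all vectors reduces vector identities to identities between complex
  numbers, which the simplifier handles better than those of modules.\<close>

lemma vec_eqI:
  assumes "x \<in> carrier H" "y \<in> carrier H"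
    and "\<And>u. u \<in> carrier H \<Longrightarrow> cinner H x u = cinner H y u"
  shows "x = y"
proof -
  have "x \<ominus>\<^bsub>H\<^esub> y = \<zero>\<^bsub>H\<^esub>"
    by (rule cinner_definite) (use assms in \<open>simp_all add: cinner_minus_left\<close>)
  then show ?thesis
    using assms(1,2) by (metis M.M.a_inv_closed M.M.minus_equality M.M.minus_minus M.M.r_neg a_minus_def)
qed

lemma norm_sq: "x \<in> carrier H \<Longrightarrow> (hnorm H x)\<^sup>2 = Re (cinner H x x)"
  by (simp add: hnorm_def cinner_nonneg)

lemma norm_minus_sq:
  assumes "x \<in> carrier H" "y \<in> carrier H"
  shows "(hnorm H (x \<ominus>\<^bsub>H\<^esub> y))\<^sup>2 = (hnorm H x)\<^sup>2 - 2 * Re (cinner H x y) + (hnorm H y)\<^sup>2"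
  using assms cinner_commute[of x y]
  by (simp add: norm_sq cinner_simps)

lemma norm_add_sq:
  assumes "x \<in> carrier H" "y \<in> carrier H"
  shows "(hnorm H (x \<oplus>\<^bsub>H\<^esub> y))\<^sup>2 = (hnorm H x)\<^sup>2 + 2 * Re (cinner H x y) + (hnorm H y)\<^sup>2"
  using assms cinner_commute[of x y]
  by (simp add: norm_sq cinner_simps)

lemma norm_zero: "hnorm H \<zero>\<^bsub>H\<^esub> = 0"
  using hnorm_eq_0[of "\<zero>\<^bsub>H\<^esub>"] by simp

lemma norm_scale:
  assumes "x \<in> carrier H"
  shows "hnorm H (c \<odot>\<^bsub>H\<^esub> x) = cmod c * hnorm H x"
proof (rule power2_eq_imp_eq)
  have "cinner H (c \<odot>\<^bsub>H\<^esub> x) (c \<odot>\<^bsub>H\<^esub> x) = (c * cnj c) * cinner H x x"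
    using assms by (simp add: cinner_simps)
  then show "(hnorm H (c \<odot>\<^bsub>H\<^esub> x))\<^sup>2 = (cmod c * hnorm H x)\<^sup>2"
    using assms by (simp add: norm_sq scale_closed complex_norm_square[symmetric] power_mult_distrib
        del: of_real_power)
qed (use assms in \<open>simp_all add: hnorm_nonneg scale_closed\<close>)

lemma norm_minus_commute:
  assumes "x \<in> carrier H" "y \<in> carrier H"
  shows "hnorm H (x \<ominus>\<^bsub>H\<^esub> y) = hnorm H (y \<ominus>\<^bsub>H\<^esub> x)"
proof (rule power2_eq_imp_eq)
  show "(hnorm H (x \<ominus>\<^bsub>H\<^esub> y))\<^sup>2 = (hnorm H (y \<ominus>\<^bsub>H\<^esub> x))\<^sup>2"
    using assms cinner_commute[of x y] by (simp add: norm_minus_sq)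
qed (use assms in \<open>simp_all add: hnorm_nonneg\<close>)

lemma norm_minus_triangle:
  assumes "x \<in> carrier H" "y \<in> carrier H" "z \<in> carrier H"
  shows "hnorm H (x \<ominus>\<^bsub>H\<^esub> z) \<le> hnorm H (x \<ominus>\<^bsub>H\<^esub> y) + hnorm H (y \<ominus>\<^bsub>H\<^esub> z)"
proof -
  have "x \<ominus>\<^bsub>H\<^esub> z = (x \<ominus>\<^bsub>H\<^esub> y) \<oplus>\<^bsub>H\<^esub> (y \<ominus>\<^bsub>H\<^esub> z)"
    by (rule vec_eqI) (use assms in \<open>simp_all add: cinner_simps\<close>)
  then show ?thesis
    using hnorm_triangle[of "x \<ominus>\<^bsub>H\<^esub> y" "y \<ominus>\<^bsub>H\<^esub> z"] assms by simp
qed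

lemma cauchy_schwarz:
  assumes "x \<in> carrier H" "y \<in> carrier H"
  shows "cmod (cinner H x y) \<le> hnorm H x * hnorm H y"
proof (cases "cinner H x y = 0")
  case True
  then show ?thesis using assms by (simp add: hnorm_nonneg)
next
  case False
  \<comment> \<open>The unimodular factor that turns \<open>cinner H x y\<close> onto the positive
    real axis, where the bound for real parts applies.\<close>
  define c where "c = cnj (cinner H x y) / cmod (cinner H x y)"
  have "c * cinner H x y = (cmod (cinner H x y))\<^sup>2 / cmod (cinner H x y)"
    by (simp add: c_def complex_norm_square mult.commute del: of_real_power)
  also have "\<dots> = cmod (cinner H x y)" by (simp add: power2_eq_square)
  finally have "Re (cinner H (c \<odot>\<^bsub>H\<^esub> x) y) = cmod (cinner H x y)"
    using assms by (simp add: cinner_scale_left)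
  moreover have "cmod c = 1"
    using False by (simp add: c_def norm_divide)
  ultimately show ?thesis
    using Re_cinner_le[of "c \<odot>\<^bsub>H\<^esub> x" y] assms by (simp add: norm_scale scale_closed)
qed

text \<open>Off the carrier \<open>hdist\<close> has the default value 0, so it agrees with the norm
  of the difference only at those indices where the sequence lies in the carrier; for a limit it is
  enough that this holds eventually.\<close>

lemma limitin_iff_norm:
  "limitin (Metric_space.mtopology (carrier H) (hdist H)) s l sequentially \<longleftrightarrow>
    l \<in> carrier H \<and> (\<forall>\<^sub>F k in sequentially. s k \<in> carrier H) \<and>
    (\<lambda>k. hnorm H (s k \<ominus>\<^bsub>H\<^esub> l)) \<longlonglongrightarrow> 0"
proof -
  interpret D: Metric_space "carrier H" "hdist H" by (rule hdist_metric)
  have "(\<lambda>k. hdist H (s k) l) \<longlonglongrightarrow> 0 \<longleftrightarrow> (\<lambda>k. hnorm H (s k \<ominus>\<^bsub>H\<^esub> l)) \<longlonglongrightarrow> 0"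
    if "l \<in> carrier H" "\<forall>\<^sub>F k in sequentially. s k \<in> carrier H"
    by (rule tendsto_cong) (use that in \<open>auto simp: hdist_def elim: eventually_mono\<close>)
  then show ?thesis
    unfolding D.limitin_metric_dist_null by blast
qed

lemma tendsto_norm_imp_weak:
  assumes "l \<in> carrier H" "\<And>k. s k \<in> carrier H" "u \<in> carrier H"
    and "(\<lambda>k. hnorm H (s k \<ominus>\<^bsub>H\<^esub> l)) \<longlonglongrightarrow> 0"
  shows "(\<lambda>k. cinner H (s k) u) \<longlonglongrightarrow> cinner H l u"
proof -
  have "(\<lambda>k. cinner H (s k) u - cinner H l u) \<longlonglongrightarrow> 0"
  proof (rule Lim_null_comparison)
    show "\<forall>\<^sub>F k in sequentially. cmod (cinner H (s k) u - cinner H l u)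
        \<le> hnorm H (s k \<ominus>\<^bsub>H\<^esub> l) * hnorm H u"
      using cauchy_schwarz[of "s _ \<ominus>\<^bsub>H\<^esub> l" u] assms(1-3) by (simp add: cinner_minus_left)
    show "(\<lambda>k. hnorm H (s k \<ominus>\<^bsub>H\<^esub> l) * hnorm H u) \<longlonglongrightarrow> 0"
      using tendsto_mult_left_zero[OF assms(4)] .
  qed
  then show ?thesis by (rule LIM_zero_cancel)
qed

lemma cinner_finsum_left:
  assumes "\<And>k. a k \<in> carrier H" "u \<in> carrier H"
  shows "cinner H (\<Oplus>\<^bsub>H\<^esub>k\<in>{..<m::nat}. a k) u = (\<Sum>k<m. cinner H (a k) u)"
proof (induction m)
  case 0
  show ?case using assms by (simp add: cinner_zero_left)
next
  case (Suc m)
  have "(\<Oplus>\<^bsub>H\<^esub>k\<in>{..<Suc m}. a k) = a m \<oplus>\<^bsub>H\<^esub> (\<Oplus>\<^bsub>H\<^esub>k\<in>{..<m}. a k)"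
    unfolding lessThan_Suc by (rule M.finsum_insert) (use assms in auto)
  then show ?case
    using Suc assms by (simp add: cinner_add_left M.finsum_closed Pi_def)
qed

lemma finsum_carrier: "(\<And>k. a k \<in> carrier H) \<Longrightarrow> (\<Oplus>\<^bsub>H\<^esub>k\<in>{..<m::nat}. a k) \<in> carrier H"
  by (rule M.finsum_closed) auto

end

context hilbert_space
begin

lemma cauchy_norm_convergent:
  assumes s: "\<And>k::nat. s k \<in> carrier H"
    and "\<And>e. e > 0 \<Longrightarrow> \<exists>N. \<forall>k\<ge>N. \<forall>m\<ge>N. hnorm H (s k \<ominus>\<^bsub>H\<^esub> s m) < e"
  obtains l where "l \<in> carrier H" "(\<lambda>k. hnorm H (s k \<ominus>\<^bsub>H\<^esub> l)) \<longlonglongrightarrow> 0"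
proof -
  interpret D: Metric_space "carrier H" "hdist H" by (rule hdist_metric)
  have "D.MCauchy s"
    unfolding D.MCauchy_def using assms by (auto simp: hdist_def)
  then obtain l where "limitin D.mtopology s l sequentially"
    using complete unfolding D.mcomplete_def by blast
  then show ?thesis
    using that unfolding limitin_iff_norm by blast
qed

text \<open>The representing vector minimizes the functional \<open>J\<close> below; a minimizing sequence is
  Cauchy by the parallelogram identity.\<close>

theorem riesz_representation:
  assumes add: "\<And>x y. \<lbrakk>x \<in> carrier H; y \<in> carrier H\<rbrakk> \<Longrightarrow> f (x \<oplus>\<^bsub>H\<^esub> y) = f x + f y"
    and scale: "\<And>c x. x \<in> carrier H \<Longrightarrow> f (c \<odot>\<^bsub>H\<^esub> x) = c * f x"
    and bound: "\<And>x. x \<in> carrier H \<Longrightarrow> cmod (f x) \<le> C * hnorm H x"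
  obtains w where "w \<in> carrier H" "\<And>u. u \<in> carrier H \<Longrightarrow> f u = cinner H u w"
proof -
  define J where "J x = (hnorm H x)\<^sup>2 - 2 * Re (f x)" for x
  have "- C\<^sup>2 \<le> J x" if "x \<in> carrier H" for x
  proof -
    have "Re (f x) \<le> C * hnorm H x"
      using bound[OF that] complex_Re_le_cmod[of "f x"] by linarith
    then have "(hnorm H x - C)\<^sup>2 - C\<^sup>2 \<le> J x"
      by (simp add: J_def power2_eq_square algebra_simps)
    then show ?thesis by (smt (verit) zero_le_power2)
  qed
  then have bdd: "bdd_below (J ` carrier H)" by (intro bdd_belowI) auto
  define m where "m = Inf (J ` carrier H)"
  have m: "m \<le> J x" if "x \<in> carrier H" for x
    unfolding m_def using bdd that by (simp add: cInf_lower)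
  have "\<exists>x\<in>carrier H. J x < m + e" if "e > 0" for e
    using cInf_lessD[of "J ` carrier H" "m + e"] that zero_carrier by (auto simp: m_def)
  then have "\<exists>x\<in>carrier H. J x < m + inverse (real (Suc k))" for k by simp
  then obtain s where s: "\<And>k. s k \<in> carrier H" "\<And>k. J (s k) < m + inverse (real (Suc k))"
    by metis
  have par: "(hnorm H (x \<ominus>\<^bsub>H\<^esub> y))\<^sup>2 = 2 * J x + 2 * J y - 4 * J ((1/2) \<odot>\<^bsub>H\<^esub> (x \<oplus>\<^bsub>H\<^esub> y))"
    if "x \<in> carrier H" "y \<in> carrier H" for x y
    using that cinner_commute[of x y]
    by (simp add: J_def norm_minus_sq add scale norm_sq cinner_simps field_simps)
  have dist: "(hnorm H (s k \<ominus>\<^bsub>H\<^esub> s l))\<^sup>2 < 2 * inverse (real (Suc k)) + 2 * inverse (real (Suc l))" for k l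
    using par[OF s(1) s(1), of k l] s(2)[of k] s(2)[of l]
      m[of "(1/2) \<odot>\<^bsub>H\<^esub> (s k \<oplus>\<^bsub>H\<^esub> s l)"] s(1) by (simp add: carrier_intros)
  obtain w where w: "w \<in> carrier H" "(\<lambda>k. hnorm H (s k \<ominus>\<^bsub>H\<^esub> w)) \<longlonglongrightarrow> 0"
  proof (rule cauchy_norm_convergent[of s])
    fix e :: real assume "e > 0"
    then obtain N where N: "inverse (real (Suc N)) < e\<^sup>2 / 4"
      using reals_Archimedean[of "e\<^sup>2 / 4"] by auto
    have "hnorm H (s k \<ominus>\<^bsub>H\<^esub> s l) < e" if "k \<ge> N" "l \<ge> N" for k l
    proof (rule power2_less_imp_less)
      have "inverse (real (Suc k)) \<le> inverse (real (Suc N))"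
        "inverse (real (Suc l)) \<le> inverse (real (Suc N))"
        using that by simp_all
      then show "(hnorm H (s k \<ominus>\<^bsub>H\<^esub> s l))\<^sup>2 < e\<^sup>2"
        using dist[of k l] N by linarith
    qed (use \<open>e > 0\<close> in simp)
    then show "\<exists>N. \<forall>k\<ge>N. \<forall>m\<ge>N. hnorm H (s k \<ominus>\<^bsub>H\<^esub> s m) < e" by blast
  qed (use s in auto)
  have Re: "Re (f u) = Re (cinner H u w)" if u: "u \<in> carrier H" for u
  proof -
    define d where "d = Re (cinner H w u) - Re (f u)"
    \<comment> \<open>\<open>m\<close> bounds \<open>J\<close> from below at the perturbed
      minimizing vectors \<open>s k + t u\<close>, while \<open>J (s k)\<close> exceeds
      \<open>m\<close> by less than \<open>1 / (k + 1)\<close>. Letting \<open>k\<close> grow gives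
      the first variation at \<open>w\<close> from weak convergence alone.\<close>
    have *: "0 \<le> 2 * t * d + t\<^sup>2 * (hnorm H u)\<^sup>2" for t
    proof (rule tendsto_lowerbound[of _ _ sequentially])
      have "0 \<le> 2 * t * (Re (cinner H (s k) u) - Re (f u)) + t\<^sup>2 * (hnorm H u)\<^sup>2
          + inverse (real (Suc k))" for k
      proof -
        have "m \<le> J (s k \<oplus>\<^bsub>H\<^esub> complex_of_real t \<odot>\<^bsub>H\<^esub> u)"
          using m s(1) u by (simp add: carrier_intros)
        also have "\<dots> = J (s k) + 2 * t * (Re (cinner H (s k) u) - Re (f u)) + t\<^sup>2 * (hnorm H u)\<^sup>2"
          using s(1) u
          by (simp add: J_def norm_add_sq add scale carrier_intros cinner_scale_right norm_scale
              power_mult_distrib algebra_simps)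
        finally show ?thesis using s(2)[of k] by linarith
      qed
      then show "\<forall>\<^sub>F k in sequentially. 0 \<le> 2 * t * (Re (cinner H (s k) u) - Re (f u))
          + t\<^sup>2 * (hnorm H u)\<^sup>2 + inverse (real (Suc k))" by simp
      have "(\<lambda>k. cinner H (s k) u) \<longlonglongrightarrow> cinner H w u"
        by (rule tendsto_norm_imp_weak) (use w s u in auto)
      then have "(\<lambda>k. Re (cinner H (s k) u)) \<longlonglongrightarrow> Re (cinner H w u)"
        by (rule tendsto_Re)
      then have "(\<lambda>k. 2 * t * (Re (cinner H (s k) u) - Re (f u)) + t\<^sup>2 * (hnorm H u)\<^sup>2
          + inverse (real (Suc k))) \<longlonglongrightarrow> 2 * t * (Re (cinner H w u) - Re (f u)) + t\<^sup>2 * (hnorm H u)\<^sup>2 + 0"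
        by (intro tendsto_add tendsto_mult tendsto_diff tendsto_const LIMSEQ_inverse_real_of_nat)
      then show "(\<lambda>k. 2 * t * (Re (cinner H (s k) u) - Re (f u)) + t\<^sup>2 * (hnorm H u)\<^sup>2
          + inverse (real (Suc k))) \<longlonglongrightarrow> 2 * t * d + t\<^sup>2 * (hnorm H u)\<^sup>2"
        by (simp add: d_def)
    qed simp
    have "d = 0"
    proof (rule ccontr)
      assume "d \<noteq> 0"
      \<comment> \<open>The choice \<open>t = - d / N\<close> bounds the quadratic by
        \<open>- d^2 / N\<close>; the added 1 keeps \<open>N\<close> positive when \<open>u\<close>
        is zero.\<close>
      define N where "N = (hnorm H u)\<^sup>2 + 1"
      have "N > 0" by (simp add: N_def add_nonneg_pos)
      have "0 \<le> 2 * (- d / N) * d + (- d / N)\<^sup>2 * N"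
        using *[of "- d / N"] unfolding N_def by (smt (verit) mult_left_mono zero_le_power2)
      also have "\<dots> = - (d\<^sup>2 / N)"
        using \<open>N > 0\<close> by (simp add: field_simps power2_eq_square)
      finally show False
        using \<open>d \<noteq> 0\<close> \<open>N > 0\<close> by (simp add: divide_le_0_iff)
    qed
    then show ?thesis
      using cinner_commute[OF w(1) u] by (simp add: d_def)
  qed
  have "f u = cinner H u w" if u: "u \<in> carrier H" for u
  proof (rule complex_eqI)
    show "Re (f u) = Re (cinner H u w)" by (rule Re[OF u])
    show "Im (f u) = Im (cinner H u w)"
      using Re[of "\<i> \<odot>\<^bsub>H\<^esub> u"] u w(1) by (simp add: scale scale_closed cinner_scale_left)
  qed
  then show ?thesis using that w(1) by blast
qed

end

section \<open>Linear operators and adjoints of contractions\<close>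

lemma linear_operatorD:
  assumes "linear_operator H K A"
  shows "x \<in> carrier H \<Longrightarrow> A x \<in> carrier K"
    and "\<lbrakk>x \<in> carrier H; y \<in> carrier H\<rbrakk> \<Longrightarrow> A (x \<oplus>\<^bsub>H\<^esub> y) = A x \<oplus>\<^bsub>K\<^esub> A y"
    and "x \<in> carrier H \<Longrightarrow> A (c \<odot>\<^bsub>H\<^esub> x) = c \<odot>\<^bsub>K\<^esub> A x"
  using assms unfolding linear_operator_def by blast+

lemma linear_operatorI:
  assumes "\<And>x. x \<in> carrier H \<Longrightarrow> A x \<in> carrier K"
    and "\<And>x y. \<lbrakk>x \<in> carrier H; y \<in> carrier H\<rbrakk> \<Longrightarrow> A (x \<oplus>\<^bsub>H\<^esub> y) = A x \<oplus>\<^bsub>K\<^esub> A y"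
    and "\<And>c x. x \<in> carrier H \<Longrightarrow> A (c \<odot>\<^bsub>H\<^esub> x) = c \<odot>\<^bsub>K\<^esub> A x"
  shows "linear_operator H K A"
  using assms unfolding linear_operator_def by blast

context inner_product_space
begin

text \<open>A representing vector is determined by its inner products, so exhibiting one evaluates
  the definite description. On the Hardy space the adjoints are found in this way, from explicit
  Taylor coefficients.\<close>

lemma adj_eqI:
  assumes "x \<in> carrier H" "\<And>u. u \<in> carrier H \<Longrightarrow> cinner H (A u) y = cinner H u x"
  shows "adj H A y = x"
  unfolding adj_def
proof (rule the_equality)
  fix x' assume x': "x' \<in> carrier H \<and> (\<forall>u\<in>carrier H. cinner H (A u) y = cinner H u x')"
  show "x' = x"
  proof (rule vec_eqI)
    fix u assume "u \<in> carrier H"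
    then have "cinner H u x' = cinner H u x" using x' assms by simp
    then show "cinner H x' u = cinner H x u"
      using cinner_commute \<open>u \<in> carrier H\<close> x' assms(1) by metis
  qed (use x' assms in auto)
qed (use assms in auto)

lemma contractionD:
  assumes "contraction H A"
  shows "linear_operator H H A" "x \<in> carrier H \<Longrightarrow> A x \<in> carrier H"
    "x \<in> carrier H \<Longrightarrow> hnorm H (A x) \<le> hnorm H x"
  using assms linear_operatorD[of H H A] unfolding contraction_def by auto

end

context hilbert_space
begin

lemma adj_contraction:
  assumes "contraction H A" "y \<in> carrier H"
  shows "adj H A y \<in> carrier H"
    and "u \<in> carrier H \<Longrightarrow> cinner H (A u) y = cinner H u (adj H A y)"
proof -
  note A = contractionD[OF assms(1)] and lin = linear_operatorD[OF contractionD(1)[OF assms(1)]]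
  obtain w where w: "w \<in> carrier H" "\<And>u. u \<in> carrier H \<Longrightarrow> cinner H (A u) y = cinner H u w"
  proof (rule riesz_representation[of "\<lambda>u. cinner H (A u) y" "hnorm H y"])
    fix x assume x: "x \<in> carrier H"
    have "cmod (cinner H (A x) y) \<le> hnorm H (A x) * hnorm H y"
      using A(2) x assms(2) by (simp add: cauchy_schwarz)
    also have "\<dots> \<le> hnorm H x * hnorm H y"
      using A(3) x assms(2) by (simp add: mult_right_mono hnorm_nonneg)
    finally show "cmod (cinner H (A x) y) \<le> hnorm H y * hnorm H x"
      by (simp add: mult.commute)
  qed (use lin assms(2) in \<open>simp_all add: cinner_simps\<close>)
  moreover have "adj H A y = w"
    by (rule adj_eqI) (use w in auto)
  ultimately show "adj H A y \<in> carrier H"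
    and "u \<in> carrier H \<Longrightarrow> cinner H (A u) y = cinner H u (adj H A y)"
    by simp_all
qed

lemma cinner_adj_left:
  assumes "contraction H A" "x \<in> carrier H" "y \<in> carrier H"
  shows "cinner H (adj H A x) y = cinner H x (A y)"
  using adj_contraction[OF assms(1,2)] assms(3) contractionD(2)[OF assms(1)]
  by (metis cinner_commute assms(2))

lemma contraction_adj:
  assumes "contraction H A"
  shows "contraction H (adj H A)"
  unfolding contraction_def
proof (intro conjI ballI)
  note [simp] = adj_contraction(1)[OF assms] contractionD(2)[OF assms] cinner_adj_left[OF assms]
  show "linear_operator H H (adj H A)"
  proof (rule linear_operatorI)
    fix x y assume "x \<in> carrier H" "y \<in> carrier H"
    then show "adj H A (x \<oplus>\<^bsub>H\<^esub> y) = adj H A x \<oplus>\<^bsub>H\<^esub> adj H A y"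
      by (intro vec_eqI) (simp_all add: cinner_simps)
  next
    fix c x assume "x \<in> carrier H"
    then show "adj H A (c \<odot>\<^bsub>H\<^esub> x) = c \<odot>\<^bsub>H\<^esub> adj H A x"
      by (intro vec_eqI) (simp_all add: cinner_simps)
  qed simp
  fix x assume x: "x \<in> carrier H"
  have "hnorm H (adj H A x) * hnorm H (adj H A x) = cmod (cinner H (adj H A x) (adj H A x))"
    using cinner_self[of "adj H A x"] x by (simp add: power2_eq_square norm_mult hnorm_nonneg)
  also have "\<dots> = cmod (cinner H x (A (adj H A x)))"
    using x by simp
  also have "\<dots> \<le> hnorm H x * hnorm H (A (adj H A x))"
    using x by (simp add: cauchy_schwarz)
  also have "\<dots> \<le> hnorm H x * hnorm H (adj H A x)"
    using x contractionD(3)[OF assms] by (simp add: mult_left_mono hnorm_nonneg)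
  finally have "hnorm H (adj H A x) * hnorm H (adj H A x) \<le> hnorm H x * hnorm H (adj H A x)" .
  then show "hnorm H (adj H A x) \<le> hnorm H x"
    using hnorm_nonneg[of "adj H A x"] hnorm_nonneg[OF x] x
    by (cases "hnorm H (adj H A x) = 0") auto
qed

end

section \<open>Completion of a semi-inner product space\<close>

text \<open>The operations need not satisfy the axioms of a vector space: these hold up to null vectors,
  and that suffices.\<close>

locale semi_inner_product =
  fixes X :: "'x set" and B :: "'x \<Rightarrow> 'x \<Rightarrow> complex"
    and add :: "'x \<Rightarrow> 'x \<Rightarrow> 'x" and scl :: "complex \<Rightarrow> 'x \<Rightarrow> 'x"
  assumes nonempty: "X \<noteq> {}"
    and add_closed: "\<lbrakk>x \<in> X; y \<in> X\<rbrakk> \<Longrightarrow> add x y \<in> X"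
    and scl_closed: "x \<in> X \<Longrightarrow> scl c x \<in> X"
    and form_add_left: "\<lbrakk>x \<in> X; y \<in> X; z \<in> X\<rbrakk> \<Longrightarrow> B (add x y) z = B x z + B y z"
    and form_scl_left: "\<lbrakk>x \<in> X; z \<in> X\<rbrakk> \<Longrightarrow> B (scl c x) z = c * B x z"
    and form_commute: "\<lbrakk>x \<in> X; y \<in> X\<rbrakk> \<Longrightarrow> B x y = cnj (B y x)"
    and form_nonneg: "x \<in> X \<Longrightarrow> 0 \<le> Re (B x x)"
begin

text \<open>The squared seminorm of \<open>x - y\<close>, kept expanded in values of the form: maps
  that preserve the form then visibly preserve it, and limits can be taken term by term.\<close>

definition sqdist :: "'x \<Rightarrow> 'x \<Rightarrow> real" where
  "sqdist x y = Re (B x x) - 2 * Re (B x y) + Re (B y y)"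

definition seminorm :: "'x \<Rightarrow> real" where
  "seminorm x = sqrt (Re (B x x))"

lemma form_add_right: "\<lbrakk>x \<in> X; y \<in> X; z \<in> X\<rbrakk> \<Longrightarrow> B z (add x y) = B z x + B z y"
  by (metis add_closed complex_cnj_add form_add_left form_commute)

lemma form_scl_right: "\<lbrakk>x \<in> X; z \<in> X\<rbrakk> \<Longrightarrow> B z (scl c x) = cnj c * B z x"
  by (metis complex_cnj_mult form_commute form_scl_left scl_closed)

lemmas form_simps = form_add_left form_add_right form_scl_left form_scl_right add_closed scl_closed

lemma Re_form_commute: "\<lbrakk>x \<in> X; y \<in> X\<rbrakk> \<Longrightarrow> Re (B x y) = Re (B y x)"
  using form_commute[of x y] by simp

text \<open>The squared norm of \<open>x - t c y\<close> with \<open>c = B x y\<close> is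
  nonnegative for all real \<open>t\<close>. If \<open>y\<close> is not null, the optimal
  \<open>t\<close> gives the bound. If \<open>y\<close> is null, the expression is affine in
  \<open>t\<close>, and unless \<open>c = 0\<close> a suitable \<open>t\<close> brings it down to
  -1.\<close>

lemma form_cauchy_schwarz:
  assumes x: "x \<in> X" and y: "y \<in> X"
  shows "cmod (B x y) \<le> seminorm x * seminorm y"
proof -
  define c where "c = B x y"
  have *: "0 \<le> Re (B x x) - 2 * t * (cmod c)\<^sup>2 + t\<^sup>2 * (cmod c)\<^sup>2 * Re (B y y)" for t :: real
  proof -
    define l where "l = - complex_of_real t * c"
    have Im: "Im (B y y) = 0"
      using form_commute[OF y y] by (metis cnj.simps(2) neg_equal_zero)
    have "0 \<le> Re (B (add x (scl l y)) (add x (scl l y)))"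
      by (rule form_nonneg) (simp add: x y form_simps)
    also have "\<dots> = Re (B x x) + Re (cnj l * c + l * cnj c) + Re (l * cnj l * B y y)"
      using form_commute[OF y x] x y by (simp add: form_simps c_def algebra_simps)
    also have "cnj l * c + l * cnj c = complex_of_real (- 2 * t * (cmod c)\<^sup>2)"
      by (simp add: l_def complex_norm_square mult.commute del: of_real_power)
    also have "l * cnj l = complex_of_real (t\<^sup>2 * (cmod c)\<^sup>2)"
      by (simp add: complex_norm_square[symmetric] l_def norm_mult power_mult_distrib
          del: of_real_power complex_cnj_mult)
    also have "Re (complex_of_real (t\<^sup>2 * (cmod c)\<^sup>2) * B y y) = t\<^sup>2 * (cmod c)\<^sup>2 * Re (B y y)"
      using Im by simp
    finally show ?thesis by simp
  qed
  have "(cmod c)\<^sup>2 \<le> Re (B x x) * Re (B y y)"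
  proof (cases "Re (B y y) = 0")
    case True
    have "cmod c = 0"
    proof (rule ccontr)
      assume "cmod c \<noteq> 0"
      then have "0 \<le> (- 1 :: real)"
        using *[of "(Re (B x x) + 1) / (2 * (cmod c)\<^sup>2)"] True by (simp add: field_simps)
      then show False by simp
    qed
    then show ?thesis using True by simp
  next
    case False
    then have "Re (B y y) > 0" using form_nonneg[OF y] by simp
    then show ?thesis
      using *[of "1 / Re (B y y)"] by (simp add: field_simps power2_eq_square)
  qed
  then show ?thesis
    by (simp add: c_def seminorm_def real_sqrt_mult[symmetric] real_le_rsqrt)
qed

lemma sqdist_eq:
  assumes "x \<in> X" "y \<in> X"
  shows "sqdist x y = Re (B (add x (scl (- 1) y)) (add x (scl (- 1) y)))"
  using assms Re_form_commute[of x y] by (simp add: sqdist_def form_simps)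

lemma sqdist_nonneg: "\<lbrakk>x \<in> X; y \<in> X\<rbrakk> \<Longrightarrow> 0 \<le> sqdist x y"
  using form_nonneg[of "add x (scl (- 1) y)"] by (simp add: sqdist_eq add_closed scl_closed)

text \<open>Parallelogram identity for the two differences with the nonnegative term
  \<open>sqdist u v\<close> dropped; the factor 2 takes the place of a triangle inequality for
  square roots.\<close>

lemma sqdist_add:
  assumes "x \<in> X" "y \<in> X" "x' \<in> X" "y' \<in> X"
  shows "sqdist (add x y) (add x' y') \<le> 2 * sqdist x x' + 2 * sqdist y y'"
proof -
  define u where "u = add x (scl (- 1) x')"
  define v where "v = add y (scl (- 1) y')"
  have uv: "u \<in> X" "v \<in> X" using assms by (simp_all add: u_def v_def form_simps)
  have "sqdist (add x y) (add x' y') = Re (B (add u v) (add u v))"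
    using assms Re_form_commute[of x x'] Re_form_commute[of y y'] Re_form_commute[of x y]
      Re_form_commute[of x y'] Re_form_commute[of x' y] Re_form_commute[of x' y']
    by (simp add: sqdist_def u_def v_def form_simps)
  also have "\<dots> = 2 * Re (B u u) + 2 * Re (B v v) - sqdist u v"
    using uv Re_form_commute[of u v] by (simp add: sqdist_def form_simps)
  finally show ?thesis
    using sqdist_nonneg[OF uv] assms by (simp add: u_def v_def sqdist_eq)
qed

lemma sqdist_scl:
  assumes "x \<in> X" "y \<in> X"
  shows "sqdist (scl c x) (scl c y) = (cmod c)\<^sup>2 * sqdist x y"
proof -
  have "B (scl c u) (scl c v) = complex_of_real ((cmod c)\<^sup>2) * B u v" if "u \<in> X" "v \<in> X" for u v
    using that by (simp only: form_simps complex_norm_square mult.assoc) (simp add: ac_simps)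
  then show ?thesis
    using assms by (simp add: sqdist_def algebra_simps del: of_real_power)
qed

lemma form_diff_left:
  assumes "x \<in> X" "y \<in> X" "v \<in> X"
  shows "cmod (B x v - B y v) \<le> sqrt (sqdist x y) * seminorm v"
  using form_cauchy_schwarz[of "add x (scl (- 1) y)" v] assms
  by (simp add: form_simps seminorm_def sqdist_eq)

lemma form_diff_right:
  assumes "x \<in> X" "y \<in> X" "v \<in> X"
  shows "cmod (B v x - B v y) \<le> sqrt (sqdist x y) * seminorm v"
  using form_diff_left[OF assms] form_commute[of v x] form_commute[of v y] assms
  by (metis complex_cnj_diff complex_mod_cnj)

section \<open>Cauchy sequences and the functionals that they represent\<close>

definition form_cauchy :: "(nat \<Rightarrow> 'x) \<Rightarrow> bool" where
  "form_cauchy x \<longleftrightarrow> (\<forall>k. x k \<in> X) \<and> (\<forall>e>0. \<exists>N. \<forall>k\<ge>N. \<forall>m\<ge>N. sqdist (x k) (x m) < e)"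

lemma form_cauchy_bounded:
  assumes "form_cauchy x"
  obtains M where "M > 0" "\<And>k. seminorm (x k) \<le> M"
proof -
  have x: "x k \<in> X" for k using assms by (simp add: form_cauchy_def)
  obtain N where N: "\<And>k m. k \<ge> N \<Longrightarrow> m \<ge> N \<Longrightarrow> sqdist (x k) (x m) < 1"
    using assms unfolding form_cauchy_def by (meson zero_less_one)
  \<comment> \<open>From \<open>N\<close> on, nonnegativity of the norm of
    \<open>x k - 2 x N\<close> bounds \<open>Re (B (x k) (x k))\<close> by twice the distance to
    \<open>x N\<close>, which is below 1, plus \<open>2 * Re (B (x N) (x N))\<close>. The sum takes
    care of the indices below \<open>N\<close>.\<close>
  define K where "K = 2 + 2 * Re (B (x N) (x N)) + (\<Sum>k<N. Re (B (x k) (x k)))"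
  have s: "0 \<le> (\<Sum>k<N. Re (B (x k) (x k)))"
    by (intro sum_nonneg form_nonneg x)
  have "Re (B (x k) (x k)) \<le> K" for k
  proof (cases "k < N")
    case True
    have "Re (B (x k) (x k)) \<le> (\<Sum>k<N. Re (B (x k) (x k)))"
      by (rule member_le_sum) (use True x form_nonneg in auto)
    then show ?thesis using form_nonneg[OF x[of N]] by (simp add: K_def)
  next
    case False
    have "0 \<le> Re (B (add (x k) (scl (- 2) (x N))) (add (x k) (scl (- 2) (x N))))"
      by (rule form_nonneg) (simp add: x form_simps)
    also have "\<dots> = 2 * sqdist (x k) (x N) + 2 * Re (B (x N) (x N)) - Re (B (x k) (x k))"
      using x Re_form_commute[of "x k" "x N"] by (simp add: form_simps sqdist_def)
    finally show ?thesis using N[of k N] False s by (simp add: K_def)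
  qed
  then have "seminorm (x k) \<le> sqrt K" for k
    by (simp add: seminorm_def)
  moreover have "K > 0" using s form_nonneg[OF x[of N]] by (simp add: K_def)
  ultimately show ?thesis using that[of "sqrt K"] by simp
qed

text \<open>An element of the completion is the functional \<open>\<lambda>v. lim B (x k) v\<close> for a Cauchy sequence
  \<open>x\<close>; working with functionals instead of classes of sequences makes the vector space operations
  pointwise.\<close>

definition represents :: "(nat \<Rightarrow> 'x) \<Rightarrow> ('x \<Rightarrow> complex) \<Rightarrow> bool" where
  "represents x \<phi> \<longleftrightarrow> form_cauchy x \<and> (\<forall>v\<in>X. (\<lambda>k. B (x k) v) \<longlonglongrightarrow> \<phi> v) \<and> (\<forall>v. v \<notin> X \<longrightarrow> \<phi> v = 0)"

definition form_rep :: "('x \<Rightarrow> complex) \<Rightarrow> nat \<Rightarrow> 'x" where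
  "form_rep \<phi> = (SOME x. represents x \<phi>)"

text \<open>The inner product is evaluated along one chosen sequence for \<open>\<psi>\<close>;
  \<open>cinner_completion_form\<close> shows that all sequences representing the two functionals
  give the same value.\<close>

definition completion :: "('x \<Rightarrow> complex) cinner_space" where
  "completion = \<lparr>carrier = {\<phi>. \<exists>x. represents x \<phi>}, mult = undefined, one = undefined,
    zero = (\<lambda>_. 0), add = (\<lambda>\<phi> \<psi> v. \<phi> v + \<psi> v), smult = (\<lambda>c \<phi> v. c * \<phi> v),
    cinner = (\<lambda>\<phi> \<psi>. lim (\<lambda>k. \<phi> (form_rep \<psi> k)))\<rparr>"

definition embed :: "'x \<Rightarrow> 'x \<Rightarrow> complex" where
  "embed x v = (if v \<in> X then B x v else 0)"

lemma representsD:
  assumes "represents x \<phi>"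
  shows "form_cauchy x" "x k \<in> X" "v \<in> X \<Longrightarrow> (\<lambda>k. B (x k) v) \<longlonglongrightarrow> \<phi> v" "v \<notin> X \<Longrightarrow> \<phi> v = 0"
  using assms by (auto simp: represents_def form_cauchy_def)

lemma form_cauchy_represents:
  assumes "form_cauchy x"
  obtains \<phi> where "represents x \<phi>"
proof -
  have x: "x k \<in> X" for k using assms by (simp add: form_cauchy_def)
  have "convergent (\<lambda>k. B (x k) v)" if v: "v \<in> X" for v
  proof -
    have "\<exists>N. \<forall>m\<ge>N. \<forall>n\<ge>N. cmod (B (x m) v - B (x n) v) < e" if "e > 0" for e
    proof -
      define r where "r = e / (seminorm v + 1)"
      have sv: "seminorm v \<ge> 0" by (simp add: seminorm_def form_nonneg v)
      then have "r > 0" using that by (simp add: r_def)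
      then obtain N where N: "\<And>k m. k \<ge> N \<Longrightarrow> m \<ge> N \<Longrightarrow> sqdist (x k) (x m) < r\<^sup>2"
        using assms unfolding form_cauchy_def by (meson zero_less_power)
      have "cmod (B (x m) v - B (x n) v) < e" if "m \<ge> N" "n \<ge> N" for m n
      proof -
        have "sqrt (sqdist (x m) (x n)) \<le> r"
          using N[OF that] \<open>r > 0\<close> by (intro real_le_lsqrt) (auto simp: sqdist_nonneg x)
        then have "sqrt (sqdist (x m) (x n)) * seminorm v \<le> r * seminorm v"
          using sv by (rule mult_right_mono)
        also have "\<dots> < r * (seminorm v + 1)" using \<open>r > 0\<close> by simp
        also have "\<dots> = e" using sv by (simp add: r_def)
        finally show ?thesis using form_diff_left[OF x[of m] x[of n] v] by simp
      qed
      then show ?thesis by blast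
    qed
    then have "Cauchy (\<lambda>k. B (x k) v)" by (simp add: Cauchy_iff)
    then show ?thesis by (rule Cauchy_convergent)
  qed
  then have "represents x (\<lambda>v. if v \<in> X then lim (\<lambda>k. B (x k) v) else 0)"
    using assms by (simp add: represents_def convergent_LIMSEQ_iff)
  then show ?thesis by (rule that)
qed

text \<open>Since the \<open>y k\<close> are bounded, \<open>B (x m) (y k)\<close> converges to
  \<open>\<phi> (y k)\<close> as \<open>m\<close> grows uniformly in \<open>k\<close>; this
  identifies the limit along the diagonal with that of \<open>\<phi> (y k)\<close>. The diagonal is
  Cauchy because the same uniformity holds in the other argument.\<close>

lemma represents_pairing:
  assumes x\<phi>: "represents x \<phi>" and y\<psi>: "represents y \<psi>"
  obtains L where "(\<lambda>k. B (x k) (y k)) \<longlonglongrightarrow> L" "(\<lambda>k. \<phi> (y k)) \<longlonglongrightarrow> L"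
proof -
  note x = representsD(2)[OF x\<phi>] and y = representsD(2)[OF y\<psi>]
  obtain M1 where M1: "M1 > 0" "\<And>k. seminorm (x k) \<le> M1"
    using form_cauchy_bounded[OF representsD(1)[OF x\<phi>]] by blast
  obtain M2 where M2: "M2 > 0" "\<And>k. seminorm (y k) \<le> M2"
    using form_cauchy_bounded[OF representsD(1)[OF y\<psi>]] by blast
  have close: "\<exists>N. \<forall>m\<ge>N. \<forall>n\<ge>N. \<forall>k. cmod (B (x m) (y k) - B (x n) (y k)) \<le> e" if "e > 0" for e
  proof -
    obtain N where N: "\<And>k m. k \<ge> N \<Longrightarrow> m \<ge> N \<Longrightarrow> sqdist (x k) (x m) < (e / M2)\<^sup>2"
      using representsD(1)[OF x\<phi>] \<open>e > 0\<close> \<open>M2 > 0\<close> unfolding form_cauchy_def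
      by (meson divide_pos_pos zero_less_power)
    have "cmod (B (x m) (y k) - B (x n) (y k)) \<le> e" if "m \<ge> N" "n \<ge> N" for m n k
    proof -
      have "sqrt (sqdist (x m) (x n)) \<le> e / M2"
        using N[OF that] \<open>e > 0\<close> \<open>M2 > 0\<close> by (intro real_le_lsqrt) (auto simp: sqdist_nonneg x)
      then have "sqrt (sqdist (x m) (x n)) * seminorm (y k) \<le> e / M2 * M2"
        using M2 by (intro mult_mono) (auto simp: seminorm_def form_nonneg y \<open>e > 0\<close> less_imp_le)
      then show ?thesis using form_diff_left[OF x[of m] x[of n] y[of k]] M2(1) by simp
    qed
    then show ?thesis by blast
  qed
  have close': "\<exists>N. \<forall>m\<ge>N. \<forall>n\<ge>N. \<forall>k. cmod (B (x k) (y m) - B (x k) (y n)) \<le> e" if "e > 0" for e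
  proof -
    obtain N where N: "\<And>k m. k \<ge> N \<Longrightarrow> m \<ge> N \<Longrightarrow> sqdist (y k) (y m) < (e / M1)\<^sup>2"
      using representsD(1)[OF y\<psi>] \<open>e > 0\<close> \<open>M1 > 0\<close> unfolding form_cauchy_def
      by (meson divide_pos_pos zero_less_power)
    have "cmod (B (x k) (y m) - B (x k) (y n)) \<le> e" if "m \<ge> N" "n \<ge> N" for m n k
    proof -
      have "sqrt (sqdist (y m) (y n)) \<le> e / M1"
        using N[OF that] \<open>e > 0\<close> \<open>M1 > 0\<close> by (intro real_le_lsqrt) (auto simp: sqdist_nonneg y)
      then have "sqrt (sqdist (y m) (y n)) * seminorm (x k) \<le> e / M1 * M1"
        using M1 by (intro mult_mono) (auto simp: seminorm_def form_nonneg x \<open>e > 0\<close> less_imp_le)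
      then show ?thesis using form_diff_right[OF y[of m] y[of n] x[of k]] M1(1) by simp
    qed
    then show ?thesis by blast
  qed
  have "Cauchy (\<lambda>k. B (x k) (y k))"
    unfolding Cauchy_iff
  proof (intro allI impI)
    fix e :: real assume "e > 0"
    then have "e / 3 > 0" by simp
    from close[OF this] close'[OF this] obtain N N'
      where N: "\<And>m n k. m \<ge> N \<Longrightarrow> n \<ge> N \<Longrightarrow> cmod (B (x m) (y k) - B (x n) (y k)) \<le> e / 3"
        and N': "\<And>m n k. m \<ge> N' \<Longrightarrow> n \<ge> N' \<Longrightarrow> cmod (B (x k) (y m) - B (x k) (y n)) \<le> e / 3"
      by blast
    have "cmod (B (x m) (y m) - B (x n) (y n)) < e" if "m \<ge> max N N'" "n \<ge> max N N'" for m n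
      using N[of m n m] N'[of m n n] that \<open>e > 0\<close>
        norm_triangle_ineq[of "B (x m) (y m) - B (x n) (y m)" "B (x n) (y m) - B (x n) (y n)"]
      by simp
    then show "\<exists>M. \<forall>m\<ge>M. \<forall>n\<ge>M. cmod (B (x m) (y m) - B (x n) (y n)) < e" by blast
  qed
  then obtain L where L: "(\<lambda>k. B (x k) (y k)) \<longlonglongrightarrow> L"
    using Cauchy_convergent convergent_def by blast
  have "(\<lambda>k. \<phi> (y k) - B (x k) (y k)) \<longlonglongrightarrow> 0"
    unfolding LIMSEQ_iff
  proof (intro allI impI)
    fix e :: real assume "e > 0"
    then have "e / 2 > 0" by simp
    from close[OF this] obtain N
      where N: "\<And>m n k. m \<ge> N \<Longrightarrow> n \<ge> N \<Longrightarrow> cmod (B (x m) (y k) - B (x n) (y k)) \<le> e / 2"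
      by blast
    have "cmod (\<phi> (y n) - B (x n) (y n)) \<le> e / 2" if "n \<ge> N" for n
    proof (rule tendsto_upperbound)
      show "(\<lambda>m. cmod (B (x m) (y n) - B (x n) (y n))) \<longlonglongrightarrow> cmod (\<phi> (y n) - B (x n) (y n))"
        by (intro tendsto_intros representsD(3)[OF x\<phi>] y)
      show "\<forall>\<^sub>F m in sequentially. cmod (B (x m) (y n) - B (x n) (y n)) \<le> e / 2"
        using eventually_ge_at_top[of N] by eventually_elim (use N that in auto)
    qed simp
    then show "\<exists>N. \<forall>n\<ge>N. norm (\<phi> (y n) - B (x n) (y n) - 0) < e"
      using \<open>e > 0\<close> by (intro exI[of _ N]) (fastforce intro: le_less_trans)
  qed
  from tendsto_add[OF this L] have "(\<lambda>k. \<phi> (y k)) \<longlonglongrightarrow> L" by simp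
  with L show ?thesis by (rule that)
qed

lemma completion_sel:
  "carrier completion = {\<phi>. \<exists>x. represents x \<phi>}" "\<zero>\<^bsub>completion\<^esub> = (\<lambda>_. 0)"
  "\<phi> \<oplus>\<^bsub>completion\<^esub> \<psi> = (\<lambda>v. \<phi> v + \<psi> v)" "c \<odot>\<^bsub>completion\<^esub> \<phi> = (\<lambda>v. c * \<phi> v)"
  by (simp_all add: completion_def)

lemma represents_form_rep: "\<phi> \<in> carrier completion \<Longrightarrow> represents (form_rep \<phi>) \<phi>"
  unfolding form_rep_def completion_sel using someI_ex[of "\<lambda>x. represents x \<phi>"] by simp

text \<open>Paired with \<open>x\<close>, both \<open>y\<close> and the chosen sequence of
  \<open>\<psi>\<close> have the limit of \<open>\<psi> (x k)\<close>, an expression that involves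
  no sequence for \<open>\<psi>\<close>. Conjugation turns this into independence of the choice made
  in the definition.\<close>

lemma cinner_completion_form:
  assumes "represents x \<phi>" "represents y \<psi>"
  shows "(\<lambda>k. B (x k) (y k)) \<longlonglongrightarrow> cinner completion \<phi> \<psi>"
proof -
  have r\<psi>: "represents (form_rep \<psi>) \<psi>"
    using assms(2) by (intro represents_form_rep) (auto simp: completion_sel)
  obtain L where L: "(\<lambda>k. \<phi> (form_rep \<psi> k)) \<longlonglongrightarrow> L" "(\<lambda>k. B (x k) (form_rep \<psi> k)) \<longlonglongrightarrow> L"
    using represents_pairing[OF assms(1) r\<psi>] by blast
  obtain L1 where L1: "(\<lambda>k. B (form_rep \<psi> k) (x k)) \<longlonglongrightarrow> L1" "(\<lambda>k. \<psi> (x k)) \<longlonglongrightarrow> L1"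
    using represents_pairing[OF r\<psi> assms(1)] by blast
  obtain L2 where L2: "(\<lambda>k. B (y k) (x k)) \<longlonglongrightarrow> L2" "(\<lambda>k. \<psi> (x k)) \<longlonglongrightarrow> L2"
    using represents_pairing[OF assms(2,1)] by blast
  have "L2 = L1" using LIMSEQ_unique L1(2) L2(2) by blast
  have c: "B v w = cnj (B w v)" if "v \<in> X" "w \<in> X" for v w using form_commute that by blast
  have "(\<lambda>k. B (x k) (y k)) \<longlonglongrightarrow> cnj L1"
    using tendsto_cnj[OF L2(1)] \<open>L2 = L1\<close> c[OF representsD(2)[OF assms(1)] representsD(2)[OF assms(2)]]
    by simp
  moreover have "(\<lambda>k. B (x k) (form_rep \<psi> k)) \<longlonglongrightarrow> cnj L1"
    using tendsto_cnj[OF L1(1)] c[OF representsD(2)[OF assms(1)] representsD(2)[OF r\<psi>]]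
    by simp
  ultimately have "(\<lambda>k. B (x k) (y k)) \<longlonglongrightarrow> L"
    using L(2) LIMSEQ_unique by blast
  moreover have "cinner completion \<phi> \<psi> = L"
    using L(1) by (simp add: completion_def limI)
  ultimately show ?thesis by simp
qed

lemma cinner_completion_eval:
  assumes "\<phi> \<in> carrier completion" "represents y \<psi>"
  shows "(\<lambda>k. \<phi> (y k)) \<longlonglongrightarrow> cinner completion \<phi> \<psi>"
proof -
  note r = represents_form_rep[OF assms(1)]
  obtain L where "(\<lambda>k. B (form_rep \<phi> k) (y k)) \<longlonglongrightarrow> L" "(\<lambda>k. \<phi> (y k)) \<longlonglongrightarrow> L"
    using represents_pairing[OF r assms(2)] by blast
  then show ?thesis
    using cinner_completion_form[OF r assms(2)] LIMSEQ_unique by blast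
qed

lemma represents_add:
  assumes "represents x \<phi>" "represents y \<psi>"
  shows "represents (\<lambda>k. add (x k) (y k)) (\<lambda>v. \<phi> v + \<psi> v)"
proof -
  note x = representsD[OF assms(1)] and y = representsD[OF assms(2)]
  have "\<exists>N. \<forall>k\<ge>N. \<forall>m\<ge>N. sqdist (add (x k) (y k)) (add (x m) (y m)) < e" if "e > 0" for e
  proof -
    from that have "e / 4 > 0" by simp
    then obtain N N' where N: "\<And>k m. k \<ge> N \<Longrightarrow> m \<ge> N \<Longrightarrow> sqdist (x k) (x m) < e / 4"
      and N': "\<And>k m. k \<ge> N' \<Longrightarrow> m \<ge> N' \<Longrightarrow> sqdist (y k) (y m) < e / 4"
      using x(1) y(1) unfolding form_cauchy_def by meson
    have "sqdist (add (x k) (y k)) (add (x m) (y m)) < e" if "k \<ge> max N N'" "m \<ge> max N N'" for k m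
      using sqdist_add[OF x(2) y(2) x(2) y(2), of k k m m] N[of k m] N'[of k m] that by simp
    then show ?thesis by blast
  qed
  then have "form_cauchy (\<lambda>k. add (x k) (y k))"
    unfolding form_cauchy_def using add_closed[OF x(2) y(2)] by blast
  moreover have "(\<lambda>k. B (add (x k) (y k)) v) \<longlonglongrightarrow> \<phi> v + \<psi> v" if "v \<in> X" for v
    using tendsto_add[OF x(3)[OF that] y(3)[OF that]] that x(2) y(2) by (simp add: form_simps)
  ultimately show ?thesis
    using x(4) y(4) by (simp add: represents_def)
qed

lemma represents_scl:
  assumes "represents x \<phi>"
  shows "represents (\<lambda>k. scl c (x k)) (\<lambda>v. c * \<phi> v)"
proof -
  note x = representsD[OF assms(1)]
  have "\<exists>N. \<forall>k\<ge>N. \<forall>m\<ge>N. sqdist (scl c (x k)) (scl c (x m)) < e" if "e > 0" for e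
  proof -
    define r where "r = e / ((cmod c)\<^sup>2 + 1)"
    have p: "(cmod c)\<^sup>2 + 1 > 0" by (simp add: add_nonneg_pos)
    have "r > 0" using that p by (simp add: r_def)
    then obtain N where N: "\<And>k m. k \<ge> N \<Longrightarrow> m \<ge> N \<Longrightarrow> sqdist (x k) (x m) < r"
      using x(1) unfolding form_cauchy_def by meson
    have "sqdist (scl c (x k)) (scl c (x m)) < e" if "k \<ge> N" "m \<ge> N" for k m
    proof -
      have "(cmod c)\<^sup>2 * sqdist (x k) (x m) \<le> (cmod c)\<^sup>2 * r"
        using N[OF that] by (intro mult_left_mono) auto
      also have "\<dots> < ((cmod c)\<^sup>2 + 1) * r" using \<open>r > 0\<close> by simp
      also have "\<dots> = e" using p by (simp add: r_def)
      finally show ?thesis using sqdist_scl x(2) by simp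
    qed
    then show ?thesis by blast
  qed
  then have "form_cauchy (\<lambda>k. scl c (x k))"
    unfolding form_cauchy_def using scl_closed[OF x(2)] by blast
  moreover have "(\<lambda>k. B (scl c (x k)) v) \<longlonglongrightarrow> c * \<phi> v" if "v \<in> X" for v
    using tendsto_mult_left[OF x(3)[OF that], of c] that x(2) by (simp add: form_simps)
  ultimately show ?thesis
    using x(4) by (simp add: represents_def)
qed

lemma represents_embed:
  assumes "x \<in> X"
  shows "represents (\<lambda>_. x) (embed x)"
  using assms by (simp add: represents_def form_cauchy_def embed_def sqdist_def)

lemma embed_carrier: "x \<in> X \<Longrightarrow> embed x \<in> carrier completion"
  using represents_embed by (auto simp: completion_sel)

text \<open>The constant sequence represents \<open>embed x\<close>: evaluation at \<open>x\<close>
  is reproduced by the vector \<open>embed x\<close>, as with a reproducing kernel.\<close>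

lemma cinner_embed:
  assumes "\<phi> \<in> carrier completion" "x \<in> X"
  shows "cinner completion \<phi> (embed x) = \<phi> x"
  using cinner_completion_eval[OF assms(1) represents_embed[OF assms(2)]]
    by (simp add: LIMSEQ_const_iff)

lemma inner_product_space_completion: "inner_product_space completion"
proof (rule inner_product_space.intro)
  have zero: "(\<lambda>_. 0) \<in> carrier completion"
  proof -
    obtain x where "x \<in> X" using nonempty by blast
    from represents_scl[OF represents_embed[OF this], of 0] show ?thesis
      by (auto simp: completion_sel)
  qed
  have scale: "(\<lambda>v. c * \<phi> v) \<in> carrier completion" if "\<phi> \<in> carrier completion" for c \<phi>
    using that represents_scl unfolding completion_sel by blast
  have add: "(\<lambda>v. \<phi> v + \<psi> v) \<in> carrier completion"
    if "\<phi> \<in> carrier completion" "\<psi> \<in> carrier completion" for \<phi> \<psi>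
    using that represents_add unfolding completion_sel by blast
  have "abelian_group completion"
  proof (rule abelian_groupI)
    fix \<phi> assume "\<phi> \<in> carrier completion"
    then show "\<exists>\<psi>\<in>carrier completion. \<psi> \<oplus>\<^bsub>completion\<^esub> \<phi> = \<zero>\<^bsub>completion\<^esub>"
      using scale[of \<phi> "- 1"] by (intro bexI[of _ "\<lambda>v. - 1 * \<phi> v"]) (simp_all add: completion_sel(2-))
  qed (use zero add in \<open>auto simp: completion_sel(2-) algebra_simps\<close>)
  then show "Module.module complex_field completion"
    by (rule moduleI[OF cring_complex_field])
      (use scale in \<open>auto simp: completion_sel(2-) complex_field_def algebra_simps\<close>)
  fix \<phi> \<psi> assume \<phi>: "\<phi> \<in> carrier completion" and \<psi>: "\<psi> \<in> carrier completion"
  note r\<phi> = represents_form_rep[OF \<phi>] and r\<psi> = represents_form_rep[OF \<psi>]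
  show "cinner completion \<phi> \<psi> = cnj (cinner completion \<psi> \<phi>)"
  proof (rule LIMSEQ_unique)
    show "(\<lambda>k. B (form_rep \<phi> k) (form_rep \<psi> k)) \<longlonglongrightarrow> cinner completion \<phi> \<psi>"
      by (rule cinner_completion_form[OF r\<phi> r\<psi>])
    have "(\<lambda>k. cnj (B (form_rep \<psi> k) (form_rep \<phi> k))) \<longlonglongrightarrow> cnj (cinner completion \<psi> \<phi>)"
      by (rule tendsto_cnj[OF cinner_completion_form[OF r\<psi> r\<phi>]])
    then show "(\<lambda>k. B (form_rep \<phi> k) (form_rep \<psi> k)) \<longlonglongrightarrow> cnj (cinner completion \<psi> \<phi>)"
      using form_commute[OF representsD(2)[OF r\<phi>] representsD(2)[OF r\<psi>]] by simp
  qed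
  fix c
  show "cinner completion (c \<odot>\<^bsub>completion\<^esub> \<phi>) \<psi> = c * cinner completion \<phi> \<psi>"
  proof (rule LIMSEQ_unique)
    show "(\<lambda>k. (c \<odot>\<^bsub>completion\<^esub> \<phi>) (form_rep \<psi> k)) \<longlonglongrightarrow> cinner completion (c \<odot>\<^bsub>completion\<^esub> \<phi>) \<psi>"
      using scale[OF \<phi>] by (intro cinner_completion_eval r\<psi>) (simp add: completion_sel(4))
    show "(\<lambda>k. (c \<odot>\<^bsub>completion\<^esub> \<phi>) (form_rep \<psi> k)) \<longlonglongrightarrow> c * cinner completion \<phi> \<psi>"
      using tendsto_mult_left[OF cinner_completion_eval[OF \<phi> r\<psi>]] by (simp add: completion_sel(4))
  qed
next
  fix \<phi> \<psi> \<eta> assume \<phi>: "\<phi> \<in> carrier completion" and \<psi>: "\<psi> \<in> carrier completion"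
    and \<eta>: "\<eta> \<in> carrier completion"
  note r = represents_form_rep[OF \<eta>]
  have "\<phi> \<oplus>\<^bsub>completion\<^esub> \<psi> \<in> carrier completion"
    using represents_add[OF represents_form_rep[OF \<phi>] represents_form_rep[OF \<psi>]]
    by (auto simp: completion_sel)
  from cinner_completion_eval[OF this r]
  show "cinner completion (\<phi> \<oplus>\<^bsub>completion\<^esub> \<psi>) \<eta> = cinner completion \<phi> \<eta> + cinner completion \<psi> \<eta>"
    using tendsto_add[OF cinner_completion_eval[OF \<phi> r] cinner_completion_eval[OF \<psi> r]]
    by (auto simp: completion_sel(3) intro: LIMSEQ_unique)
next
  fix \<phi> assume \<phi>: "\<phi> \<in> carrier completion"
  note r = represents_form_rep[OF \<phi>]
  have lim: "(\<lambda>k. Re (B (form_rep \<phi> k) (form_rep \<phi> k))) \<longlonglongrightarrow> Re (cinner completion \<phi> \<phi>)"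
    by (rule tendsto_Re[OF cinner_completion_form[OF r r]])
  show "0 \<le> Re (cinner completion \<phi> \<phi>)"
    by (rule tendsto_lowerbound[OF lim]) (simp_all add: form_nonneg representsD(2)[OF r])
  assume "cinner completion \<phi> \<phi> = 0"
  \<comment> \<open>The seminorms of a representing sequence tend to 0, and the Cauchy-Schwarz
    inequality then makes the functional vanish at every \<open>v\<close>. Definiteness thus holds
    although \<open>X\<close> may contain null vectors.\<close>
  with lim have lim0: "(\<lambda>k. seminorm (form_rep \<phi> k)) \<longlonglongrightarrow> 0"
    using tendsto_real_sqrt[OF lim] by (simp add: seminorm_def)
  have "\<phi> v = 0" if v: "v \<in> X" for v
  proof -
    have "(\<lambda>k. B (form_rep \<phi> k) v) \<longlonglongrightarrow> 0"
      by (rule Lim_null_comparison[OF _ tendsto_mult_left_zero[OF lim0, of "seminorm v"]])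
        (simp add: form_cauchy_schwarz v representsD(2)[OF r])
    then show ?thesis using representsD(3)[OF r v] LIMSEQ_unique by blast
  qed
  then show "\<phi> = \<zero>\<^bsub>completion\<^esub>"
    using representsD(4)[OF r] by (auto simp: completion_sel(2) fun_eq_iff)
qed

section \<open>Density, completeness and separability of the completion; operators on it\<close>

interpretation C: inner_product_space completion
  by (rule inner_product_space_completion)

lemma norm_embed_minus:
  assumes "x \<in> X" "y \<in> X"
  shows "(hnorm completion (embed x \<ominus>\<^bsub>completion\<^esub> embed y))\<^sup>2 = sqdist x y"
  using assms by (simp add: C.norm_minus_sq embed_carrier C.norm_sq cinner_embed sqdist_def)
    (simp add: embed_def)

lemma represents_embed_tendsto:
  assumes "represents x \<phi>"
  shows "(\<lambda>k. hnorm completion (embed (x k) \<ominus>\<^bsub>completion\<^esub> \<phi>)) \<longlonglongrightarrow> 0"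
  unfolding LIMSEQ_iff
proof (intro allI impI)
  note x = representsD[OF assms]
  have \<phi>: "\<phi> \<in> carrier completion" using assms by (auto simp: completion_sel)
  fix e :: real assume "e > 0"
  then have "e\<^sup>2 / 4 > 0" by simp
  then obtain N where N: "\<And>k m. k \<ge> N \<Longrightarrow> m \<ge> N \<Longrightarrow> sqdist (x k) (x m) < e\<^sup>2 / 4"
    using x(1) unfolding form_cauchy_def by meson
  have "hnorm completion (embed (x k) \<ominus>\<^bsub>completion\<^esub> \<phi>) < e" if "k \<ge> N" for k
  proof -
    have lim1: "(\<lambda>m. Re (B (x m) (x m))) \<longlonglongrightarrow> Re (cinner completion \<phi> \<phi>)"
      by (rule tendsto_Re[OF cinner_completion_form[OF assms assms]])
    have lim2: "(\<lambda>m. Re (B (x m) (x k))) \<longlonglongrightarrow> Re (\<phi> (x k))"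
      by (rule tendsto_Re[OF x(3)[OF x(2)]])
    have "(\<lambda>m. sqdist (x m) (x k)) \<longlonglongrightarrow> Re (cinner completion \<phi> \<phi>) - 2 * Re (\<phi> (x k)) + Re (B (x k) (x k))"
      unfolding sqdist_def by (intro tendsto_intros lim1 lim2)
    also have "Re (cinner completion \<phi> \<phi>) - 2 * Re (\<phi> (x k)) + Re (B (x k) (x k)) =
        (hnorm completion (\<phi> \<ominus>\<^bsub>completion\<^esub> embed (x k)))\<^sup>2"
      using x(2) by (simp add: C.norm_minus_sq embed_carrier C.norm_sq cinner_embed \<phi>)
        (simp add: embed_def)
    finally have "(hnorm completion (\<phi> \<ominus>\<^bsub>completion\<^esub> embed (x k)))\<^sup>2 \<le> e\<^sup>2 / 4"
      by (rule tendsto_upperbound)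
        (use N that in \<open>auto simp: eventually_sequentially intro!: exI[of _ N] less_imp_le\<close>)
    also have "\<dots> < e\<^sup>2" using \<open>e > 0\<close> by simp
    finally have "hnorm completion (\<phi> \<ominus>\<^bsub>completion\<^esub> embed (x k)) < e"
      using \<open>e > 0\<close> by (rule power2_less_imp_less[OF _ less_imp_le])
    then show ?thesis
      using C.norm_minus_commute \<phi> embed_carrier x(2) by simp
  qed
  then show "\<exists>N. \<forall>k\<ge>N. norm (hnorm completion (embed (x k) \<ominus>\<^bsub>completion\<^esub> \<phi>) - 0) < e"
    by (intro exI[of _ N]) (simp add: C.hnorm_nonneg \<phi> embed_carrier x(2) C.minus_carrier)
qed

lemma embed_dense:
  assumes "\<phi> \<in> carrier completion" "e > 0"
  obtains x where "x \<in> X" "hnorm completion (\<phi> \<ominus>\<^bsub>completion\<^esub> embed x) < e"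
proof -
  note r = represents_form_rep[OF assms(1)]
  obtain k where "norm (hnorm completion (embed (form_rep \<phi> k) \<ominus>\<^bsub>completion\<^esub> \<phi>) - 0) < e"
    using represents_embed_tendsto[OF r] assms(2) unfolding LIMSEQ_iff by blast
  then show ?thesis
    using that[of "form_rep \<phi> k"] C.norm_minus_commute[of \<phi>] assms(1) embed_carrier representsD(2)[OF r]
    by simp
qed

text \<open>Approximate each \<open>\<sigma> k\<close> by some \<open>embed (x k)\<close> within
  \<open>1 / (k + 1)\<close>. Then \<open>x\<close> is Cauchy for the form, and the functional that
  it represents is the limit of \<open>\<sigma>\<close> as well.\<close>

lemma hilbert_space_completion: "hilbert_space completion"
proof
  interpret D: Metric_space "carrier completion" "hdist completion" by (rule C.hdist_metric)
  show "D.mcomplete"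
    unfolding D.mcomplete_def
  proof (intro allI impI)
    fix \<sigma> assume \<sigma>: "D.MCauchy \<sigma>"
    have car: "\<sigma> k \<in> carrier completion" for k
      using \<sigma> unfolding D.MCauchy_def by auto
    have "\<exists>x\<in>X. hnorm completion (\<sigma> k \<ominus>\<^bsub>completion\<^esub> embed x) < inverse (real (Suc k))" for k
      using embed_dense[OF car, of "inverse (real (Suc k))" k] by (metis inverse_positive_iff_positive of_nat_0_less_iff zero_less_Suc)
    then obtain x where x: "\<And>k. x k \<in> X"
      "\<And>k. hnorm completion (\<sigma> k \<ominus>\<^bsub>completion\<^esub> embed (x k)) < inverse (real (Suc k))"
      by metis
    have "form_cauchy x"
      unfolding form_cauchy_def
    proof (intro conjI allI impI)
      fix e :: real assume "e > 0"
      \<comment> \<open>Three distances below \<open>r\<close> add up to less than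
        \<open>sqrt e\<close>, and \<open>sqdist\<close> is the square of a norm.\<close>
      define r where "r = sqrt e / 3"
      have "r > 0" using \<open>e > 0\<close> by (simp add: r_def)
      obtain N where N: "\<And>k m. k \<ge> N \<Longrightarrow> m \<ge> N \<Longrightarrow> hdist completion (\<sigma> k) (\<sigma> m) < r"
        using \<sigma> \<open>r > 0\<close> unfolding D.MCauchy_def by metis
      obtain N' where N': "inverse (real (Suc N')) < r"
        using reals_Archimedean[OF \<open>r > 0\<close>] by blast
      have "sqdist (x k) (x m) < e" if "k \<ge> max N N'" "m \<ge> max N N'" for k m
      proof -
        have i: "inverse (real (Suc k)) \<le> inverse (real (Suc N'))"
          "inverse (real (Suc m)) \<le> inverse (real (Suc N'))"
          using that by simp_all
        have "hnorm completion (embed (x k) \<ominus>\<^bsub>completion\<^esub> embed (x m)) \<le>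
          hnorm completion (embed (x k) \<ominus>\<^bsub>completion\<^esub> \<sigma> k) + hnorm completion (\<sigma> k \<ominus>\<^bsub>completion\<^esub> embed (x m))"
          by (rule C.norm_minus_triangle) (auto simp: car x embed_carrier)
        also have "\<dots> \<le> hnorm completion (embed (x k) \<ominus>\<^bsub>completion\<^esub> \<sigma> k) +
           (hnorm completion (\<sigma> k \<ominus>\<^bsub>completion\<^esub> \<sigma> m) + hnorm completion (\<sigma> m \<ominus>\<^bsub>completion\<^esub> embed (x m)))"
          by (rule add_left_mono, rule C.norm_minus_triangle) (auto simp: car x embed_carrier)
        also have "\<dots> < r + (r + r)"
        proof -
          have "hnorm completion (embed (x k) \<ominus>\<^bsub>completion\<^esub> \<sigma> k) < r"
            using x(2)[of k] N' i(1) C.norm_minus_commute[OF car[of k] embed_carrier[OF x(1)[of k]]]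
            by linarith
          moreover have "hnorm completion (\<sigma> m \<ominus>\<^bsub>completion\<^esub> embed (x m)) < r"
            using x(2)[of m] N' i(2) by linarith
          moreover have "hnorm completion (\<sigma> k \<ominus>\<^bsub>completion\<^esub> \<sigma> m) < r"
            using N[of k m] that car by (simp add: hdist_def)
          ultimately show ?thesis by linarith
        qed
        also have "\<dots> = sqrt e" by (simp add: r_def)
        finally have "(hnorm completion (embed (x k) \<ominus>\<^bsub>completion\<^esub> embed (x m)))\<^sup>2 < (sqrt e)\<^sup>2"
          by (intro power_strict_mono) (auto intro!: C.hnorm_nonneg C.minus_carrier embed_carrier x)
        then show ?thesis using \<open>e > 0\<close> x(1) by (simp add: norm_embed_minus)
      qed
      then show "\<exists>N. \<forall>k\<ge>N. \<forall>m\<ge>N. sqdist (x k) (x m) < e" by blast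
    qed (use x in simp)
    then obtain \<phi> where \<phi>: "represents x \<phi>" by (rule form_cauchy_represents)
    then have \<phi>c: "\<phi> \<in> carrier completion" by (auto simp: completion_sel)
    have "(\<lambda>k. hnorm completion (\<sigma> k \<ominus>\<^bsub>completion\<^esub> \<phi>)) \<longlonglongrightarrow> 0"
    proof (rule Lim_null_comparison)
      show "\<forall>\<^sub>F k in sequentially. norm (hnorm completion (\<sigma> k \<ominus>\<^bsub>completion\<^esub> \<phi>)) \<le>
          inverse (real (Suc k)) + hnorm completion (embed (x k) \<ominus>\<^bsub>completion\<^esub> \<phi>)"
      proof (intro always_eventually allI)
        fix k
        show "norm (hnorm completion (\<sigma> k \<ominus>\<^bsub>completion\<^esub> \<phi>)) \<le>
          inverse (real (Suc k)) + hnorm completion (embed (x k) \<ominus>\<^bsub>completion\<^esub> \<phi>)"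
          using C.norm_minus_triangle[OF car[of k] embed_carrier[OF x(1)[of k]] \<phi>c] x(2)[of k]
          by (simp add: C.hnorm_nonneg C.minus_carrier car \<phi>c)
      qed
      show "(\<lambda>k. inverse (real (Suc k)) + hnorm completion (embed (x k) \<ominus>\<^bsub>completion\<^esub> \<phi>)) \<longlonglongrightarrow> 0"
        using tendsto_add[OF LIMSEQ_inverse_real_of_nat represents_embed_tendsto[OF \<phi>]] by simp
    qed
    then show "\<exists>\<phi>. limitin D.mtopology \<sigma> \<phi> sequentially"
      using car \<phi>c C.limitin_iff_norm by auto
  qed
qed

lemma separable_hilbert_space_completion:
  assumes C: "countable C" "C \<subseteq> X" and dense: "\<And>x e. \<lbrakk>x \<in> X; e > 0\<rbrakk> \<Longrightarrow> \<exists>c\<in>C. sqdist x c < e"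
  shows "separable_hilbert_space completion"
proof -
  interpret hilbert_space completion by (rule hilbert_space_completion)
  interpret D: Metric_space "carrier completion" "hdist completion" by (rule C.hdist_metric)
  have "carrier completion \<subseteq> D.mtopology closure_of (embed ` C)"
  proof
    fix \<phi> assume \<phi>: "\<phi> \<in> carrier completion"
    have "\<exists>y\<in>embed ` C. y \<in> D.mball \<phi> r" if "r > 0" for r
    proof -
      obtain x where x: "x \<in> X" "hnorm completion (\<phi> \<ominus>\<^bsub>completion\<^esub> embed x) < r / 2"
        using embed_dense[OF \<phi>, of "r / 2"] \<open>r > 0\<close> by auto
      obtain c where c: "c \<in> C" "sqdist x c < (r / 2)\<^sup>2"
        using dense[OF x(1), of "(r / 2)\<^sup>2"] \<open>r > 0\<close> by auto
      have "hnorm completion (embed x \<ominus>\<^bsub>completion\<^esub> embed c) < r / 2"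
        by (rule power2_less_imp_less) (use c C(2) x norm_embed_minus[of x c] \<open>r > 0\<close> in auto)
      moreover have "embed c \<in> carrier completion" "embed x \<in> carrier completion"
        using c C(2) x embed_carrier by auto
      ultimately have "embed c \<in> D.mball \<phi> r"
        unfolding D.in_mball using C.norm_minus_triangle[of \<phi> "embed x" "embed c"] x(2) \<phi>
        by (simp add: hdist_def)
      then show ?thesis using c(1) by blast
    qed
    then show "\<phi> \<in> D.mtopology closure_of (embed ` C)"
      using \<phi> unfolding D.metric_closure_of by blast
  qed
  then have "D.mtopology closure_of (embed ` C) = carrier completion"
    by (metis D.topspace_mtopology closure_of_subset_topspace subset_antisym)
  then have "separable_space D.mtopology"
    unfolding separable_space_def using C embed_carrier
    by (intro exI[of _ "embed ` C"]) (auto simp: D.topspace_mtopology)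
  then show ?thesis by unfold_locales
qed

text \<open>The operator on the completion that extends the formal adjoint of \<open>g\<close>.\<close>

definition lift :: "('x \<Rightarrow> 'x) \<Rightarrow> ('x \<Rightarrow> complex) \<Rightarrow> 'x \<Rightarrow> complex" where
  "lift g \<phi> v = (if v \<in> X then \<phi> (g v) else 0)"

text \<open>Adjointness already makes \<open>f\<close> linear up to null vectors; the last clause
  lets \<open>f\<close> carry Cauchy sequences to Cauchy sequences, so that \<open>lift g\<close>
  maps the completion to itself.\<close>

definition formal_adjoint :: "('x \<Rightarrow> 'x) \<Rightarrow> ('x \<Rightarrow> 'x) \<Rightarrow> bool" where
  "formal_adjoint f g \<longleftrightarrow> f \<in> X \<rightarrow> X \<and> g \<in> X \<rightarrow> X \<and>
    (\<forall>x\<in>X. \<forall>y\<in>X. B (f x) y = B x (g y)) \<and>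
    (\<forall>x\<in>X. \<forall>y\<in>X. sqdist (f x) (f y) \<le> sqdist x y)"

lemma represents_lift:
  assumes "formal_adjoint f g" "represents x \<phi>"
  shows "represents (\<lambda>k. f (x k)) (lift g \<phi>)"
proof -
  note x = representsD[OF assms(2)]
  have f: "f v \<in> X" "g v \<in> X" if "v \<in> X" for v
    using assms(1) that by (auto simp: formal_adjoint_def)
  have *: "B (f v) w = B v (g w)" "sqdist (f v) (f w) \<le> sqdist v w" if "v \<in> X" "w \<in> X" for v w
    using assms(1) that by (auto simp: formal_adjoint_def)
  have "form_cauchy (\<lambda>k. f (x k))"
    using x(1) *(2)[OF x(2) x(2)] f(1)[OF x(2)] unfolding form_cauchy_def by (meson le_less_trans)
  then show ?thesis
    using x(3)[OF f(2)] by (auto simp: represents_def lift_def *(1) x(2))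
qed

lemma linear_lift:
  assumes "formal_adjoint f g"
  shows "linear_operator completion completion (lift g)"
proof (rule linear_operatorI)
  fix \<phi> assume "\<phi> \<in> carrier completion"
  then show "lift g \<phi> \<in> carrier completion"
    using represents_lift[OF assms] by (auto simp: completion_sel)
qed (auto simp: completion_sel(3,4) lift_def)

lemma cinner_lift:
  assumes "formal_adjoint f g" "formal_adjoint g f" "\<phi> \<in> carrier completion" "\<psi> \<in> carrier completion"
  shows "cinner completion (lift g \<phi>) \<psi> = cinner completion \<phi> (lift f \<psi>)"
proof -
  note r = represents_form_rep[OF assms(4)]
  have "lift g \<phi> \<in> carrier completion"
    by (rule linear_operatorD(1)[OF linear_lift[OF assms(1)] assms(3)])
  from cinner_completion_eval[OF this r]
  have "(\<lambda>k. \<phi> (g (form_rep \<psi> k))) \<longlonglongrightarrow> cinner completion (lift g \<phi>) \<psi>"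
    using representsD(2)[OF r] by (simp add: lift_def)
  then show ?thesis
    using cinner_completion_eval[OF assms(3) represents_lift[OF assms(2) r]] LIMSEQ_unique by blast
qed

text \<open>Elements of the completion do not distinguish vectors that differ by a null vector.
  Identities between maps of \<open>X\<close> that hold only in this sense therefore become
  equations between operators on the completion.\<close>

lemma completion_eval_cong:
  assumes "\<phi> \<in> carrier completion" "v \<in> X" "w \<in> X" "\<And>z. z \<in> X \<Longrightarrow> B v z = B w z"
  shows "\<phi> v = \<phi> w"
proof -
  note r = represents_form_rep[OF assms(1)]
  have "B (form_rep \<phi> k) v = B (form_rep \<phi> k) w" for k
    using form_commute[of _ v] form_commute[of _ w] assms(2-) representsD(2)[OF r] by metis
  then show ?thesis
    using representsD(3)[OF r assms(2)] representsD(3)[OF r assms(3)] by (auto intro: LIMSEQ_unique)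
qed

lemma completion_eval_add:
  assumes "\<phi> \<in> carrier completion" "v \<in> X" "w \<in> X"
  shows "\<phi> (add v w) = \<phi> v + \<phi> w"
proof -
  note r = represents_form_rep[OF assms(1)]
  have "(\<lambda>k. B (form_rep \<phi> k) (add v w)) \<longlonglongrightarrow> \<phi> v + \<phi> w"
    using tendsto_add[OF representsD(3)[OF r assms(2)] representsD(3)[OF r assms(3)]]
      representsD(2)[OF r] assms(2,3) by (simp add: form_add_right)
  then show ?thesis
    using representsD(3)[OF r add_closed[OF assms(2,3)]] LIMSEQ_unique by blast
qed

end

section \<open>The Hardy space\<close>

text \<open>Once the coefficients below \<open>k\<close> vanish, the series can be divided by
  \<open>z^k\<close>; the quotient is 0 away from the origin and tends to \<open>a k\<close>
  there.\<close>

lemma powser_zero_imp_coeff_zero: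
  fixes a :: "nat \<Rightarrow> complex"
  assumes "\<And>z. cmod z < 1 \<Longrightarrow> (\<lambda>k. z ^ k * a k) sums 0"
  shows "a k = 0"
proof (induction k rule: less_induct)
  case (less k)
  have "((\<lambda>_. 0) \<longlongrightarrow> a (0 + k)) (at (0::complex))"
  proof (rule powser_limit_0_strong[of 1 "\<lambda>i. a (i + k)"])
    fix z :: complex assume z: "z \<noteq> 0" "norm z < 1"
    have "(\<lambda>i. z ^ (i + k) * a (i + k)) sums 0"
      using assms[OF z(2)] less sums_iff_shift[of "\<lambda>i. z ^ i * a i" k 0] by simp
    then have "(\<lambda>i. inverse (z ^ k) * (z ^ (i + k) * a (i + k))) sums (inverse (z ^ k) * 0)"
      by (rule sums_mult)
    then show "(\<lambda>i. a (i + k) * z ^ i) sums 0"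
      using z(1) by (simp add: power_add field_simps)
  qed simp
  then show ?case
    using LIM_const_eq[of 0 "a k" "0::complex"] by simp
qed

section \<open>Square-summable sequences and their power series\<close>

context hilbert_space
begin

definition square_summable :: "(nat \<Rightarrow> 'a) \<Rightarrow> bool" where
  "square_summable a \<longleftrightarrow> (\<forall>k. a k \<in> carrier H) \<and> summable (\<lambda>k. (hnorm H (a k))\<^sup>2)"

lemma square_summableD:
  assumes "square_summable a"
  shows "a k \<in> carrier H" "summable (\<lambda>k. (hnorm H (a k))\<^sup>2)"
  using assms by (simp_all add: square_summable_def)

lemma square_summable_add:
  assumes "square_summable a" "square_summable b"
  shows "square_summable (\<lambda>k. a k \<oplus>\<^bsub>H\<^esub> b k)"
  unfolding square_summable_def
proof (intro conjI allI)
  note a = square_summableD[OF assms(1)] and b = square_summableD[OF assms(2)]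
  show "a k \<oplus>\<^bsub>H\<^esub> b k \<in> carrier H" for k using a b by (simp add: carrier_intros)
  show "summable (\<lambda>k. (hnorm H (a k \<oplus>\<^bsub>H\<^esub> b k))\<^sup>2)"
  proof (rule summable_comparison_test')
    show "summable (\<lambda>k. 2 * (hnorm H (a k))\<^sup>2 + 2 * (hnorm H (b k))\<^sup>2)"
      by (intro summable_add summable_mult a b)
    have "(hnorm H (a k \<oplus>\<^bsub>H\<^esub> b k))\<^sup>2 + (hnorm H (a k \<ominus>\<^bsub>H\<^esub> b k))\<^sup>2 =
        2 * (hnorm H (a k))\<^sup>2 + 2 * (hnorm H (b k))\<^sup>2" for k
      using a b by (simp add: norm_add_sq norm_minus_sq)
    then have "(hnorm H (a k \<oplus>\<^bsub>H\<^esub> b k))\<^sup>2 \<le> 2 * (hnorm H (a k))\<^sup>2 + 2 * (hnorm H (b k))\<^sup>2" for k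
      by (metis le_add_same_cancel1 zero_le_power2)
    then show "norm ((hnorm H (a k \<oplus>\<^bsub>H\<^esub> b k))\<^sup>2) \<le> 2 * (hnorm H (a k))\<^sup>2 + 2 * (hnorm H (b k))\<^sup>2" for k
      by simp
  qed
qed

lemma square_summable_scale:
  assumes "square_summable a"
  shows "square_summable (\<lambda>k. c \<odot>\<^bsub>H\<^esub> a k)"
  using assms by (simp add: square_summable_def norm_scale power_mult_distrib scale_closed summable_mult)

lemma square_summable_contraction:
  assumes "contraction H A" "square_summable a"
  shows "square_summable (\<lambda>k. A (a k))"
  using assms contractionD(2,3)[OF assms(1)] unfolding square_summable_def
  by (auto intro!: summable_comparison_test'[where g = "\<lambda>k. (hnorm H (a k))\<^sup>2"] power_mono
      simp: hnorm_nonneg)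

lemma square_summable_shift_down:
  "square_summable a \<Longrightarrow> square_summable (\<lambda>k. a (Suc k))"
  by (simp add: square_summable_def summable_Suc_iff[of "\<lambda>k. (hnorm H (a k))\<^sup>2"])

lemma square_summable_shift_up:
  "square_summable a \<Longrightarrow> square_summable (case_nat \<zero>\<^bsub>H\<^esub> a)"
  unfolding square_summable_def
  by (auto simp: zero_carrier summable_Suc_iff[symmetric, of "\<lambda>k. (hnorm H (case_nat \<zero>\<^bsub>H\<^esub> a k))\<^sup>2"] split: nat.split)

text \<open>Square-summable coefficients are bounded, so differences of partial sums are dominated
  by those of a geometric series with ratio \<open>cmod z\<close>.\<close>

lemma cauchy_power_series:
  assumes a: "square_summable a" and z: "cmod z < 1"
  obtains l where "l \<in> carrier H" "(\<lambda>m. hnorm H ((\<Oplus>\<^bsub>H\<^esub>k\<in>{..<m}. (z ^ k) \<odot>\<^bsub>H\<^esub> a k) \<ominus>\<^bsub>H\<^esub> l)) \<longlonglongrightarrow> 0"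
proof -
  note ac = square_summableD(1)[OF a]
  define s where "s m = (\<Oplus>\<^bsub>H\<^esub>k\<in>{..<m}. (z ^ k) \<odot>\<^bsub>H\<^esub> a k)" for m
  have sc: "s m \<in> carrier H" for m
    unfolding s_def by (rule finsum_carrier) (simp add: ac scale_closed)
  have step: "s (Suc m) = s m \<oplus>\<^bsub>H\<^esub> (z ^ m) \<odot>\<^bsub>H\<^esub> a m" for m
  proof (rule vec_eqI)
    fix u assume "u \<in> carrier H"
    then show "cinner H (s (Suc m)) u = cinner H (s m \<oplus>\<^bsub>H\<^esub> (z ^ m) \<odot>\<^bsub>H\<^esub> a m) u"
      using sc[of m] ac by (simp add: cinner_add_left scale_closed)
        (simp add: s_def cinner_finsum_left scale_closed)
  qed (use sc ac in \<open>simp_all add: carrier_intros\<close>)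
  have "(\<lambda>k. (hnorm H (a k))\<^sup>2) \<longlonglongrightarrow> 0"
    by (rule summable_LIMSEQ_zero[OF square_summableD(2)[OF a]])
  from Bseq_eq_bounded convergent_imp_Bseq[OF convergentI[OF this]]
  obtain M where M: "\<And>k. (hnorm H (a k))\<^sup>2 \<le> M"
    unfolding Bseq_def by auto
  have M': "hnorm H (a k) \<le> sqrt M" for k
    using M[of k] by (rule real_le_rsqrt)
  define r where "r m = (\<Sum>k<m. cmod z ^ k * sqrt M)" for m
  have "summable (\<lambda>k. cmod z ^ k * sqrt M)"
    by (intro summable_mult2 summable_geometric) (simp add: z)
  then have "convergent r"
    using summable_iff_convergent unfolding r_def by blast
  then have "Cauchy r" by (rule convergent_Cauchy)
  have le: "hnorm H (s (m + d) \<ominus>\<^bsub>H\<^esub> s m) \<le> r (m + d) - r m" for m d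
  proof (induction d)
    case 0
    have "s m \<ominus>\<^bsub>H\<^esub> s m = \<zero>\<^bsub>H\<^esub>"
      by (rule vec_eqI) (simp_all add: sc cinner_simps)
    then show ?case by (simp add: norm_zero)
  next
    case (Suc d)
    have "s (m + Suc d) \<ominus>\<^bsub>H\<^esub> s m = (s (m + d) \<ominus>\<^bsub>H\<^esub> s m) \<oplus>\<^bsub>H\<^esub> (z ^ (m + d)) \<odot>\<^bsub>H\<^esub> a (m + d)"
      by (rule vec_eqI) (simp_all add: step sc ac cinner_simps)
    then have "hnorm H (s (m + Suc d) \<ominus>\<^bsub>H\<^esub> s m) \<le>
        hnorm H (s (m + d) \<ominus>\<^bsub>H\<^esub> s m) + hnorm H ((z ^ (m + d)) \<odot>\<^bsub>H\<^esub> a (m + d))"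
      by (simp add: hnorm_triangle sc ac carrier_intros)
    also have "hnorm H ((z ^ (m + d)) \<odot>\<^bsub>H\<^esub> a (m + d)) \<le> cmod z ^ (m + d) * sqrt M"
      using M' by (simp add: norm_scale ac norm_power mult_left_mono)
    finally show ?case using Suc by (simp add: r_def)
  qed
  have "\<exists>N. \<forall>k\<ge>N. \<forall>m\<ge>N. hnorm H (s k \<ominus>\<^bsub>H\<^esub> s m) < e" if "e > 0" for e
  proof -
    obtain N where N: "\<And>k m. k \<ge> N \<Longrightarrow> m \<ge> N \<Longrightarrow> norm (r k - r m) < e"
      using \<open>Cauchy r\<close> \<open>e > 0\<close> unfolding Cauchy_iff by blast
    have *: "hnorm H (s k \<ominus>\<^bsub>H\<^esub> s m) < e" if "k \<ge> N" "m \<ge> N" "m \<le> k" for k m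
      using le[of m "k - m"] N[of k m] that by simp
    have "hnorm H (s k \<ominus>\<^bsub>H\<^esub> s m) < e" if "k \<ge> N" "m \<ge> N" for k m
      using *[of k m] *[of m k] that norm_minus_commute[OF sc sc, of k m] by (cases "m \<le> k") auto
    then show ?thesis by blast
  qed
  from cauchy_norm_convergent[of s, OF sc this] show ?thesis
    using that unfolding s_def by blast
qed

lemma hardy_series_iff:
  "hardy_series H a f \<longleftrightarrow> square_summable a \<and> (\<forall>z\<in>unit_disc. f z \<in> carrier H \<and>
    (\<lambda>m. hnorm H ((\<Oplus>\<^bsub>H\<^esub>k\<in>{..<m}. (z ^ k) \<odot>\<^bsub>H\<^esub> a k) \<ominus>\<^bsub>H\<^esub> f z)) \<longlonglongrightarrow> 0)"
proof -
  have "(\<Oplus>\<^bsub>H\<^esub>k\<in>{..<m}. (z ^ k) \<odot>\<^bsub>H\<^esub> a k) \<in> carrier H" if "\<forall>k. a k \<in> carrier H" for m z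
    using that by (intro finsum_carrier scale_closed) auto
  then show ?thesis
    unfolding hardy_series_def limitin_iff_norm square_summable_def image_subset_iff
    by (auto intro!: always_eventually)
qed

text \<open>Since the Taylor coefficients of \<open>f\<close> are determined by those of the scalar functions
  \<open>\<lambda>z. cinner H (f z) u\<close>, elements of the Hardy space can be identified weakly.\<close>

lemma hardy_series_weak:
  assumes "hardy_series H a f" "z \<in> unit_disc" "u \<in> carrier H"
  shows "(\<lambda>k. z ^ k * cinner H (a k) u) sums cinner H (f z) u"
proof -
  have a: "a k \<in> carrier H" for k
    using assms(1) by (simp add: hardy_series_iff square_summable_def)
  have "(\<lambda>m. cinner H (\<Oplus>\<^bsub>H\<^esub>k\<in>{..<m}. (z ^ k) \<odot>\<^bsub>H\<^esub> a k) u) \<longlonglongrightarrow> cinner H (f z) u"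
    using assms a by (intro tendsto_norm_imp_weak finsum_carrier)
      (auto simp: hardy_series_iff scale_closed)
  then show ?thesis
    using a assms(3) by (simp add: sums_def cinner_finsum_left scale_closed cinner_scale_left)
qed

lemma hardy_series_exists:
  assumes "square_summable a"
  obtains f where "f \<in> unit_disc \<rightarrow>\<^sub>E carrier H" "hardy_series H a f"
proof -
  have "\<exists>l. l \<in> carrier H \<and> (\<lambda>m. hnorm H ((\<Oplus>\<^bsub>H\<^esub>k\<in>{..<m}. (z ^ k) \<odot>\<^bsub>H\<^esub> a k) \<ominus>\<^bsub>H\<^esub> l)) \<longlonglongrightarrow> 0"
    if "z \<in> unit_disc" for z
    using cauchy_power_series[OF assms, of z] that by auto
  then obtain l where l: "\<And>z. z \<in> unit_disc \<Longrightarrow> l z \<in> carrier H \<and>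
      (\<lambda>m. hnorm H ((\<Oplus>\<^bsub>H\<^esub>k\<in>{..<m}. (z ^ k) \<odot>\<^bsub>H\<^esub> a k) \<ominus>\<^bsub>H\<^esub> l z)) \<longlonglongrightarrow> 0"
    by metis
  show ?thesis
    by (rule that[of "restrict l unit_disc"]) (use l assms in \<open>auto simp: hardy_series_iff\<close>)
qed

lemma hardy_series_coeff_unique:
  assumes "hardy_series H a f" "hardy_series H b f"
  shows "a = b"
proof
  fix k
  have ac: "a k \<in> carrier H" and bc: "b k \<in> carrier H" for k
    using assms by (simp_all add: hardy_series_iff square_summable_def)
  show "a k = b k"
  proof (rule vec_eqI)
    fix u assume u: "u \<in> carrier H"
    have "(\<lambda>k. z ^ k * (cinner H (a k) u - cinner H (b k) u)) sums 0" if "cmod z < 1" for z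
      using sums_diff[OF hardy_series_weak[OF assms(1) _ u, of z] hardy_series_weak[OF assms(2) _ u, of z]] that
      by (simp add: algebra_simps)
    from powser_zero_imp_coeff_zero[of "\<lambda>k. cinner H (a k) u - cinner H (b k) u", OF this]
    show "cinner H (a k) u = cinner H (b k) u" by simp
  qed (use ac bc in auto)
qed

section \<open>The Hardy space in terms of coefficient sequences\<close>

lemma hardy_coeff_eqI: "hardy_series H a f \<Longrightarrow> hardy_coeff H f = a"
  unfolding hardy_coeff_def using hardy_series_coeff_unique by blast

lemma hardy_sel:
  "carrier (hardy H) = {f \<in> unit_disc \<rightarrow>\<^sub>E carrier H. \<exists>a. hardy_series H a f}"
  "\<zero>\<^bsub>hardy H\<^esub> = (\<lambda>z\<in>unit_disc. \<zero>\<^bsub>H\<^esub>)"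
  "f \<oplus>\<^bsub>hardy H\<^esub> g = (\<lambda>z\<in>unit_disc. f z \<oplus>\<^bsub>H\<^esub> g z)"
  "c \<odot>\<^bsub>hardy H\<^esub> f = (\<lambda>z\<in>unit_disc. c \<odot>\<^bsub>H\<^esub> f z)"
  "cinner (hardy H) f g = (\<Sum>k. cinner H (hardy_coeff H f k) (hardy_coeff H g k))"
  by (simp_all add: hardy_def)

lemma hardy_series_hardy_coeff:
  assumes "f \<in> carrier (hardy H)"
  shows "hardy_series H (hardy_coeff H f) f"
  using assms hardy_coeff_eqI by (auto simp: hardy_sel)

lemma hardy_value: "\<lbrakk>f \<in> carrier (hardy H); z \<in> unit_disc\<rbrakk> \<Longrightarrow> f z \<in> carrier H"
  by (auto simp: hardy_sel)

lemma hardy_coeff_square_summable: "f \<in> carrier (hardy H) \<Longrightarrow> square_summable (hardy_coeff H f)"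
  using hardy_series_hardy_coeff hardy_series_iff by blast

lemma hardy_coeff_carrier: "f \<in> carrier (hardy H) \<Longrightarrow> hardy_coeff H f k \<in> carrier H"
  using hardy_coeff_square_summable square_summableD by blast

lemma hardy_weak:
  "\<lbrakk>f \<in> carrier (hardy H); z \<in> unit_disc; u \<in> carrier H\<rbrakk> \<Longrightarrow>
    (\<lambda>k. z ^ k * cinner H (hardy_coeff H f k) u) sums cinner H (f z) u"
  by (intro hardy_series_weak hardy_series_hardy_coeff)

text \<open>The series of \<open>a\<close> converges in norm to some Hardy function
  \<open>g\<close>, and the scalar series force \<open>f = g\<close>. Membership in the Hardy space
  and the Taylor coefficients can thus be read off from scalar series alone.\<close>

lemma hardy_weakI:
  assumes a: "square_summable a" and f: "f \<in> unit_disc \<rightarrow>\<^sub>E carrier H"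
    and w: "\<And>z u. \<lbrakk>z \<in> unit_disc; u \<in> carrier H\<rbrakk> \<Longrightarrow>
      (\<lambda>k. z ^ k * cinner H (a k) u) sums cinner H (f z) u"
  shows "f \<in> carrier (hardy H)" "hardy_coeff H f = a"
proof -
  obtain g where g: "g \<in> unit_disc \<rightarrow>\<^sub>E carrier H" "hardy_series H a g"
    using hardy_series_exists[OF a] by blast
  have "f z = g z" if "z \<in> unit_disc" for z
  proof (rule vec_eqI)
    fix u assume "u \<in> carrier H"
    then show "cinner H (f z) u = cinner H (g z) u"
      using w[OF that] hardy_series_weak[OF g(2) that] sums_unique2 by blast
  qed (use f g that in auto)
  then have "f = g"
    using f g(1) by (metis PiE_ext)
  then show "f \<in> carrier (hardy H)" "hardy_coeff H f = a"
    using g hardy_coeff_eqI by (auto simp: hardy_sel)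
qed

lemma hardy_exists:
  assumes "square_summable a"
  obtains f where "f \<in> carrier (hardy H)" "hardy_coeff H f = a"
proof -
  obtain f where "f \<in> unit_disc \<rightarrow>\<^sub>E carrier H" "hardy_series H a f"
    using hardy_series_exists[OF assms] by blast
  then show ?thesis
    using that hardy_coeff_eqI by (auto simp: hardy_sel)
qed

definition hardy_of :: "(nat \<Rightarrow> 'a) \<Rightarrow> complex \<Rightarrow> 'a" where
  "hardy_of a = (SOME f. f \<in> carrier (hardy H) \<and> hardy_coeff H f = a)"

lemma hardy_of:
  assumes "square_summable a"
  shows "hardy_of a \<in> carrier (hardy H)" "hardy_coeff H (hardy_of a) = a"
  using hardy_exists[OF assms] someI_ex[of "\<lambda>f. f \<in> carrier (hardy H) \<and> hardy_coeff H f = a"]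
  unfolding hardy_of_def by blast+

lemma hardy_eqI:
  assumes "f \<in> carrier (hardy H)" "g \<in> carrier (hardy H)"
    and "\<And>k. hardy_coeff H f k = hardy_coeff H g k"
  shows "f = g"
proof (rule PiE_ext)
  show "f \<in> unit_disc \<rightarrow>\<^sub>E carrier H" "g \<in> unit_disc \<rightarrow>\<^sub>E carrier H"
    using assms(1,2) by (auto simp: hardy_sel)
  fix z assume z: "z \<in> unit_disc"
  show "f z = g z"
  proof (rule vec_eqI)
    fix u assume "u \<in> carrier H"
    then show "cinner H (f z) u = cinner H (g z) u"
      using hardy_weak[OF assms(1) z] hardy_weak[OF assms(2) z] assms(3) sums_unique2
      by (metis (no_types, lifting) sums_cong)
  qed (use assms z in \<open>auto simp: hardy_value\<close>)
qed

lemma hardy_add: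
  assumes f: "f \<in> carrier (hardy H)" and g: "g \<in> carrier (hardy H)"
  shows "f \<oplus>\<^bsub>hardy H\<^esub> g \<in> carrier (hardy H)"
    and "hardy_coeff H (f \<oplus>\<^bsub>hardy H\<^esub> g) = (\<lambda>k. hardy_coeff H f k \<oplus>\<^bsub>H\<^esub> hardy_coeff H g k)"
proof -
  have *: "(\<lambda>k. z ^ k * cinner H (hardy_coeff H f k \<oplus>\<^bsub>H\<^esub> hardy_coeff H g k) u) sums
      cinner H ((f \<oplus>\<^bsub>hardy H\<^esub> g) z) u" if "z \<in> unit_disc" "u \<in> carrier H" for z u
    using sums_add[OF hardy_weak[OF f that] hardy_weak[OF g that]] that f g
    by (simp add: hardy_sel(3) cinner_add_left hardy_value hardy_coeff_carrier distrib_left)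
  have "f \<oplus>\<^bsub>hardy H\<^esub> g \<in> unit_disc \<rightarrow>\<^sub>E carrier H"
    using f g by (auto simp: hardy_sel(3) hardy_value carrier_intros)
  from hardy_weakI[OF square_summable_add this *] f g
  show "f \<oplus>\<^bsub>hardy H\<^esub> g \<in> carrier (hardy H)"
    and "hardy_coeff H (f \<oplus>\<^bsub>hardy H\<^esub> g) = (\<lambda>k. hardy_coeff H f k \<oplus>\<^bsub>H\<^esub> hardy_coeff H g k)"
    by (simp_all add: hardy_coeff_square_summable)
qed

lemma hardy_scale:
  assumes f: "f \<in> carrier (hardy H)"
  shows "c \<odot>\<^bsub>hardy H\<^esub> f \<in> carrier (hardy H)"
    and "hardy_coeff H (c \<odot>\<^bsub>hardy H\<^esub> f) = (\<lambda>k. c \<odot>\<^bsub>H\<^esub> hardy_coeff H f k)"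
proof -
  have *: "(\<lambda>k. z ^ k * cinner H (c \<odot>\<^bsub>H\<^esub> hardy_coeff H f k) u) sums
      cinner H ((c \<odot>\<^bsub>hardy H\<^esub> f) z) u" if "z \<in> unit_disc" "u \<in> carrier H" for z u
    using sums_mult[OF hardy_weak[OF f that], of c] that f
    by (simp add: hardy_sel(4) cinner_scale_left hardy_value hardy_coeff_carrier mult.left_commute)
  have "c \<odot>\<^bsub>hardy H\<^esub> f \<in> unit_disc \<rightarrow>\<^sub>E carrier H"
    using f by (auto simp: hardy_sel(4) hardy_value carrier_intros)
  from hardy_weakI[OF square_summable_scale this *] f
  show "c \<odot>\<^bsub>hardy H\<^esub> f \<in> carrier (hardy H)"
    and "hardy_coeff H (c \<odot>\<^bsub>hardy H\<^esub> f) = (\<lambda>k. c \<odot>\<^bsub>H\<^esub> hardy_coeff H f k)"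
    by (simp_all add: hardy_coeff_square_summable)
qed

lemma hardy_zero:
  shows "\<zero>\<^bsub>hardy H\<^esub> \<in> carrier (hardy H)" "hardy_coeff H \<zero>\<^bsub>hardy H\<^esub> = (\<lambda>k. \<zero>\<^bsub>H\<^esub>)"
proof -
  have "square_summable (\<lambda>k. \<zero>\<^bsub>H\<^esub>)"
    by (simp add: square_summable_def zero_carrier norm_zero)
  moreover have "\<zero>\<^bsub>hardy H\<^esub> \<in> unit_disc \<rightarrow>\<^sub>E carrier H"
    by (auto simp: hardy_sel(2) zero_carrier)
  moreover have "(\<lambda>k. z ^ k * cinner H \<zero>\<^bsub>H\<^esub> u) sums cinner H (\<zero>\<^bsub>hardy H\<^esub> z) u"
    if "z \<in> unit_disc" "u \<in> carrier H" for z u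
    using that by (simp add: hardy_sel(2) cinner_zero_left)
  ultimately show "\<zero>\<^bsub>hardy H\<^esub> \<in> carrier (hardy H)" "hardy_coeff H \<zero>\<^bsub>hardy H\<^esub> = (\<lambda>k. \<zero>\<^bsub>H\<^esub>)"
    using hardy_weakI by blast+
qed

lemma summable_cinner:
  assumes "square_summable a" "square_summable b"
  shows "summable (\<lambda>k. cinner H (a k) (b k))"
proof (rule summable_comparison_test')
  note a = square_summableD[OF assms(1)] and b = square_summableD[OF assms(2)]
  show "summable (\<lambda>k. (hnorm H (a k))\<^sup>2 + (hnorm H (b k))\<^sup>2)"
    by (intro summable_add a b)
  fix k
  have "cmod (cinner H (a k) (b k)) \<le> hnorm H (a k) * hnorm H (b k)"
    by (rule cauchy_schwarz[OF a(1) b(1)])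
  also have "\<dots> \<le> (hnorm H (a k))\<^sup>2 + (hnorm H (b k))\<^sup>2"
    using sum_squares_bound[of "hnorm H (a k)" "hnorm H (b k)"]
      mult_nonneg_nonneg[OF hnorm_nonneg[OF a(1)] hnorm_nonneg[OF b(1)], of k k] by linarith
  finally show "cmod (cinner H (a k) (b k)) \<le> (hnorm H (a k))\<^sup>2 + (hnorm H (b k))\<^sup>2" .
qed

lemma cinner_hardy_sums:
  assumes "f \<in> carrier (hardy H)" "g \<in> carrier (hardy H)"
  shows "(\<lambda>k. cinner H (hardy_coeff H f k) (hardy_coeff H g k)) sums cinner (hardy H) f g"
  using summable_sums[OF summable_cinner[OF hardy_coeff_square_summable[OF assms(1)]
    hardy_coeff_square_summable[OF assms(2)]]]
  by (simp add: hardy_sel(5))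

lemma inner_product_space_hardy: "inner_product_space (hardy H)"
proof (rule inner_product_space.intro)
  interpret M: Module.module complex_field H by (rule vector_space)
  note [simp] = hardy_add hardy_scale hardy_zero hardy_coeff_carrier
  have "abelian_group (hardy H)"
  proof (rule abelian_groupI)
    fix f assume f: "f \<in> carrier (hardy H)"
    have "(- 1) \<odot>\<^bsub>hardy H\<^esub> f \<oplus>\<^bsub>hardy H\<^esub> f = \<zero>\<^bsub>hardy H\<^esub>"
      by (rule hardy_eqI) (use f in \<open>auto intro!: vec_eqI simp: cinner_simps\<close>)
    then show "\<exists>g\<in>carrier (hardy H). g \<oplus>\<^bsub>hardy H\<^esub> f = \<zero>\<^bsub>hardy H\<^esub>"
      using f hardy_scale(1) by blast
  next
    fix f g h assume "f \<in> carrier (hardy H)" "g \<in> carrier (hardy H)" "h \<in> carrier (hardy H)"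
    then show "f \<oplus>\<^bsub>hardy H\<^esub> g \<oplus>\<^bsub>hardy H\<^esub> h = f \<oplus>\<^bsub>hardy H\<^esub> (g \<oplus>\<^bsub>hardy H\<^esub> h)"
      by (intro hardy_eqI) (auto intro!: vec_eqI simp: cinner_simps)
  next
    fix f g assume "f \<in> carrier (hardy H)" "g \<in> carrier (hardy H)"
    then show "f \<oplus>\<^bsub>hardy H\<^esub> g = g \<oplus>\<^bsub>hardy H\<^esub> f"
      by (intro hardy_eqI) (auto intro!: vec_eqI simp: cinner_simps)
  next
    fix f assume "f \<in> carrier (hardy H)"
    then show "\<zero>\<^bsub>hardy H\<^esub> \<oplus>\<^bsub>hardy H\<^esub> f = f"
      by (intro hardy_eqI) (auto intro!: vec_eqI simp: cinner_simps)
  qed auto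
  then show "Module.module complex_field (hardy H)"
  proof (rule moduleI[OF cring_complex_field])
    fix f g a b assume f: "f \<in> carrier (hardy H)" and g: "g \<in> carrier (hardy H)"
    show "(a \<oplus>\<^bsub>complex_field\<^esub> b) \<odot>\<^bsub>hardy H\<^esub> f = a \<odot>\<^bsub>hardy H\<^esub> f \<oplus>\<^bsub>hardy H\<^esub> b \<odot>\<^bsub>hardy H\<^esub> f"
      "(a \<otimes>\<^bsub>complex_field\<^esub> b) \<odot>\<^bsub>hardy H\<^esub> f = a \<odot>\<^bsub>hardy H\<^esub> (b \<odot>\<^bsub>hardy H\<^esub> f)"
      "a \<odot>\<^bsub>hardy H\<^esub> (f \<oplus>\<^bsub>hardy H\<^esub> g) = a \<odot>\<^bsub>hardy H\<^esub> f \<oplus>\<^bsub>hardy H\<^esub> a \<odot>\<^bsub>hardy H\<^esub> g"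
      "\<one>\<^bsub>complex_field\<^esub> \<odot>\<^bsub>hardy H\<^esub> f = f"
      by (rule hardy_eqI; use f g in \<open>auto intro!: vec_eqI simp: cinner_simps complex_field_def algebra_simps\<close>)+
  qed simp
  fix f g assume f: "f \<in> carrier (hardy H)" and g: "g \<in> carrier (hardy H)"
  note sums = cinner_hardy_sums
  show "cinner (hardy H) (c \<odot>\<^bsub>hardy H\<^esub> f) g = c * cinner (hardy H) f g" for c
    by (rule sums_unique2[OF sums]) (use f g sums_mult[OF sums[OF f g], of c] in \<open>simp_all add: cinner_simps\<close>)
  show "cinner (hardy H) f g = cnj (cinner (hardy H) g f)"
  proof (rule sums_unique2[OF sums[OF f g]])
    have "cnj (cinner H (hardy_coeff H g k) (hardy_coeff H f k)) =
        cinner H (hardy_coeff H f k) (hardy_coeff H g k)" for k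
      using cinner_commute[of "hardy_coeff H f k" "hardy_coeff H g k"] f g by simp
    then show "(\<lambda>k. cinner H (hardy_coeff H f k) (hardy_coeff H g k)) sums cnj (cinner (hardy H) g f)"
      using sums_cnj[THEN iffD2, OF sums[OF g f]] by simp
  qed
  show "cinner (hardy H) (f \<oplus>\<^bsub>hardy H\<^esub> g) h = cinner (hardy H) f h + cinner (hardy H) g h"
    if "h \<in> carrier (hardy H)" for h
    by (rule sums_unique2[OF sums])
      (use f g that sums_add[OF sums[OF f that] sums[OF g that]] in \<open>simp_all add: cinner_simps\<close>)
next
  fix f assume f: "f \<in> carrier (hardy H)"
  have *: "(\<lambda>k. Re (cinner H (hardy_coeff H f k) (hardy_coeff H f k))) sums Re (cinner (hardy H) f f)"
    by (rule sums_Re[OF cinner_hardy_sums[OF f f]])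
  have nn: "0 \<le> Re (cinner H (hardy_coeff H f k) (hardy_coeff H f k))" for k
    by (rule cinner_nonneg[OF hardy_coeff_carrier[OF f]])
  show "0 \<le> Re (cinner (hardy H) f f)"
    by (rule sums_le[OF nn sums_zero *])
  assume "cinner (hardy H) f f = 0"
  with * have "(\<Sum>k. Re (cinner H (hardy_coeff H f k) (hardy_coeff H f k))) = 0"
    by (simp add: sums_iff)
  then have "Re (cinner H (hardy_coeff H f k) (hardy_coeff H f k)) = 0" for k
    using suminf_eq_zero_iff[OF sums_summable[OF *] nn] by simp
  then have "hnorm H (hardy_coeff H f k) = 0" for k
    by (simp add: hnorm_def)
  then show "f = \<zero>\<^bsub>hardy H\<^esub>"
    using f by (intro hardy_eqI) (simp_all add: hardy_zero hnorm_eq_0 hardy_coeff_carrier)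
qed

lemma hnorm_hardy_sums:
  assumes "f \<in> carrier (hardy H)"
  shows "(\<lambda>k. (hnorm H (hardy_coeff H f k))\<^sup>2) sums (hnorm (hardy H) f)\<^sup>2"
  using sums_Re[OF cinner_hardy_sums[OF assms assms]] assms
    inner_product_space.norm_sq[OF inner_product_space_hardy assms]
  by (simp add: norm_sq hardy_coeff_carrier)

lemma hardy_minus:
  assumes f: "f \<in> carrier (hardy H)" and g: "g \<in> carrier (hardy H)"
  shows "f \<ominus>\<^bsub>hardy H\<^esub> g \<in> carrier (hardy H)"
    and "hardy_coeff H (f \<ominus>\<^bsub>hardy H\<^esub> g) k = hardy_coeff H f k \<ominus>\<^bsub>H\<^esub> hardy_coeff H g k"
proof -
  interpret HH: inner_product_space "hardy H" by (rule inner_product_space_hardy)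
  show "f \<ominus>\<^bsub>hardy H\<^esub> g \<in> carrier (hardy H)" using f g by (rule HH.minus_carrier)
  show "hardy_coeff H (f \<ominus>\<^bsub>hardy H\<^esub> g) k = hardy_coeff H f k \<ominus>\<^bsub>H\<^esub> hardy_coeff H g k"
    using f g by (simp add: a_minus_def HH.uminus_eq_scale uminus_eq_scale hardy_coeff_carrier
        hardy_add hardy_scale)
qed

section \<open>Multiplication by affine symbols\<close>

definition affine_symbol :: "('a \<Rightarrow> 'a) \<Rightarrow> ('a \<Rightarrow> 'a) \<Rightarrow> complex \<Rightarrow> 'a \<Rightarrow> 'a" where
  "affine_symbol A B z x = A x \<oplus>\<^bsub>H\<^esub> z \<odot>\<^bsub>H\<^esub> B x"

text \<open>The factor \<open>z\<close> moves the coefficients of the \<open>B\<close> part up one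
  place, with zero at index 0. When tested against \<open>u\<close>, the operators \<open>A\<close>
  and \<open>B\<close> pass to \<open>u\<close> as adjoints, and what remains are the scalar series
  of \<open>f\<close>.\<close>

lemma mult_op_affine:
  assumes A: "contraction H A" and B: "contraction H B" and f: "f \<in> carrier (hardy H)"
  shows "mult_op (affine_symbol A B) f \<in> carrier (hardy H)"
    and "hardy_coeff H (mult_op (affine_symbol A B) f) =
      (\<lambda>k. A (hardy_coeff H f k) \<oplus>\<^bsub>H\<^esub> case_nat \<zero>\<^bsub>H\<^esub> (\<lambda>j. B (hardy_coeff H f j)) k)"
proof -
  note Ac = contractionD(2)[OF A] and Bc = contractionD(2)[OF B]
  note fc = hardy_coeff_carrier[OF f] and fv = hardy_value[OF f]
  define b where "b = case_nat \<zero>\<^bsub>H\<^esub> (\<lambda>j. B (hardy_coeff H f j))"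
  have b: "square_summable b"
    unfolding b_def
    by (intro square_summable_shift_up square_summable_contraction[OF B] hardy_coeff_square_summable f)
  have A_sums: "(\<lambda>k. z ^ k * cinner H (A (hardy_coeff H f k)) u) sums cinner H (A (f z)) u"
    if "z \<in> unit_disc" "u \<in> carrier H" for z u
    using hardy_weak[OF f that(1) adj_contraction(1)[OF A that(2)]] that
    by (simp add: adj_contraction(2)[OF A that(2)] fc fv)
  have B_sums: "(\<lambda>k. z ^ k * cinner H (b k) u) sums (z * cinner H (B (f z)) u)"
    if "z \<in> unit_disc" "u \<in> carrier H" for z u
  proof -
    have "(\<lambda>k. z ^ k * cinner H (B (hardy_coeff H f k)) u) sums cinner H (B (f z)) u"
      using hardy_weak[OF f that(1) adj_contraction(1)[OF B that(2)]] that
      by (simp add: adj_contraction(2)[OF B that(2)] fc fv)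
    from sums_mult[OF this, of z] have "(\<lambda>k. z ^ Suc k * cinner H (b (Suc k)) u) sums (z * cinner H (B (f z)) u)"
      by (simp add: b_def mult.assoc)
    from sums_Suc[OF this] show ?thesis using that by (simp add: b_def cinner_zero_left)
  qed
  have bc: "b k \<in> carrier H" for k using b by (rule square_summableD)
  have *: "(\<lambda>k. z ^ k * cinner H (A (hardy_coeff H f k) \<oplus>\<^bsub>H\<^esub> b k) u) sums
      cinner H (mult_op (affine_symbol A B) f z) u" if "z \<in> unit_disc" "u \<in> carrier H" for z u
    using sums_add[OF A_sums[OF that] B_sums[OF that]] that
    by (simp add: mult_op_def affine_symbol_def Ac Bc bc fc fv cinner_simps distrib_left)
  have "mult_op (affine_symbol A B) f \<in> unit_disc \<rightarrow>\<^sub>E carrier H"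
    using fv by (auto simp: mult_op_def affine_symbol_def Ac Bc carrier_intros)
  from hardy_weakI[OF square_summable_add[OF square_summable_contraction[OF A] b] this *]
  show "mult_op (affine_symbol A B) f \<in> carrier (hardy H)"
    and "hardy_coeff H (mult_op (affine_symbol A B) f) =
      (\<lambda>k. A (hardy_coeff H f k) \<oplus>\<^bsub>H\<^esub> case_nat \<zero>\<^bsub>H\<^esub> (\<lambda>j. B (hardy_coeff H f j)) k)"
    using f by (simp_all add: hardy_coeff_square_summable b_def)
qed

lemma linear_affine_symbol:
  assumes A: "linear_operator H H A" and B: "linear_operator H H B"
  shows "linear_operator H H (affine_symbol A B z)"
proof (rule linear_operatorI)
  note lin = linear_operatorD[OF A] linear_operatorD[OF B]
  fix x y assume "x \<in> carrier H" "y \<in> carrier H"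
  then show "affine_symbol A B z (x \<oplus>\<^bsub>H\<^esub> y) = affine_symbol A B z x \<oplus>\<^bsub>H\<^esub> affine_symbol A B z y"
    by (intro vec_eqI) (simp_all add: affine_symbol_def lin cinner_simps algebra_simps)
next
  note lin = linear_operatorD[OF A] linear_operatorD[OF B]
  fix c x assume "x \<in> carrier H"
  then show "affine_symbol A B z (c \<odot>\<^bsub>H\<^esub> x) = c \<odot>\<^bsub>H\<^esub> affine_symbol A B z x"
    by (intro vec_eqI) (simp_all add: affine_symbol_def lin cinner_simps algebra_simps)
qed (simp add: affine_symbol_def linear_operatorD[OF A] linear_operatorD[OF B] carrier_intros)

text \<open>The difference quotient of an affine symbol is exactly \<open>B\<close>, so the error in
  the definition of the derivative is the zero vector. On the disc two contractions give the bound
  2.\<close>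

lemma bounded_analytic_affine:
  assumes A: "contraction H A" and B: "contraction H B"
  shows "bounded_analytic H (affine_symbol A B)"
proof -
  note Ac = contractionD[OF A] and Bc = contractionD[OF B]
  have bd: "hnorm H (affine_symbol A B z x) \<le> 2 * hnorm H x" if "z \<in> unit_disc" "x \<in> carrier H" for z x
  proof -
    have "hnorm H (affine_symbol A B z x) \<le> hnorm H (A x) + cmod z * hnorm H (B x)"
      using that Ac Bc hnorm_triangle[of "A x" "z \<odot>\<^bsub>H\<^esub> B x"]
      by (simp add: affine_symbol_def norm_scale scale_closed)
    also have "cmod z * hnorm H (B x) \<le> 1 * hnorm H x"
      using that Bc by (intro mult_mono) (auto simp: hnorm_nonneg)
    finally show ?thesis using Ac(3)[OF that(2)] by simp
  qed
  have lin: "linear_operator H H (affine_symbol A B z)" for z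
    by (rule linear_affine_symbol[OF Ac(1) Bc(1)])
  have B_bounded: "bounded_operator H B"
    unfolding bounded_operator_def using Bc by (auto intro!: exI[of _ 1])
  have deriv: "\<forall>x\<in>carrier H. hnorm H (inverse (w - z) \<odot>\<^bsub>H\<^esub>
        (affine_symbol A B w x \<ominus>\<^bsub>H\<^esub> affine_symbol A B z x) \<ominus>\<^bsub>H\<^esub> B x) \<le> \<epsilon> * hnorm H x"
    if "w \<noteq> z" "\<epsilon> > 0" for w z \<epsilon>
  proof
    fix x assume x: "x \<in> carrier H"
    have "inverse (w - z) \<odot>\<^bsub>H\<^esub> (affine_symbol A B w x \<ominus>\<^bsub>H\<^esub> affine_symbol A B z x) \<ominus>\<^bsub>H\<^esub> B x = \<zero>\<^bsub>H\<^esub>"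
    proof (rule vec_eqI)
      fix u assume u: "u \<in> carrier H"
      have "cinner H (inverse (w - z) \<odot>\<^bsub>H\<^esub> (affine_symbol A B w x \<ominus>\<^bsub>H\<^esub> affine_symbol A B z x) \<ominus>\<^bsub>H\<^esub> B x) u
        = inverse (w - z) * ((w - z) * cinner H (B x) u) - cinner H (B x) u"
        using x u Ac(2) Bc(2) by (simp add: affine_symbol_def cinner_simps algebra_simps)
      then show "cinner H (inverse (w - z) \<odot>\<^bsub>H\<^esub> (affine_symbol A B w x \<ominus>\<^bsub>H\<^esub> affine_symbol A B z x) \<ominus>\<^bsub>H\<^esub> B x) u
        = cinner H \<zero>\<^bsub>H\<^esub> u"
        using \<open>w \<noteq> z\<close> u by (simp add: cinner_zero_left)
    qed (use x Ac(2) Bc(2) in \<open>simp_all add: affine_symbol_def carrier_intros\<close>)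
    then show "hnorm H (inverse (w - z) \<odot>\<^bsub>H\<^esub>
        (affine_symbol A B w x \<ominus>\<^bsub>H\<^esub> affine_symbol A B z x) \<ominus>\<^bsub>H\<^esub> B x) \<le> \<epsilon> * hnorm H x"
      using \<open>\<epsilon> > 0\<close> x by (simp add: norm_zero hnorm_nonneg)
  qed
  show ?thesis
    unfolding bounded_analytic_def bounded_operator_def[of H "affine_symbol A B _"]
  proof (intro conjI ballI)
    show "\<exists>C. \<forall>z\<in>unit_disc. \<forall>x\<in>carrier H. hnorm H (affine_symbol A B z x) \<le> C * hnorm H x"
      using bd by blast
    fix z assume z: "z \<in> unit_disc"
    show "\<exists>C. \<forall>x\<in>carrier H. hnorm H (affine_symbol A B z x) \<le> C * hnorm H x"
      using bd z by blast
    show "\<exists>D. bounded_operator H D \<and>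
        (\<forall>\<epsilon>>0. \<forall>\<^sub>F w in at z. \<forall>x\<in>carrier H. hnorm H (inverse (w - z) \<odot>\<^bsub>H\<^esub>
          (affine_symbol A B w x \<ominus>\<^bsub>H\<^esub> affine_symbol A B z x) \<ominus>\<^bsub>H\<^esub> D x) \<le> \<epsilon> * hnorm H x)"
      using B_bounded deriv by (intro exI[of _ B]) (simp add: eventually_at_filter)
  qed (rule lin)
qed

end

section \<open>Model tuples of commuting isometries\<close>

lemma contraction_comp:
  "\<lbrakk>contraction H A; contraction H B\<rbrakk> \<Longrightarrow> contraction H (\<lambda>x. A (B x))"
  unfolding contraction_def linear_operator_def
  by (auto simp: Pi_iff) (meson order_trans)

lemma tuple_prod_carrier:
  assumes "\<And>i x. \<lbrakk>i \<in> {1..n}; x \<in> S\<rbrakk> \<Longrightarrow> A i x \<in> S" "x \<in> S"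
  shows "tuple_prod n A x \<in> S"
  using assms by (induction n arbitrary: x) auto

lemma tuple_prod_contraction:
  assumes "\<And>i. i \<in> {1..n} \<Longrightarrow> contraction H (A i)"
  shows "contraction H (tuple_prod n A)"
  using assms
proof (induction n)
  case 0
  show ?case by (auto simp: contraction_def linear_operator_def)
next
  case (Suc n)
  then show ?case
    using contraction_comp[of H "tuple_prod n A" "A (Suc n)"] by (simp add: comp_def)
qed

context hilbert_space
begin

lemma linear_mult_op_affine:
  assumes A: "contraction H A" and B: "contraction H B"
  shows "linear_operator (hardy H) (hardy H) (mult_op (affine_symbol A B))"
proof (rule linear_operatorI)
  note lin = linear_operatorD[OF contractionD(1)[OF A]] linear_operatorD[OF contractionD(1)[OF B]]
  note [simp] = mult_op_affine[OF A B] hardy_add hardy_scale hardy_coeff_carrier lin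
  fix f assume f: "f \<in> carrier (hardy H)"
  then show "mult_op (affine_symbol A B) f \<in> carrier (hardy H)" by simp
  show "mult_op (affine_symbol A B) (c \<odot>\<^bsub>hardy H\<^esub> f) = c \<odot>\<^bsub>hardy H\<^esub> mult_op (affine_symbol A B) f" for c
    using f by (intro hardy_eqI)
      (auto intro!: vec_eqI simp: cinner_simps algebra_simps split: nat.split)
  show "mult_op (affine_symbol A B) (f \<oplus>\<^bsub>hardy H\<^esub> g) =
      mult_op (affine_symbol A B) f \<oplus>\<^bsub>hardy H\<^esub> mult_op (affine_symbol A B) g"
    if "g \<in> carrier (hardy H)" for g
    using f that by (intro hardy_eqI)
      (auto intro!: vec_eqI simp: cinner_simps algebra_simps split: nat.split)
qed

lemma contraction_zero: "contraction H (\<lambda>_. \<zero>\<^bsub>H\<^esub>)"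
  unfolding contraction_def
proof (intro conjI ballI linear_operatorI)
  fix c show "\<zero>\<^bsub>H\<^esub> = c \<odot>\<^bsub>H\<^esub> \<zero>\<^bsub>H\<^esub>"
    by (rule vec_eqI) (simp_all add: cinner_simps)
next
  show "\<zero>\<^bsub>H\<^esub> = \<zero>\<^bsub>H\<^esub> \<oplus>\<^bsub>H\<^esub> \<zero>\<^bsub>H\<^esub>"
    by (rule vec_eqI) (simp_all add: cinner_simps)
qed (simp_all add: norm_zero hnorm_nonneg zero_carrier)

lemma contraction_ident: "contraction H (\<lambda>x. x)"
  by (simp add: contraction_def linear_operator_def)

lemma hardy_shift_affine:
  assumes "f \<in> carrier (hardy H)"
  shows "hardy_shift H f = mult_op (affine_symbol (\<lambda>_. \<zero>\<^bsub>H\<^esub>) (\<lambda>x. x)) f"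
  unfolding hardy_shift_def mult_op_def
proof (rule restrict_ext)
  fix z assume "z \<in> unit_disc"
  then have "f z \<in> carrier H" by (rule hardy_value[OF assms])
  then show "z \<odot>\<^bsub>H\<^esub> f z = affine_symbol (\<lambda>_. \<zero>\<^bsub>H\<^esub>) (\<lambda>x. x) z (f z)"
    by (intro vec_eqI) (simp_all add: affine_symbol_def cinner_simps)
qed

lemma hardy_shift_coeff:
  assumes "f \<in> carrier (hardy H)"
  shows "hardy_shift H f \<in> carrier (hardy H)"
    and "hardy_coeff H (hardy_shift H f) k = case_nat \<zero>\<^bsub>H\<^esub> (hardy_coeff H f) k"
proof -
  note * = mult_op_affine[OF contraction_zero contraction_ident assms]
  show "hardy_shift H f \<in> carrier (hardy H)"
    by (simp add: hardy_shift_affine[OF assms] *)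
  show "hardy_coeff H (hardy_shift H f) k = case_nat \<zero>\<^bsub>H\<^esub> (hardy_coeff H f) k"
    using hardy_coeff_carrier[OF assms] unfolding hardy_shift_affine[OF assms] *(2)
    by (intro vec_eqI) (auto simp: cinner_simps split: nat.split)
qed

lemma hardy_shift_isometry:
  assumes "f \<in> carrier (hardy H)"
  shows "hnorm (hardy H) (hardy_shift H f) = hnorm (hardy H) f"
proof -
  interpret HH: inner_product_space "hardy H" by (rule inner_product_space_hardy)
  have "(\<lambda>k. (hnorm H (hardy_coeff H (hardy_shift H f) k))\<^sup>2) sums (hnorm (hardy H) f)\<^sup>2"
    using sums_Suc[of "\<lambda>k. (hnorm H (hardy_coeff H (hardy_shift H f) k))\<^sup>2"]
      hnorm_hardy_sums[OF assms] hardy_shift_coeff(2)[OF assms] norm_zero by simp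
  then have "(hnorm (hardy H) (hardy_shift H f))\<^sup>2 = (hnorm (hardy H) f)\<^sup>2"
    using hnorm_hardy_sums[OF hardy_shift_coeff(1)[OF assms]] sums_unique2 by blast
  then show ?thesis
    by (simp add: HH.hnorm_nonneg assms hardy_shift_coeff(1))
qed

definition backward_shift :: "(complex \<Rightarrow> 'a) \<Rightarrow> complex \<Rightarrow> 'a" where
  "backward_shift f = hardy_of (\<lambda>k. hardy_coeff H f (Suc k))"

lemma backward_shift:
  assumes "f \<in> carrier (hardy H)"
  shows "backward_shift f \<in> carrier (hardy H)"
    and "hardy_coeff H (backward_shift f) = (\<lambda>k. hardy_coeff H f (Suc k))"
  using hardy_of[OF square_summable_shift_down[OF hardy_coeff_square_summable[OF assms]]]
  by (simp_all add: backward_shift_def)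

text \<open>Formulated for any \<open>S\<close> that agrees with the shift on the carrier, because
  this is all that is known of a product of multipliers.\<close>

lemma adj_hardy_shift:
  assumes S: "\<And>f. f \<in> carrier (hardy H) \<Longrightarrow> S f = hardy_shift H f"
    and g: "g \<in> carrier (hardy H)"
  shows "adj (hardy H) S g = backward_shift g"
proof -
  interpret HH: inner_product_space "hardy H" by (rule inner_product_space_hardy)
  show ?thesis
  proof (rule HH.adj_eqI)
    show "backward_shift g \<in> carrier (hardy H)" by (rule backward_shift[OF g])
    fix f assume f: "f \<in> carrier (hardy H)"
    have "(\<lambda>k. cinner H (hardy_coeff H (hardy_shift H f) k) (hardy_coeff H g k)) sums
        cinner (hardy H) f (backward_shift g)"
      using sums_Suc[of "\<lambda>k. cinner H (hardy_coeff H (hardy_shift H f) k) (hardy_coeff H g k)"]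
        cinner_hardy_sums[OF f backward_shift(1)[OF g]] hardy_shift_coeff(2)[OF f]
      by (simp add: backward_shift g cinner_zero_left hardy_coeff_carrier)
    then show "cinner (hardy H) (S f) g = cinner (hardy H) f (backward_shift g)"
      using cinner_hardy_sums[OF hardy_shift_coeff(1)[OF f] g] sums_unique2 S[OF f] by metis
  qed
qed

text \<open>The \<open>k\<close>-th power of the adjoint drops the first \<open>k\<close>
  coefficients, so the squared norm of its value is a tail of the convergent series for
  \<open>f\<close>.\<close>

lemma pure_contraction_hardy_shift:
  assumes S: "\<And>f. f \<in> carrier (hardy H) \<Longrightarrow> S f = hardy_shift H f"
  shows "pure_contraction (hardy H) S"
  unfolding pure_contraction_def
proof (intro conjI ballI)
  interpret HH: inner_product_space "hardy H" by (rule inner_product_space_hardy)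
  have "linear_operator (hardy H) (hardy H) S"
    using linear_mult_op_affine[OF contraction_zero contraction_ident]
    by (simp add: linear_operator_def hardy_shift_affine S HH.carrier_intros Pi_iff)
  then show "contraction (hardy H) S"
    by (simp add: contraction_def S hardy_shift_isometry)
  fix f assume f: "f \<in> carrier (hardy H)"
  have it: "(adj (hardy H) S ^^ k) f \<in> carrier (hardy H) \<and>
      (\<forall>j. hardy_coeff H ((adj (hardy H) S ^^ k) f) j = hardy_coeff H f (j + k))" for k
    by (induction k) (use f in \<open>simp_all add: adj_hardy_shift[OF S] backward_shift\<close>)
  have "(hnorm (hardy H) ((adj (hardy H) S ^^ k) f))\<^sup>2 =
      (hnorm (hardy H) f)\<^sup>2 - (\<Sum>j<k. (hnorm H (hardy_coeff H f j))\<^sup>2)" for k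
  proof (rule sums_unique2)
    show "(\<lambda>j. (hnorm H (hardy_coeff H f (j + k)))\<^sup>2) sums (hnorm (hardy H) ((adj (hardy H) S ^^ k) f))\<^sup>2"
      using hnorm_hardy_sums[of "(adj (hardy H) S ^^ k) f"] it by simp
    show "(\<lambda>j. (hnorm H (hardy_coeff H f (j + k)))\<^sup>2) sums
        ((hnorm (hardy H) f)\<^sup>2 - (\<Sum>j<k. (hnorm H (hardy_coeff H f j))\<^sup>2))"
      by (rule sums_split_initial_segment[OF hnorm_hardy_sums[OF f]])
  qed
  moreover have "(\<lambda>k. (hnorm (hardy H) f)\<^sup>2 - (\<Sum>j<k. (hnorm H (hardy_coeff H f j))\<^sup>2)) \<longlonglongrightarrow>
      (hnorm (hardy H) f)\<^sup>2 - (hnorm (hardy H) f)\<^sup>2"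
    by (intro tendsto_diff tendsto_const) (use hnorm_hardy_sums[OF f] in \<open>simp add: sums_def\<close>)
  ultimately have "(\<lambda>k. (hnorm (hardy H) ((adj (hardy H) S ^^ k) f))\<^sup>2) \<longlonglongrightarrow> 0" by simp
  from tendsto_real_sqrt[OF this]
  show "(\<lambda>k. hnorm (hardy H) ((adj (hardy H) S ^^ k) f)) \<longlonglongrightarrow> 0"
    using it by (simp add: HH.hnorm_nonneg)
qed

end

text \<open>The data of a pure tuple of commuting isometries as in the Berger--Coburn--Lebow theorem:
  unitaries \<open>V i\<close> with inverses \<open>U i\<close>, and projections \<open>P S\<close> onto sums of coordinate subspaces
  that reduce them. The \<open>i\<close>-th isometry is multiplication by \<open>V i (P (- {i}) + z P {i})\<close>.\<close>

locale bcl_model = hilbert_space H for H :: "'a cinner_space" +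
  fixes n :: nat and V U :: "nat \<Rightarrow> 'a \<Rightarrow> 'a" and P :: "nat set \<Rightarrow> 'a \<Rightarrow> 'a"
  assumes V_linear: "i \<in> {1..n} \<Longrightarrow> linear_operator H H (V i)"
    and U_linear: "i \<in> {1..n} \<Longrightarrow> linear_operator H H (U i)"
    and P_linear: "linear_operator H H (P S)"
    and V_adjoint: "\<lbrakk>i \<in> {1..n}; x \<in> carrier H; y \<in> carrier H\<rbrakk> \<Longrightarrow>
      cinner H (V i x) y = cinner H x (U i y)"
    and P_adjoint: "\<lbrakk>x \<in> carrier H; y \<in> carrier H\<rbrakk> \<Longrightarrow> cinner H (P S x) y = cinner H x (P S y)"
    and U_V: "\<lbrakk>i \<in> {1..n}; x \<in> carrier H\<rbrakk> \<Longrightarrow> U i (V i x) = x"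
    and V_U: "\<lbrakk>i \<in> {1..n}; x \<in> carrier H\<rbrakk> \<Longrightarrow> V i (U i x) = x"
    and V_commute: "\<lbrakk>i \<in> {1..n}; j \<in> {1..n}; x \<in> carrier H\<rbrakk> \<Longrightarrow> V i (V j x) = V j (V i x)"
    and V_P: "\<lbrakk>i \<in> {1..n}; x \<in> carrier H\<rbrakk> \<Longrightarrow> V i (P S x) = P S (V i x)"
    and P_P: "x \<in> carrier H \<Longrightarrow> P S (P R x) = P (S \<inter> R) x"
    and P_Un: "\<lbrakk>S \<inter> R = {}; x \<in> carrier H\<rbrakk> \<Longrightarrow> P (S \<union> R) x = P S x \<oplus>\<^bsub>H\<^esub> P R x"
    and P_full: "\<lbrakk>{1..n} \<subseteq> S; x \<in> carrier H\<rbrakk> \<Longrightarrow> P S x = x"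
    and V_prod: "x \<in> carrier H \<Longrightarrow> tuple_prod n V x = x"
begin

lemmas V_lin = linear_operatorD[OF V_linear]
lemmas U_lin = linear_operatorD[OF U_linear]
lemmas P_lin = linear_operatorD[OF P_linear]

lemma V_isometry:
  assumes "i \<in> {1..n}" "x \<in> carrier H"
  shows "hnorm H (V i x) = hnorm H x"
  unfolding hnorm_def using assms by (simp add: V_adjoint U_V V_lin)

lemma U_isometry:
  assumes "i \<in> {1..n}" "x \<in> carrier H"
  shows "hnorm H (U i x) = hnorm H x"
  using V_isometry[OF assms(1) U_lin(1)[OF assms]] assms by (simp add: V_U)

lemma V_zero: "i \<in> {1..n} \<Longrightarrow> V i \<zero>\<^bsub>H\<^esub> = \<zero>\<^bsub>H\<^esub>"
  using V_isometry[of i "\<zero>\<^bsub>H\<^esub>"] V_lin(1)[of i "\<zero>\<^bsub>H\<^esub>"] zero_carrier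
  by (simp add: norm_zero hnorm_eq_0)

lemma P_zero: "P S \<zero>\<^bsub>H\<^esub> = \<zero>\<^bsub>H\<^esub>"
  by (rule vec_eqI) (simp_all add: zero_carrier P_lin P_adjoint cinner_zero_left)

lemma U_P:
  assumes "i \<in> {1..n}" "x \<in> carrier H"
  shows "U i (P S x) = P S (U i x)"
proof -
  have "U i (P S x) = U i (P S (V i (U i x)))"
    using assms by (simp add: V_U)
  also have "\<dots> = U i (V i (P S (U i x)))"
    using assms by (simp add: V_P U_lin)
  also have "\<dots> = P S (U i x)"
    using assms by (simp add: U_V U_lin P_lin)
  finally show ?thesis .
qed

text \<open>The disjoint union of the empty set with itself gives
  \<open>P {} x = P {} x + P {} x\<close>.\<close>

lemma P_empty: "x \<in> carrier H \<Longrightarrow> P {} x = \<zero>\<^bsub>H\<^esub>"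
  using P_Un[of "{}" "{}" x] P_lin(1)[of x "{}"]
  by (intro vec_eqI) (simp_all add: cinner_simps, metis add_cancel_right_left cinner_add_left)

lemma P_split: "x \<in> carrier H \<Longrightarrow> P (- S) x \<oplus>\<^bsub>H\<^esub> P S x = x"
  using P_Un[of "- S" S x] P_full[of UNIV x] by simp

lemma P_split_norm:
  assumes "x \<in> carrier H"
  shows "(hnorm H x)\<^sup>2 = (hnorm H (P (- S) x))\<^sup>2 + (hnorm H (P S x))\<^sup>2"
proof -
  have "cinner H (P (- S) x) (P S x) = 0"
    using assms by (simp add: P_adjoint P_lin P_P P_empty cinner_zero_right)
  then show ?thesis
    using norm_add_sq[of "P (- S) x" "P S x"] assms by (simp add: P_split P_lin)
qed

lemma P_contraction: "contraction H (P S)"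
  unfolding contraction_def
proof (intro conjI ballI P_linear)
  fix x assume x: "x \<in> carrier H"
  show "hnorm H (P S x) \<le> hnorm H x"
    by (rule power2_le_imp_le) (use P_split_norm[OF x, of S] x in \<open>simp_all add: hnorm_nonneg\<close>)
qed

lemma V_contraction: "i \<in> {1..n} \<Longrightarrow> contraction H (V i)"
  by (simp add: contraction_def V_linear V_isometry)

lemma U_contraction: "i \<in> {1..n} \<Longrightarrow> contraction H (U i)"
  by (simp add: contraction_def U_linear U_isometry)

definition symbol :: "nat \<Rightarrow> complex \<Rightarrow> 'a \<Rightarrow> 'a" where
  "symbol i = affine_symbol (\<lambda>x. V i (P (- {i}) x)) (\<lambda>x. V i (P {i} x))"

text \<open>The expected adjoint: that of \<open>V i\<close> is \<open>U i\<close>, which is pulled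
  to the front because it commutes with the projections, and that of multiplication by
  \<open>z\<close> reads the next coefficient.\<close>

definition mult_adjoint :: "nat \<Rightarrow> (complex \<Rightarrow> 'a) \<Rightarrow> complex \<Rightarrow> 'a" where
  "mult_adjoint i f = hardy_of (\<lambda>k. U i (P (- {i}) (hardy_coeff H f k) \<oplus>\<^bsub>H\<^esub>
    P {i} (hardy_coeff H f (Suc k))))"

lemma VP_contraction: "i \<in> {1..n} \<Longrightarrow> contraction H (\<lambda>x. V i (P S x))"
  by (intro contraction_comp[OF V_contraction P_contraction])

lemma mult_symbol:
  assumes "i \<in> {1..n}" "f \<in> carrier (hardy H)"
  shows "mult_op (symbol i) f \<in> carrier (hardy H)"
    and "hardy_coeff H (mult_op (symbol i) f) k = V i (P (- {i}) (hardy_coeff H f k) \<oplus>\<^bsub>H\<^esub>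
      case_nat \<zero>\<^bsub>H\<^esub> (\<lambda>j. P {i} (hardy_coeff H f j)) k)"
proof -
  note * = mult_op_affine[OF VP_contraction VP_contraction assms(2), OF assms(1) assms(1),
      of "- {i}" "{i}", folded symbol_def]
  show "mult_op (symbol i) f \<in> carrier (hardy H)" by (rule *(1))
  show "hardy_coeff H (mult_op (symbol i) f) k = V i (P (- {i}) (hardy_coeff H f k) \<oplus>\<^bsub>H\<^esub>
      case_nat \<zero>\<^bsub>H\<^esub> (\<lambda>j. P {i} (hardy_coeff H f j)) k)"
    using assms by (cases k) (simp_all add: *(2) V_lin P_lin V_zero hardy_coeff_carrier zero_carrier)
qed

lemma mult_adjoint:
  assumes "i \<in> {1..n}" "f \<in> carrier (hardy H)"
  shows "mult_adjoint i f \<in> carrier (hardy H)"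
    and "hardy_coeff H (mult_adjoint i f) k = U i (P (- {i}) (hardy_coeff H f k) \<oplus>\<^bsub>H\<^esub>
      P {i} (hardy_coeff H f (Suc k)))"
proof -
  have "square_summable (\<lambda>k. U i (P (- {i}) (hardy_coeff H f k) \<oplus>\<^bsub>H\<^esub>
      P {i} (hardy_coeff H f (Suc k))))"
    using assms by (intro square_summable_contraction[OF U_contraction] square_summable_add
        square_summable_contraction[OF P_contraction] square_summable_shift_down
        hardy_coeff_square_summable)
  from hardy_of[OF this] show "mult_adjoint i f \<in> carrier (hardy H)"
    and "hardy_coeff H (mult_adjoint i f) k = U i (P (- {i}) (hardy_coeff H f k) \<oplus>\<^bsub>H\<^esub>
      P {i} (hardy_coeff H f (Suc k)))"
    by (simp_all add: mult_adjoint_def)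
qed

text \<open>In each coefficient the two summands lie in orthogonal ranges, and moving the
  \<open>P {i}\<close> parts up one place leaves the sum of their squared norms unchanged.
  Pythagoras splits the image and \<open>f\<close> itself into the same two sums.\<close>

lemma mult_isometry:
  assumes i: "i \<in> {1..n}" and f: "f \<in> carrier (hardy H)"
  shows "hnorm (hardy H) (mult_op (symbol i) f) = hnorm (hardy H) f"
proof -
  interpret HH: inner_product_space "hardy H" by (rule inner_product_space_hardy)
  note fc = hardy_coeff_carrier[OF f]
  define a where "a = hardy_coeff H f"
  define q where "q k = (hnorm H (case_nat \<zero>\<^bsub>H\<^esub> (\<lambda>j. P {i} (a j)) k))\<^sup>2" for k
  have ac: "a k \<in> carrier H" for k by (simp add: a_def fc)
  have orth: "cinner H (P (- {i}) (a k)) (case_nat \<zero>\<^bsub>H\<^esub> (\<lambda>j. P {i} (a j)) k) = 0" for k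
    by (cases k) (simp_all add: P_adjoint ac P_lin P_P P_empty cinner_zero_right)
  have "(hnorm H (hardy_coeff H (mult_op (symbol i) f) k))\<^sup>2 =
      (hnorm H (P (- {i}) (a k)))\<^sup>2 + q k" for k
  proof -
    have "case_nat \<zero>\<^bsub>H\<^esub> (\<lambda>j. P {i} (a j)) k \<in> carrier H"
      by (cases k) (simp_all add: zero_carrier P_lin ac)
    then show ?thesis
      using orth[of k] i ac[of k] unfolding mult_symbol(2)[OF i f, folded a_def]
      by (simp add: V_isometry carrier_intros P_lin norm_add_sq q_def)
  qed
  moreover have "(\<lambda>k. (hnorm H (P (- {i}) (a k)))\<^sup>2 + q k) sums (hnorm (hardy H) f)\<^sup>2"
  proof -
    have s: "square_summable (\<lambda>k. P S (a k))" for S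
      unfolding a_def by (intro square_summable_contraction[OF P_contraction] hardy_coeff_square_summable f)
    have s1: "(\<lambda>k. (hnorm H (P S (a k)))\<^sup>2) sums (\<Sum>k. (hnorm H (P S (a k)))\<^sup>2)" for S
      by (rule summable_sums[OF square_summableD(2)[OF s]])
    have "q sums (\<Sum>k. (hnorm H (P {i} (a k)))\<^sup>2)"
      using sums_Suc[of q] s1[of "{i}"] by (simp add: q_def norm_zero)
    from sums_add[OF s1[of "- {i}"] this]
    have *: "(\<lambda>k. (hnorm H (P (- {i}) (a k)))\<^sup>2 + q k) sums
       ((\<Sum>k. (hnorm H (P (- {i}) (a k)))\<^sup>2) + (\<Sum>k. (hnorm H (P {i} (a k)))\<^sup>2))" .
    have "(\<lambda>k. (hnorm H (a k))\<^sup>2) sums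
       ((\<Sum>k. (hnorm H (P (- {i}) (a k)))\<^sup>2) + (\<Sum>k. (hnorm H (P {i} (a k)))\<^sup>2))"
      using sums_add[OF s1[of "- {i}"] s1[of "{i}"]] P_split_norm[OF ac, of _ "{i}"] by simp
    then have "(hnorm (hardy H) f)\<^sup>2 =
       (\<Sum>k. (hnorm H (P (- {i}) (a k)))\<^sup>2) + (\<Sum>k. (hnorm H (P {i} (a k)))\<^sup>2)"
      by (rule sums_unique2[OF hnorm_hardy_sums[OF f, folded a_def]])
    with * show ?thesis by simp
  qed
  ultimately have "(hnorm (hardy H) (mult_op (symbol i) f))\<^sup>2 = (hnorm (hardy H) f)\<^sup>2"
    using sums_unique2[OF hnorm_hardy_sums[OF mult_symbol(1)[OF i f]]] by simp
  then show ?thesis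
    by (simp add: HH.hnorm_nonneg f mult_symbol(1)[OF i f])
qed

lemma linear_mult_symbol: "i \<in> {1..n} \<Longrightarrow> linear_operator (hardy H) (hardy H) (mult_op (symbol i))"
  unfolding symbol_def by (intro linear_mult_op_affine VP_contraction)

text \<open>Moving \<open>V i\<close> and the projections to the second argument leaves a series in
  which the \<open>P {i}\<close> part is shifted by one index. Its term at 0 vanishes, so reindexing
  gives the pairing with \<open>mult_adjoint i g\<close>.\<close>

lemma adj_mult_symbol:
  assumes i: "i \<in> {1..n}" and g: "g \<in> carrier (hardy H)"
  shows "adj (hardy H) (mult_op (symbol i)) g = mult_adjoint i g"
proof -
  interpret HH: inner_product_space "hardy H" by (rule inner_product_space_hardy)
  show ?thesis
  proof (rule HH.adj_eqI)
    show "mult_adjoint i g \<in> carrier (hardy H)" by (rule mult_adjoint[OF i g])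
    fix f assume f: "f \<in> carrier (hardy H)"
    define a where "a = hardy_coeff H f"
    define b where "b k = U i (hardy_coeff H g k)" for k
    have a: "square_summable a" by (simp add: a_def f hardy_coeff_square_summable)
    have b: "square_summable b"
      unfolding b_def by (intro square_summable_contraction[OF U_contraction] i hardy_coeff_square_summable g)
    have Pb: "square_summable (\<lambda>k. P S (b k))" for S
      by (rule square_summable_contraction[OF P_contraction b])
    note ac = square_summableD(1)[OF a] and bc = square_summableD(1)[OF b]
    define c where "c k = cinner H (case_nat \<zero>\<^bsub>H\<^esub> (\<lambda>j. P {i} (a j)) k) (b k)" for k
    have s1: "(\<lambda>k. cinner H (a k) (P (- {i}) (b k))) sums (\<Sum>k. cinner H (a k) (P (- {i}) (b k)))"
      by (rule summable_sums[OF summable_cinner[OF a Pb]])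
    have s2: "(\<lambda>k. cinner H (a k) (P {i} (b (Suc k)))) sums (\<Sum>k. cinner H (a k) (P {i} (b (Suc k))))"
      by (rule summable_sums[OF summable_cinner[OF a square_summable_shift_down[OF Pb]]])
    have "c sums (\<Sum>k. cinner H (a k) (P {i} (b (Suc k))))"
      using sums_Suc[of c] s2 by (simp add: c_def cinner_zero_left bc P_adjoint ac)
    from sums_add[OF s1 this] have "(\<lambda>k. cinner H (a k) (P (- {i}) (b k)) + c k) sums
      ((\<Sum>k. cinner H (a k) (P (- {i}) (b k))) + (\<Sum>k. cinner H (a k) (P {i} (b (Suc k)))))" .
    moreover have "cinner H (hardy_coeff H (mult_op (symbol i) f) k) (hardy_coeff H g k) =
        cinner H (a k) (P (- {i}) (b k)) + c k" for k
    proof -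
      have "case_nat \<zero>\<^bsub>H\<^esub> (\<lambda>j. P {i} (a j)) k \<in> carrier H"
        by (cases k) (simp_all add: zero_carrier P_lin ac)
      then show ?thesis
        using i ac bc hardy_coeff_carrier[OF g] unfolding mult_symbol(2)[OF i f, folded a_def]
        by (simp add: V_adjoint carrier_intros P_lin b_def[symmetric] cinner_add_left c_def P_adjoint)
    qed
    moreover have "cinner H (hardy_coeff H f k) (hardy_coeff H (mult_adjoint i g) k) =
        cinner H (a k) (P (- {i}) (b k)) + cinner H (a k) (P {i} (b (Suc k)))" for k
      using i ac bc hardy_coeff_carrier[OF g]
      by (simp add: mult_adjoint[OF i g] a_def[symmetric] U_lin P_lin U_P b_def cinner_add_right)
    ultimately show "cinner (hardy H) (mult_op (symbol i) f) g = cinner (hardy H) f (mult_adjoint i g)"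
      using cinner_hardy_sums[OF mult_symbol(1)[OF i f] g]
        cinner_hardy_sums[OF f mult_adjoint(1)[OF i g]] sums_add[OF s1 s2] sums_unique2
      by (metis (no_types, lifting) sums_cong)
  qed
qed

text \<open>The backward shift discards the \<open>P {i}\<close> part of the constant coefficient
  and the forward shift cannot restore it; every other part returns to its place.\<close>

lemma mult_symbol_adjoint_coeff:
  assumes i: "i \<in> {1..n}" and f: "f \<in> carrier (hardy H)"
  shows "hardy_coeff H (mult_op (symbol i) (mult_adjoint i f)) k =
    (if k = 0 then P (- {i}) (hardy_coeff H f 0) else hardy_coeff H f k)"
proof (cases k)
  case 0
  then show ?thesis
    using i hardy_coeff_carrier[OF f]
    by (simp add: mult_symbol[OF i mult_adjoint(1)[OF i f]] mult_adjoint[OF i f] P_lin U_lin U_P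
        V_lin carrier_intros V_P V_U V_zero P_P P_empty)
      (auto intro!: vec_eqI simp: cinner_simps P_lin)
next
  case (Suc j)
  \<comment> \<open>In the application \<open>x\<close>, \<open>y\<close>, \<open>w\<close> are the
    coefficients of \<open>f\<close> at \<open>k\<close>, \<open>k + 1\<close> and
    \<open>k - 1\<close>. The outer projections select the two parts of \<open>x\<close> and kill
    those of \<open>y\<close> and \<open>w\<close>.\<close>
  have "P (- {i}) x \<oplus>\<^bsub>H\<^esub> P {i} y \<in> carrier H" "P (- {i}) (P (- {i}) x \<oplus>\<^bsub>H\<^esub> P {i} y) \<oplus>\<^bsub>H\<^esub> P {i} (P (- {i}) w \<oplus>\<^bsub>H\<^esub> P {i} x) = x"
    if "x \<in> carrier H" "y \<in> carrier H" "w \<in> carrier H" for x y w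
  proof -
    show "P (- {i}) x \<oplus>\<^bsub>H\<^esub> P {i} y \<in> carrier H" using that by (simp add: P_lin carrier_intros)
    have "P (- {i}) (P (- {i}) x \<oplus>\<^bsub>H\<^esub> P {i} y) \<oplus>\<^bsub>H\<^esub> P {i} (P (- {i}) w \<oplus>\<^bsub>H\<^esub> P {i} x) =
        P (- {i}) x \<oplus>\<^bsub>H\<^esub> P {i} x"
      using that by (intro vec_eqI) (simp_all add: P_lin P_P P_empty cinner_simps)
    then show "P (- {i}) (P (- {i}) x \<oplus>\<^bsub>H\<^esub> P {i} y) \<oplus>\<^bsub>H\<^esub> P {i} (P (- {i}) w \<oplus>\<^bsub>H\<^esub> P {i} x) = x"
      using that by (simp add: P_split)
  qed
  note * = this[OF hardy_coeff_carrier[OF f] hardy_coeff_carrier[OF f] hardy_coeff_carrier[OF f]]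
  have "V i (P (- {i}) (U i x) \<oplus>\<^bsub>H\<^esub> P {i} (U i y)) = P (- {i}) x \<oplus>\<^bsub>H\<^esub> P {i} y"
    if "x \<in> carrier H" "y \<in> carrier H" for x y
    using that i by (simp add: U_P[symmetric] V_lin U_lin P_lin V_U)
  from this[OF *(1) *(1)] show ?thesis
    using Suc i hardy_coeff_carrier[OF f] *(2)
    by (simp add: mult_symbol[OF i mult_adjoint(1)[OF i f]] mult_adjoint[OF i f])
qed

lemma symbol_value:
  assumes "i \<in> {1..n}" "x \<in> carrier H"
  shows "symbol i z x = V i (P (- {i}) x \<oplus>\<^bsub>H\<^esub> z \<odot>\<^bsub>H\<^esub> P {i} x)" "symbol i z x \<in> carrier H"
  using assms by (simp_all add: symbol_def affine_symbol_def V_lin P_lin carrier_intros)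

lemma P_symbol:
  assumes "i \<in> {1..n}" "x \<in> carrier H"
  shows "P S (symbol i z x) = V i (P (S - {i}) x \<oplus>\<^bsub>H\<^esub> z \<odot>\<^bsub>H\<^esub> P (S \<inter> {i}) x)"
  using assms by (simp add: symbol_value V_P[symmetric] P_lin carrier_intros P_P Diff_eq)

lemma symbol_commute:
  assumes ij: "i \<in> {1..n}" "j \<in> {1..n}" and x: "x \<in> carrier H"
  shows "symbol i z (symbol j z x) = symbol j z (symbol i z x)"
proof (cases "i = j")
  case False
  \<comment> \<open>The term in \<open>z^2\<close> disappears because \<open>P {i}\<close> and
    \<open>P {j}\<close> are orthogonal; what is left is symmetric in \<open>i\<close> and
    \<open>j\<close> up to the order of the summands.\<close>
  have *: "symbol i z (symbol j z x) =
      V i (V j (P (- {i,j}) x \<oplus>\<^bsub>H\<^esub> z \<odot>\<^bsub>H\<^esub> P {j} x \<oplus>\<^bsub>H\<^esub> z \<odot>\<^bsub>H\<^esub> P {i} x))"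
    if "i \<in> {1..n}" "j \<in> {1..n}" "i \<noteq> j" for i j
  proof -
    have e: "- {i} - {j} = - {i, j}" "- {i} \<inter> {j} = {j}" "{i} - {j} = {i}" "{i} \<inter> {j} = {}"
      using that by auto
    have "symbol i z (symbol j z x) = V i (V j (P (- {i,j}) x \<oplus>\<^bsub>H\<^esub> z \<odot>\<^bsub>H\<^esub> P {j} x) \<oplus>\<^bsub>H\<^esub>
        z \<odot>\<^bsub>H\<^esub> V j (P {i} x \<oplus>\<^bsub>H\<^esub> z \<odot>\<^bsub>H\<^esub> \<zero>\<^bsub>H\<^esub>))"
      using that x P_symbol[of j x "- {i}" z] P_symbol[of j x "{i}" z] e
      by (simp add: symbol_value(1)[OF that(1) symbol_value(2)] P_empty)
    also have "\<dots> = V i (V j ((P (- {i,j}) x \<oplus>\<^bsub>H\<^esub> z \<odot>\<^bsub>H\<^esub> P {j} x) \<oplus>\<^bsub>H\<^esub> z \<odot>\<^bsub>H\<^esub> (P {i} x \<oplus>\<^bsub>H\<^esub> z \<odot>\<^bsub>H\<^esub> \<zero>\<^bsub>H\<^esub>)))"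
      using that x by (simp add: V_lin carrier_intros P_lin)
    also have "(P (- {i,j}) x \<oplus>\<^bsub>H\<^esub> z \<odot>\<^bsub>H\<^esub> P {j} x) \<oplus>\<^bsub>H\<^esub> z \<odot>\<^bsub>H\<^esub> (P {i} x \<oplus>\<^bsub>H\<^esub> z \<odot>\<^bsub>H\<^esub> \<zero>\<^bsub>H\<^esub>) =
        P (- {i,j}) x \<oplus>\<^bsub>H\<^esub> z \<odot>\<^bsub>H\<^esub> P {j} x \<oplus>\<^bsub>H\<^esub> z \<odot>\<^bsub>H\<^esub> P {i} x"
      by (rule vec_eqI) (simp_all add: x P_lin cinner_simps)
    finally show ?thesis .
  qed
  have "P (- {i,j}) x \<oplus>\<^bsub>H\<^esub> z \<odot>\<^bsub>H\<^esub> P {j} x \<oplus>\<^bsub>H\<^esub> z \<odot>\<^bsub>H\<^esub> P {i} x =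
      P (- {j,i}) x \<oplus>\<^bsub>H\<^esub> z \<odot>\<^bsub>H\<^esub> P {i} x \<oplus>\<^bsub>H\<^esub> z \<odot>\<^bsub>H\<^esub> P {j} x"
    by (rule vec_eqI) (simp_all add: x P_lin cinner_simps insert_commute)
  then show ?thesis
    using *[OF ij False] *[OF ij(2,1)] False ij x
    by (simp add: V_commute[of i j] carrier_intros P_lin)
qed simp

text \<open>For a further index, multiplying by \<open>P (- {i}) + z P {i}\<close> merely transfers
  the \<open>i\<close>-th coordinate to the part that carries \<open>z\<close>; no higher power of
  \<open>z\<close> arises, since each coordinate is transferred once.\<close>

lemma symbol_prod:
  assumes "m \<le> n" "x \<in> carrier H"
  shows "tuple_prod m (\<lambda>i. symbol i z) x = tuple_prod m V (P (- {1..m}) x \<oplus>\<^bsub>H\<^esub> z \<odot>\<^bsub>H\<^esub> P {1..m} x)"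
  using assms
proof (induction m arbitrary: x)
  case 0
  then show ?case
    by (simp add: P_full P_empty) (auto intro!: vec_eqI simp: cinner_simps)
next
  case (Suc m)
  then have i: "Suc m \<in> {1..n}" and x: "x \<in> carrier H" by auto
  have e: "- {1..m} - {Suc m} = - {1..Suc m}" "- {1..m} \<inter> {Suc m} = {Suc m}"
    "{1..m} - {Suc m} = {1..m}" "{1..m} \<inter> {Suc m} = {}" "{1..Suc m} = {1..m} \<union> {Suc m}"
    by auto
  have "tuple_prod (Suc m) (\<lambda>i. symbol i z) x = tuple_prod m V
      (V (Suc m) (P (- {1..Suc m}) x \<oplus>\<^bsub>H\<^esub> z \<odot>\<^bsub>H\<^esub> P {Suc m} x) \<oplus>\<^bsub>H\<^esub>
       z \<odot>\<^bsub>H\<^esub> V (Suc m) (P {1..m} x \<oplus>\<^bsub>H\<^esub> z \<odot>\<^bsub>H\<^esub> \<zero>\<^bsub>H\<^esub>))"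
    using Suc.IH[OF _ symbol_value(2)[OF i x, of z]] Suc.prems P_symbol[OF i x, of _ z] e(1-4)
    by (simp add: P_empty)
  also have "V (Suc m) (P (- {1..Suc m}) x \<oplus>\<^bsub>H\<^esub> z \<odot>\<^bsub>H\<^esub> P {Suc m} x) \<oplus>\<^bsub>H\<^esub>
       z \<odot>\<^bsub>H\<^esub> V (Suc m) (P {1..m} x \<oplus>\<^bsub>H\<^esub> z \<odot>\<^bsub>H\<^esub> \<zero>\<^bsub>H\<^esub>) =
     V (Suc m) ((P (- {1..Suc m}) x \<oplus>\<^bsub>H\<^esub> z \<odot>\<^bsub>H\<^esub> P {Suc m} x) \<oplus>\<^bsub>H\<^esub> z \<odot>\<^bsub>H\<^esub> (P {1..m} x \<oplus>\<^bsub>H\<^esub> z \<odot>\<^bsub>H\<^esub> \<zero>\<^bsub>H\<^esub>))"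
    using i x by (simp add: V_lin carrier_intros P_lin)
  also have "(P (- {1..Suc m}) x \<oplus>\<^bsub>H\<^esub> z \<odot>\<^bsub>H\<^esub> P {Suc m} x) \<oplus>\<^bsub>H\<^esub> z \<odot>\<^bsub>H\<^esub> (P {1..m} x \<oplus>\<^bsub>H\<^esub> z \<odot>\<^bsub>H\<^esub> \<zero>\<^bsub>H\<^esub>) =
      P (- {1..Suc m}) x \<oplus>\<^bsub>H\<^esub> z \<odot>\<^bsub>H\<^esub> (P {1..m} x \<oplus>\<^bsub>H\<^esub> P {Suc m} x)"
    by (rule vec_eqI) (simp_all add: x P_lin cinner_simps algebra_simps)
  also have "P {1..m} x \<oplus>\<^bsub>H\<^esub> P {Suc m} x = P {1..Suc m} x"
    unfolding e(5) by (rule P_Un[symmetric]) (use x in auto)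
  finally show ?case by simp
qed

lemma mult_symbol_prod:
  assumes f: "f \<in> carrier (hardy H)"
  shows "tuple_prod n (\<lambda>i. mult_op (symbol i)) f = hardy_shift H f"
proof (rule PiE_ext)
  have "tuple_prod n (\<lambda>i. mult_op (symbol i)) f \<in> carrier (hardy H)"
    by (rule tuple_prod_carrier) (use mult_symbol(1) f in auto)
  then show "tuple_prod n (\<lambda>i. mult_op (symbol i)) f \<in> unit_disc \<rightarrow>\<^sub>E carrier H"
    "hardy_shift H f \<in> unit_disc \<rightarrow>\<^sub>E carrier H"
    using hardy_shift_coeff(1)[OF f] by (simp_all add: hardy_sel)
  fix z :: complex assume z: "z \<in> unit_disc"
  have "tuple_prod m (\<lambda>i. mult_op (symbol i)) g z = tuple_prod m (\<lambda>i. symbol i z) (g z)" for m g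
    using z by (induction m arbitrary: g) (simp_all add: mult_op_def)
  also have "tuple_prod n (\<lambda>i. symbol i z) (f z) = z \<odot>\<^bsub>H\<^esub> f z"
  proof -
    have fz: "f z \<in> carrier H" by (rule hardy_value[OF f z])
    \<comment> \<open>As \<open>P {1..n}\<close> is the identity, the splitting forces the
      complementary projection to vanish, and with it the constant term of the product
      symbol.\<close>
    have "P (- {1..n}) (f z) \<oplus>\<^bsub>H\<^esub> f z = f z"
      using P_split[OF fz, of "{1..n}"] P_full[OF order_refl fz] by simp
    then have "cinner H (P (- {1..n}) (f z)) u = 0" if "u \<in> carrier H" for u
      using cinner_add_left[OF P_lin(1)[OF fz] fz that, of "- {1..n}"] by simp
    then have "P (- {1..n}) (f z) \<oplus>\<^bsub>H\<^esub> z \<odot>\<^bsub>H\<^esub> P {1..n} (f z) = z \<odot>\<^bsub>H\<^esub> f z"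
      by (intro vec_eqI) (simp_all add: fz P_lin cinner_simps P_full)
    then show ?thesis
      by (simp add: symbol_prod fz V_prod scale_closed)
  qed
  finally show "tuple_prod n (\<lambda>i. mult_op (symbol i)) f z = hardy_shift H f z"
    using z by (simp add: hardy_shift_def mult_op_def)
qed

lemma mult_symbol_commute:
  assumes "i \<in> {1..n}" "j \<in> {1..n}" "f \<in> carrier (hardy H)"
  shows "mult_op (symbol i) (mult_op (symbol j) f) = mult_op (symbol j) (mult_op (symbol i) f)"
  using assms by (auto simp: mult_op_def symbol_commute hardy_value)

lemma BCL_tuple_symbol: "BCL_tuple n H symbol"
  unfolding BCL_tuple_def commuting_tuple_def hilbert_isometry_def
  using mult_symbol_commute mult_symbol_prod linear_mult_symbol mult_isometry
  by (auto simp: symbol_def intro!: bounded_analytic_affine VP_contraction)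

text \<open>By commutativity the mixed term is the \<open>j\<close>-th multiplier applied to
  \<open>h\<close>, and \<open>h\<close> differs from \<open>g\<close> at most in the constant
  coefficient. The mixed term then differs from \<open>f\<close> only at index 0, where the claim
  becomes \<open>I - P (- {i}) - P (- {j}) + P (- {i, j}) = 0\<close>.\<close>

lemma defect_identity:
  assumes ij: "i \<in> {1..n}" "j \<in> {1..n}" "i \<noteq> j" and f: "f \<in> carrier (hardy H)"
  shows "f \<ominus>\<^bsub>hardy H\<^esub> mult_op (symbol i) (mult_adjoint i f) \<ominus>\<^bsub>hardy H\<^esub>
      mult_op (symbol j) (mult_adjoint j f) \<oplus>\<^bsub>hardy H\<^esub>
      mult_op (symbol i) (mult_op (symbol j) (mult_adjoint i (mult_adjoint j f))) = \<zero>\<^bsub>hardy H\<^esub>"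
    (is "?D = _")
proof (rule hardy_eqI)
  note c = hardy_coeff_carrier[OF f]
  define g where "g = mult_adjoint j f"
  have g: "g \<in> carrier (hardy H)" using mult_adjoint ij f by (simp add: g_def)
  define h where "h = mult_op (symbol i) (mult_adjoint i g)"
  have h: "h \<in> carrier (hardy H)"
    using mult_symbol mult_adjoint ij g by (simp add: h_def)
  have swap: "mult_op (symbol i) (mult_op (symbol j) (mult_adjoint i (mult_adjoint j f))) =
      mult_op (symbol j) h"
    using mult_symbol_commute[OF ij(1,2) mult_adjoint(1)[OF ij(1) g]] by (simp add: h_def g_def)
  have m: "mult_op (symbol i) (mult_adjoint i f) \<in> carrier (hardy H)"
    "mult_op (symbol j) (mult_adjoint j f) \<in> carrier (hardy H)"
    "mult_op (symbol j) h \<in> carrier (hardy H)"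
    using mult_symbol mult_adjoint ij f h by simp_all
  show "?D \<in> carrier (hardy H)"
    unfolding swap using m f by (simp add: hardy_add hardy_minus)
  fix k
  show "hardy_coeff H ?D k = hardy_coeff H \<zero>\<^bsub>hardy H\<^esub> k"
  proof -
    let ?a = "hardy_coeff H f" and ?b = "hardy_coeff H g"
    note bc = hardy_coeff_carrier[OF g]
    have hc: "hardy_coeff H h l = (if l = 0 then P (- {i}) (?b 0) else ?b l)" for l
      unfolding h_def by (rule mult_symbol_adjoint_coeff[OF ij(1) g])
    have b: "hardy_coeff H (mult_op (symbol j) g) l = (if l = 0 then P (- {j}) (?a 0) else ?a l)" for l
      unfolding g_def by (rule mult_symbol_adjoint_coeff[OF ij(2) f])
    have e: "- {j} \<inter> - {i} = - {i, j}" "{j} \<inter> - {i} = {j}" "- {j} \<inter> {i} = {i}" "- {i} \<inter> - {j} = - {i, j}" "- {i} \<inter> {j} = {j}"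
      using ij by auto
    have "hardy_coeff H (mult_op (symbol j) h) k =
        (if k = 0 then P (- {i, j}) (?a 0) else ?a k)"
    proof -
      \<comment> \<open>Index 1 is special: the altered constant coefficient of \<open>h\<close>
        enters there through \<open>P {j}\<close>, which absorbs \<open>P (- {i})\<close> because
        \<open>i\<close> and \<open>j\<close> are distinct.\<close>
      consider "k = 0" | "k = 1" | l where "k = Suc (Suc l)"
        by (metis One_nat_def nat.exhaust)
      then show ?thesis
      proof cases
        case 1
        have "hardy_coeff H (mult_op (symbol j) h) 0 = V j (P (- {j}) (P (- {i}) (?b 0)) \<oplus>\<^bsub>H\<^esub> \<zero>\<^bsub>H\<^esub>)"
          using mult_symbol(2)[OF ij(2) h, of 0] by (simp add: hc)
        also have "\<dots> = V j (P (- {i}) (P (- {j}) (?b 0) \<oplus>\<^bsub>H\<^esub> \<zero>\<^bsub>H\<^esub>))"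
        proof -
          have "P (- {j}) (P (- {i}) (?b 0)) \<oplus>\<^bsub>H\<^esub> \<zero>\<^bsub>H\<^esub> = P (- {i}) (P (- {j}) (?b 0))"
            "P (- {j}) (?b 0) \<oplus>\<^bsub>H\<^esub> \<zero>\<^bsub>H\<^esub> = P (- {j}) (?b 0)"
            using bc by (auto intro!: vec_eqI simp: P_lin cinner_simps P_P e)
          then show ?thesis by simp
        qed
        also have "\<dots> = P (- {i}) (hardy_coeff H (mult_op (symbol j) g) 0)"
          using mult_symbol(2)[OF ij(2) g, of 0] bc ij by (simp add: V_P[symmetric] P_zero V_zero V_lin P_lin carrier_intros)
        finally show ?thesis using 1 c by (simp add: b P_P e)
      next
        case 2
        have "hardy_coeff H (mult_op (symbol j) h) k = V j (P (- {j}) (?b k) \<oplus>\<^bsub>H\<^esub> P {j} (P (- {i}) (?b 0)))"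
          using mult_symbol(2)[OF ij(2) h, of k] 2 by (simp add: hc)
        also have "\<dots> = hardy_coeff H (mult_op (symbol j) g) k"
          using mult_symbol(2)[OF ij(2) g, of k] 2 bc by (simp add: P_P e)
        finally show ?thesis using 2 by (simp add: b)
      next
        case (3 l)
        have "hardy_coeff H (mult_op (symbol j) h) k = hardy_coeff H (mult_op (symbol j) g) k"
          using mult_symbol(2)[OF ij(2) h, of k] mult_symbol(2)[OF ij(2) g, of k] 3 by (simp add: hc)
        then show ?thesis using 3 by (simp add: b)
      qed
    qed
    moreover have "?a 0 \<ominus>\<^bsub>H\<^esub> P (- {i}) (?a 0) \<ominus>\<^bsub>H\<^esub> P (- {j}) (?a 0) \<oplus>\<^bsub>H\<^esub> P (- {i, j}) (?a 0) = \<zero>\<^bsub>H\<^esub>"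
    proof (rule vec_eqI)
      fix u assume u: "u \<in> carrier H"
      have "P (- {i}) (?a 0) = P (- {i, j}) (?a 0) \<oplus>\<^bsub>H\<^esub> P {j} (?a 0)"
      proof -
        have "- {i} = - {i, j} \<union> {j}" using ij by auto
        then show ?thesis using P_Un[of "- {i, j}" "{j}" "?a 0"] c by simp
      qed
      moreover have "?a 0 = P (- {j}) (?a 0) \<oplus>\<^bsub>H\<^esub> P {j} (?a 0)"
        using P_split[OF c, of "{j}"] by simp
      ultimately have "cinner H (P (- {i}) (?a 0)) u = cinner H (P (- {i, j}) (?a 0)) u + cinner H (P {j} (?a 0)) u"
        "cinner H (?a 0) u = cinner H (P (- {j}) (?a 0)) u + cinner H (P {j} (?a 0)) u"
        using u c by (metis P_lin(1) cinner_add_left)+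
      then show "cinner H (?a 0 \<ominus>\<^bsub>H\<^esub> P (- {i}) (?a 0) \<ominus>\<^bsub>H\<^esub> P (- {j}) (?a 0) \<oplus>\<^bsub>H\<^esub> P (- {i, j}) (?a 0)) u =
          cinner H \<zero>\<^bsub>H\<^esub> u"
        using u c by (simp add: P_lin cinner_simps)
    qed (use c in \<open>simp_all add: P_lin carrier_intros\<close>)
    moreover have "?a k \<ominus>\<^bsub>H\<^esub> ?a k \<ominus>\<^bsub>H\<^esub> ?a k \<oplus>\<^bsub>H\<^esub> ?a k = \<zero>\<^bsub>H\<^esub>"
      by (rule vec_eqI) (simp_all add: c cinner_simps)
    ultimately show ?thesis
      unfolding swap using m f mult_symbol_adjoint_coeff[OF ij(1) f, of k] mult_symbol_adjoint_coeff[OF ij(2) f, of k]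
      by (cases "k = 0") (simp_all add: hardy_add hardy_minus hardy_zero)
  qed
qed (rule hardy_zero)

theorem class_B0_symbol: "(\<lambda>i. mult_op (symbol i)) \<in> class_B0 n (hardy H)"
proof -
  have "contraction (hardy H) (mult_op (symbol i))" if "i \<in> {1..n}" for i
    using that by (simp add: contraction_def linear_mult_symbol mult_isometry)
  moreover have "commuting_tuple n (hardy H) (\<lambda>i. mult_op (symbol i))"
    using mult_symbol_commute by (simp add: commuting_tuple_def)
  moreover have "pure_contraction (hardy H) (tuple_prod n (\<lambda>i. mult_op (symbol i)))"
    by (rule pure_contraction_hardy_shift) (rule mult_symbol_prod)
  moreover have "f \<ominus>\<^bsub>hardy H\<^esub> mult_op (symbol i) (adj (hardy H) (mult_op (symbol i)) f) \<ominus>\<^bsub>hardy H\<^esub>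
      mult_op (symbol j) (adj (hardy H) (mult_op (symbol j)) f) \<oplus>\<^bsub>hardy H\<^esub>
      mult_op (symbol i) (mult_op (symbol j)
        (adj (hardy H) (mult_op (symbol i)) (adj (hardy H) (mult_op (symbol j)) f))) = \<zero>\<^bsub>hardy H\<^esub>"
    if "i \<in> {1..n}" "j \<in> {1..n}" "i \<noteq> j" "f \<in> carrier (hardy H)" for i j f
    using defect_identity[OF that] that mult_adjoint(1) by (simp add: adj_mult_symbol)
  ultimately show ?thesis
    unfolding class_B0_def by blast
qed

text \<open>Along the orbit of \<open>R\<close> the identity \<open>Q_norm\<close> telescopes, and
  purity lets the squared norms of \<open>Q (R^k h)\<close> add up to that of \<open>h\<close>. As
  \<open>A i\<close> commutes with \<open>R\<close>, the relation \<open>Q_A\<close> at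
  \<open>R^k h\<close> is the adjoint equation in the \<open>k\<close>-th coefficient.\<close>

theorem isometric_embedding:
  fixes K :: "'b cinner_space" and A :: "nat \<Rightarrow> 'b \<Rightarrow> 'b" and R :: "'b \<Rightarrow> 'b" and Q :: "'b \<Rightarrow> 'a"
  assumes K: "inner_product_space K"
    and A: "\<And>i h. \<lbrakk>i \<in> {1..n}; h \<in> carrier K\<rbrakk> \<Longrightarrow> A i h \<in> carrier K"
    and R: "linear_operator K K R"
    and A_R: "\<And>i h. \<lbrakk>i \<in> {1..n}; h \<in> carrier K\<rbrakk> \<Longrightarrow> R (A i h) = A i (R h)"
    and pure: "\<And>h. h \<in> carrier K \<Longrightarrow> (\<lambda>k. hnorm K ((R ^^ k) h)) \<longlonglongrightarrow> 0"
    and Q: "linear_operator K H Q"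
    and Q_norm: "\<And>h. h \<in> carrier K \<Longrightarrow> (hnorm H (Q h))\<^sup>2 = (hnorm K h)\<^sup>2 - (hnorm K (R h))\<^sup>2"
    and Q_A: "\<And>i h. \<lbrakk>i \<in> {1..n}; h \<in> carrier K\<rbrakk> \<Longrightarrow>
      Q (A i h) = U i (P (- {i}) (Q h) \<oplus>\<^bsub>H\<^esub> P {i} (Q (R h)))"
  obtains W where "hilbert_isometry K (hardy H) W"
    "\<And>i h. \<lbrakk>i \<in> {1..n}; h \<in> carrier K\<rbrakk> \<Longrightarrow> W (A i h) = adj (hardy H) (mult_op (symbol i)) (W h)"
proof -
  interpret K: inner_product_space K by (rule K)
  interpret HH: inner_product_space "hardy H" by (rule inner_product_space_hardy)
  note R_lin = linear_operatorD[OF R] and Q_lin = linear_operatorD[OF Q]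
  have Rk: "(R ^^ k) h \<in> carrier K" if "h \<in> carrier K" for k h
    using that by (induction k) (auto simp: R_lin)
  have sums: "(\<lambda>k. (hnorm H (Q ((R ^^ k) h)))\<^sup>2) sums (hnorm K h)\<^sup>2" if h: "h \<in> carrier K" for h
  proof -
    have "(\<Sum>k<m. (hnorm H (Q ((R ^^ k) h)))\<^sup>2) = (hnorm K h)\<^sup>2 - (hnorm K ((R ^^ m) h))\<^sup>2" for m
      by (induction m) (simp_all add: Q_norm Rk h)
    moreover have "(\<lambda>m. (hnorm K h)\<^sup>2 - (hnorm K ((R ^^ m) h))\<^sup>2) \<longlonglongrightarrow> (hnorm K h)\<^sup>2 - 0\<^sup>2"
      by (intro tendsto_intros pure h)
    ultimately show ?thesis by (simp add: sums_def)
  qed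
  define W where "W h = hardy_of (\<lambda>k. Q ((R ^^ k) h))" for h
  have W: "W h \<in> carrier (hardy H)" "hardy_coeff H (W h) = (\<lambda>k. Q ((R ^^ k) h))"
    if "h \<in> carrier K" for h
  proof -
    have "square_summable (\<lambda>k. Q ((R ^^ k) h))"
      using sums[OF that] Rk[OF that] by (simp add: square_summable_def Q_lin sums_iff)
    from hardy_of[OF this] show "W h \<in> carrier (hardy H)" "hardy_coeff H (W h) = (\<lambda>k. Q ((R ^^ k) h))"
      by (simp_all add: W_def)
  qed
  have Rk_add: "(R ^^ k) (h \<oplus>\<^bsub>K\<^esub> g) = (R ^^ k) h \<oplus>\<^bsub>K\<^esub> (R ^^ k) g"
    if "h \<in> carrier K" "g \<in> carrier K" for k h g
    by (induction k) (simp_all add: R_lin Rk that)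
  have Rk_scale: "(R ^^ k) (c \<odot>\<^bsub>K\<^esub> h) = c \<odot>\<^bsub>K\<^esub> (R ^^ k) h" if "h \<in> carrier K" for k h c
    by (induction k) (simp_all add: R_lin Rk that)
  have "hilbert_isometry K (hardy H) W"
    unfolding hilbert_isometry_def
  proof (intro conjI ballI)
    show "linear_operator K (hardy H) W"
    proof (rule linear_operatorI)
      fix h g assume "h \<in> carrier K" "g \<in> carrier K"
      then show "W (h \<oplus>\<^bsub>K\<^esub> g) = W h \<oplus>\<^bsub>hardy H\<^esub> W g"
        by (intro hardy_eqI) (simp_all add: W hardy_add K.carrier_intros Rk_add Q_lin Rk)
    next
      fix c h assume "h \<in> carrier K"
      then show "W (c \<odot>\<^bsub>K\<^esub> h) = c \<odot>\<^bsub>hardy H\<^esub> W h"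
        by (intro hardy_eqI) (simp_all add: W hardy_scale K.carrier_intros Rk_scale Q_lin Rk)
    qed (rule W)
    fix h assume h: "h \<in> carrier K"
    have "(hnorm (hardy H) (W h))\<^sup>2 = (hnorm K h)\<^sup>2"
      using hnorm_hardy_sums[OF W(1)[OF h]] sums[OF h] W(2)[OF h] sums_unique2 by auto
    then show "hnorm (hardy H) (W h) = hnorm K h"
      by (simp add: HH.hnorm_nonneg K.hnorm_nonneg W h)
  qed
  moreover have "W (A i h) = adj (hardy H) (mult_op (symbol i)) (W h)"
    if i: "i \<in> {1..n}" and h: "h \<in> carrier K" for i h
  proof -
    have Rk_A: "(R ^^ k) (A i h) = A i ((R ^^ k) h)" for k
      by (induction k) (simp_all add: A_R[OF i] Rk h)
    have "W (A i h) = mult_adjoint i (W h)"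
    proof (rule hardy_eqI)
      show "hardy_coeff H (W (A i h)) k = hardy_coeff H (mult_adjoint i (W h)) k" for k
        unfolding W(2)[OF A[OF i h]] mult_adjoint(2)[OF i W(1)[OF h]] W(2)[OF h] Rk_A
        by (simp add: Q_A[OF i Rk[OF h]])
    qed (intro W A mult_adjoint i h)+
    then show ?thesis by (simp only: adj_mult_symbol[OF i W(1)[OF h]])
  qed
  ultimately show ?thesis by (rule that)
qed

end

section \<open>Products of commuting maps\<close>

lemma tuple_prod_commute:
  assumes "\<And>i x. \<lbrakk>i \<in> {1..n}; x \<in> S\<rbrakk> \<Longrightarrow> B i x \<in> S"
    and "\<And>i x. \<lbrakk>i \<in> {1..n}; x \<in> S\<rbrakk> \<Longrightarrow> C (B i x) = B i (C x)"
    and "x \<in> S"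
  shows "tuple_prod n B (C x) = C (tuple_prod n B x)"
  using assms
proof (induction n arbitrary: x)
  case (Suc n)
  have "tuple_prod n B (C (B (Suc n) x)) = C (tuple_prod n B (B (Suc n) x))"
    by (rule Suc.IH) (use Suc.prems in auto)
  then show ?case using Suc.prems by simp
qed simp

lemma tuple_prod_cong:
  "(\<And>i. i \<in> {1..n} \<Longrightarrow> B i = C i) \<Longrightarrow> tuple_prod n B = tuple_prod n C"
  by (induction n) auto

text \<open>Factors of larger index act earlier; \<open>B j\<close> commutes past them to its own
  place and fills the gap left there by \<open>id\<close>.\<close>

lemma tuple_prod_remove:
  assumes "\<And>i x. \<lbrakk>i \<in> {1..n}; x \<in> S\<rbrakk> \<Longrightarrow> B i x \<in> S"
    and "\<And>i k x. \<lbrakk>i \<in> {1..n}; k \<in> {1..n}; x \<in> S\<rbrakk> \<Longrightarrow> B i (B k x) = B k (B i x)"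
    and "j \<in> {1..n}" "x \<in> S"
  shows "tuple_prod n (B(j := id)) (B j x) = tuple_prod n B x"
  using assms
proof (induction n arbitrary: x)
  case (Suc n)
  show ?case
  proof (cases "j = Suc n")
    case True
    have "tuple_prod (Suc n) (B(j := id)) (B j x) = tuple_prod n (B(j := id)) (B j x)"
      using True by simp
    also have "tuple_prod n (B(j := id)) = tuple_prod n B"
      by (rule tuple_prod_cong) (use True in auto)
    finally show ?thesis using True by simp
  next
    case False
    have "tuple_prod (Suc n) (B(j := id)) (B j x) = tuple_prod n (B(j := id)) (B (Suc n) (B j x))"
      using False by simp
    also have "B (Suc n) (B j x) = B j (B (Suc n) x)"
      by (rule Suc.prems(2)) (use Suc.prems in auto)
    also have "tuple_prod n (B(j := id)) (B j (B (Suc n) x)) = tuple_prod n B (B (Suc n) x)"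
      by (rule Suc.IH) (use Suc.prems False in auto)
    finally show ?thesis by simp
  qed
qed simp

section \<open>The model space of a tuple\<close>

text \<open>\<open>A i\<close> is the adjoint of the \<open>i\<close>-th operator of the tuple; \<open>A_defect\<close> says that the defect
  operator of the \<open>i\<close>-th one satisfies \<open>D = T j D T j\<^sup>*\<close> for \<open>j \<noteq> i\<close>.\<close>

locale defect_tuple = separable_hilbert_space H for H :: "'a cinner_space" +
  fixes n :: nat and A :: "nat \<Rightarrow> 'a \<Rightarrow> 'a"
  assumes A_contraction: "i \<in> {1..n} \<Longrightarrow> contraction H (A i)"
    and A_commute: "\<lbrakk>i \<in> {1..n}; j \<in> {1..n}; x \<in> carrier H\<rbrakk> \<Longrightarrow> A i (A j x) = A j (A i x)"
    and A_defect: "\<lbrakk>i \<in> {1..n}; j \<in> {1..n}; i \<noteq> j; x \<in> carrier H; y \<in> carrier H\<rbrakk> \<Longrightarrow>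
      cinner H (A j x) (A j y) - cinner H (A i (A j x)) (A i (A j y)) =
      cinner H x y - cinner H (A i x) (A i y)"
begin

lemmas A_lin = linear_operatorD[OF contractionD(1)[OF A_contraction]]

definition defect :: "nat \<Rightarrow> 'a \<Rightarrow> 'a \<Rightarrow> complex" where
  "defect i x y = cinner H x y - cinner H (A i x) (A i y)"

text \<open>The isometry \<open>S_i\<close> for the form \<open>defect i\<close>; putting
  \<open>id\<close> in place of a factor keeps the index range of the product.\<close>

definition omit :: "nat \<Rightarrow> 'a \<Rightarrow> 'a" where
  "omit i = tuple_prod n (A(i := id))"

text \<open>The cofactor of \<open>A j\<close> in \<open>omit i\<close> for
  \<open>j \<noteq> i\<close>: dividing it by \<open>omit i\<close> gives the inverse of
  \<open>A j\<close> on the \<open>i\<close>-th summand.\<close>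

definition omit2 :: "nat \<Rightarrow> nat \<Rightarrow> 'a \<Rightarrow> 'a" where
  "omit2 i j = tuple_prod n (A(i := id, j := id))"

lemma A_upd_carrier:
  assumes "k \<in> {1..n}" "x \<in> carrier H"
  shows "(A(i := id)) k x \<in> carrier H" "(A(i := id, j := id)) k x \<in> carrier H"
  using assms A_lin(1) by auto

lemma A_upd_commute:
  assumes "k \<in> {1..n}" "l \<in> {1..n}" "x \<in> carrier H"
  shows "A l ((A(i := id)) k x) = (A(i := id)) k (A l x)"
    "(A(i := id)) l ((A(i := id)) k x) = (A(i := id)) k ((A(i := id)) l x)"
    "A l ((A(i := id, j := id)) k x) = (A(i := id, j := id)) k (A l x)"
  using assms A_commute[of k l x] by auto

lemma contraction_omit: "contraction H (omit i)"
  unfolding omit_def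
  using A_contraction contraction_ident
  by (intro tuple_prod_contraction) (auto simp: id_def)

lemma contraction_omit2: "contraction H (omit2 i j)"
  unfolding omit2_def
  using A_contraction contraction_ident
  by (intro tuple_prod_contraction) (auto simp: id_def)

lemmas omit_lin = linear_operatorD[OF contractionD(1)[OF contraction_omit]]
lemmas omit2_carrier = contractionD(2)[OF contraction_omit2]

lemma omit_A:
  assumes "i \<in> {1..n}" "x \<in> carrier H"
  shows "omit i (A i x) = tuple_prod n A x"
  unfolding omit_def
  by (rule tuple_prod_remove[where S = "carrier H"]) (use assms A_lin A_commute in auto)

lemma omit2_A:
  assumes "j \<in> {1..n}" "i \<noteq> j" "x \<in> carrier H"
  shows "omit2 i j (A j x) = omit i x"
  using tuple_prod_remove[of n "carrier H" "A(i := id)" j x] assms A_upd_carrier(1) A_upd_commute(2)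
  by (auto simp: omit_def omit2_def)

lemma omit2_commute:
  assumes "j \<in> {1..n}" "x \<in> carrier H"
  shows "omit2 i k (A j x) = A j (omit2 i k x)"
  unfolding omit2_def
  by (rule tuple_prod_commute[where S = "carrier H"]) (use assms A_upd_carrier A_upd_commute(3) in auto)

lemma omit_omit2:
  assumes "x \<in> carrier H"
  shows "omit i (omit2 i j x) = omit2 i j (omit i x)"
  unfolding omit_def
  by (rule tuple_prod_commute[where S = "carrier H"])
    (use assms omit2_commute A_upd_carrier in auto)

lemma defect_tuple_prod:
  assumes "\<And>k x y. \<lbrakk>k \<in> {1..m}; x \<in> carrier H; y \<in> carrier H\<rbrakk> \<Longrightarrow> defect i (C k x) (C k y) = defect i x y"
    and "\<And>k x. \<lbrakk>k \<in> {1..m}; x \<in> carrier H\<rbrakk> \<Longrightarrow> C k x \<in> carrier H"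
    and "x \<in> carrier H" "y \<in> carrier H"
  shows "defect i (tuple_prod m C x) (tuple_prod m C y) = defect i x y"
  using assms
proof (induction m arbitrary: x y)
  case (Suc m)
  have "defect i (tuple_prod m C (C (Suc m) x)) (tuple_prod m C (C (Suc m) y)) =
      defect i (C (Suc m) x) (C (Suc m) y)"
    by (rule Suc.IH) (use Suc.prems in auto)
  then show ?case using Suc.prems by simp
qed simp

lemma defect_A:
  "\<lbrakk>i \<in> {1..n}; j \<in> {1..n}; i \<noteq> j; x \<in> carrier H; y \<in> carrier H\<rbrakk> \<Longrightarrow>
    defect i (A j x) (A j y) = defect i x y"
  unfolding defect_def by (rule A_defect)

lemma defect_omit:
  assumes "i \<in> {1..n}" "x \<in> carrier H" "y \<in> carrier H"
  shows "defect i (omit i x) (omit i y) = defect i x y"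
  unfolding omit_def
  by (rule defect_tuple_prod) (use assms defect_A A_lin(1) in auto)

lemma defect_omit2:
  assumes "i \<in> {1..n}" "x \<in> carrier H" "y \<in> carrier H"
  shows "defect i (omit2 i j x) (omit2 i j y) = defect i x y"
  unfolding omit2_def
  by (rule defect_tuple_prod) (use assms defect_A A_lin(1) in auto)

lemma omit_pow_carrier: "x \<in> carrier H \<Longrightarrow> (omit i ^^ k) x \<in> carrier H"
  by (induction k) (auto simp: omit_lin)

lemma omit_pow_lin:
  "\<lbrakk>x \<in> carrier H; y \<in> carrier H\<rbrakk> \<Longrightarrow> (omit i ^^ k) (x \<oplus>\<^bsub>H\<^esub> y) = (omit i ^^ k) x \<oplus>\<^bsub>H\<^esub> (omit i ^^ k) y"
  "x \<in> carrier H \<Longrightarrow> (omit i ^^ k) (c \<odot>\<^bsub>H\<^esub> x) = c \<odot>\<^bsub>H\<^esub> (omit i ^^ k) x"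
  by (induction k) (auto simp: omit_lin omit_pow_carrier)

lemma omit_pow_omit2:
  assumes "x \<in> carrier H"
  shows "(omit i ^^ k) (omit2 i j x) = omit2 i j ((omit i ^^ k) x)"
  by (induction k) (use assms in \<open>auto simp: omit_omit2 omit_pow_carrier\<close>)

lemma defect_omit_pow:
  assumes "i \<in> {1..n}" "x \<in> carrier H" "y \<in> carrier H"
  shows "defect i ((omit i ^^ k) x) ((omit i ^^ k) y) = defect i x y"
  by (induction k) (use assms in \<open>auto simp: defect_omit omit_pow_carrier\<close>)

lemma defect_add_left:
  "\<lbrakk>i \<in> {1..n}; x \<in> carrier H; y \<in> carrier H; z \<in> carrier H\<rbrakk> \<Longrightarrow>
    defect i (x \<oplus>\<^bsub>H\<^esub> y) z = defect i x z + defect i y z"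
  by (simp add: defect_def A_lin cinner_simps algebra_simps)

lemma defect_scale_left:
  "\<lbrakk>i \<in> {1..n}; x \<in> carrier H; z \<in> carrier H\<rbrakk> \<Longrightarrow> defect i (c \<odot>\<^bsub>H\<^esub> x) z = c * defect i x z"
  by (simp add: defect_def A_lin cinner_simps algebra_simps)

lemma defect_commute:
  "\<lbrakk>i \<in> {1..n}; x \<in> carrier H; z \<in> carrier H\<rbrakk> \<Longrightarrow> defect i z x = cnj (defect i x z)"
  using cinner_commute[of z x] cinner_commute[of "A i z" "A i x"] by (simp add: defect_def A_lin)

text \<open>The lower bound makes the forms semi-inner products; the upper bound makes norm-dense
  sets dense for them, which yields separability of the model space.\<close>

lemma defect_bounds:
  assumes "i \<in> {1..n}" "x \<in> carrier H"
  shows "0 \<le> Re (defect i x x)" "Re (defect i x x) \<le> (hnorm H x)\<^sup>2"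
proof -
  have d: "Re (defect i x x) = (hnorm H x)\<^sup>2 - (hnorm H (A i x))\<^sup>2"
    using assms by (simp add: defect_def norm_sq A_lin)
  have "hnorm H (A i x) \<le> hnorm H x"
    by (rule contractionD(3)[OF A_contraction]) (use assms in auto)
  then show "0 \<le> Re (defect i x x)" "Re (defect i x x) \<le> (hnorm H x)\<^sup>2"
    using assms A_lin(1) by (simp_all add: d power_mono hnorm_nonneg)
qed

text \<open>Since \<open>omit i\<close> is isometric for the semi-inner product \<open>defect i\<close>, the latter extends to
  formal fractions: the pair \<open>(h, m)\<close> stands for \<open>h\<close> divided by the \<open>m\<close>-th power of \<open>omit i\<close>.
  On these, the \<open>A j\<close> with \<open>j \<noteq> i\<close> become invertible, being factors of \<open>omit i\<close>.\<close>

definition frac_form :: "nat \<Rightarrow> 'a \<times> nat \<Rightarrow> 'a \<times> nat \<Rightarrow> complex" where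
  "frac_form i x y = defect i ((omit i ^^ snd y) (fst x)) ((omit i ^^ snd x) (fst y))"

text \<open>The direct sum over \<open>i\<close> is taken before completing, so that a single
  completion produces the whole model space.\<close>

definition fracs :: "(nat \<Rightarrow> 'a \<times> nat) set" where
  "fracs = {x. \<forall>i\<in>{1..n}. fst (x i) \<in> carrier H}"

definition form :: "(nat \<Rightarrow> 'a \<times> nat) \<Rightarrow> (nat \<Rightarrow> 'a \<times> nat) \<Rightarrow> complex" where
  "form x y = (\<Sum>i\<in>{1..n}. frac_form i (x i) (y i))"

definition frac_add :: "(nat \<Rightarrow> 'a \<times> nat) \<Rightarrow> (nat \<Rightarrow> 'a \<times> nat) \<Rightarrow> nat \<Rightarrow> 'a \<times> nat" where
  "frac_add x y i = ((omit i ^^ snd (y i)) (fst (x i)) \<oplus>\<^bsub>H\<^esub> (omit i ^^ snd (x i)) (fst (y i)),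
    snd (x i) + snd (y i))"

definition frac_scl :: "complex \<Rightarrow> (nat \<Rightarrow> 'a \<times> nat) \<Rightarrow> nat \<Rightarrow> 'a \<times> nat" where
  "frac_scl c x i = (c \<odot>\<^bsub>H\<^esub> fst (x i), snd (x i))"

text \<open>Passing to a common denominator inserts the same power of \<open>omit i\<close> into
  both arguments of each summand, and \<open>defect_omit_pow\<close> cancels it.\<close>

lemma frac_form_lin:
  assumes i: "i \<in> {1..n}" and c: "h \<in> carrier H" "g \<in> carrier H" "f \<in> carrier H"
  shows "frac_form i ((omit i ^^ l) h \<oplus>\<^bsub>H\<^esub> (omit i ^^ m) g, m + l) (f, p) =
      frac_form i (h, m) (f, p) + frac_form i (g, l) (f, p)"
    "frac_form i (c \<odot>\<^bsub>H\<^esub> h, m) (f, p) = c * frac_form i (h, m) (f, p)"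
    "frac_form i (h, m) (f, p) = cnj (frac_form i (f, p) (h, m))"
    "0 \<le> Re (frac_form i (h, m) (h, m))"
proof -
  note oc = omit_pow_carrier
  have e: "(omit i ^^ p) ((omit i ^^ l) h) = (omit i ^^ l) ((omit i ^^ p) h)" for p l h
    by (metis add.commute comp_apply funpow_add)
  show "frac_form i ((omit i ^^ l) h \<oplus>\<^bsub>H\<^esub> (omit i ^^ m) g, m + l) (f, p) =
      frac_form i (h, m) (f, p) + frac_form i (g, l) (f, p)"
  proof -
    have "(omit i ^^ p) ((omit i ^^ l) h \<oplus>\<^bsub>H\<^esub> (omit i ^^ m) g) =
        (omit i ^^ l) ((omit i ^^ p) h) \<oplus>\<^bsub>H\<^esub> (omit i ^^ m) ((omit i ^^ p) g)"
      using omit_pow_lin(1)[OF oc[OF c(1)] oc[OF c(2)]] e[of p l h] e[of p m g] by simp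
    moreover have "(omit i ^^ (m + l)) f = (omit i ^^ m) ((omit i ^^ l) f)"
      by (simp add: funpow_add)
    ultimately have "frac_form i ((omit i ^^ l) h \<oplus>\<^bsub>H\<^esub> (omit i ^^ m) g, m + l) (f, p) =
      defect i ((omit i ^^ l) ((omit i ^^ p) h)) ((omit i ^^ l) ((omit i ^^ m) f)) +
      defect i ((omit i ^^ m) ((omit i ^^ p) g)) ((omit i ^^ m) ((omit i ^^ l) f))"
      using i c by (simp add: frac_form_def defect_add_left oc e[of l m f])
    then show ?thesis using i c by (simp add: defect_omit_pow frac_form_def oc)
  qed
  show "frac_form i (c \<odot>\<^bsub>H\<^esub> h, m) (f, p) = c * frac_form i (h, m) (f, p)"
    using i c by (simp add: frac_form_def defect_scale_left omit_pow_lin oc)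
  show "frac_form i (h, m) (f, p) = cnj (frac_form i (f, p) (h, m))"
    using defect_commute[OF i oc[OF c(3)] oc[OF c(1)]] by (simp add: frac_form_def)
  show "0 \<le> Re (frac_form i (h, m) (h, m))"
    using i c by (simp add: frac_form_def defect_bounds oc)
qed

text \<open>Expanding a fraction by \<open>omit i\<close> changes it by a null vector only. This
  relation is what makes raising the exponent an inverse of \<open>omit i\<close>.\<close>

lemma frac_form_cancel:
  assumes i: "i \<in> {1..n}" and c: "h \<in> carrier H" "fst y \<in> carrier H"
  shows "frac_form i (omit i h, Suc m) y = frac_form i (h, m) y"
proof -
  have "(omit i ^^ snd y) (omit i h) = omit i ((omit i ^^ snd y) h)"
    by (simp add: funpow_swap1)
  then show ?thesis
    using assms by (simp add: frac_form_def defect_omit omit_pow_carrier)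
qed

lemma frac_form_zero:
  assumes i: "i \<in> {1..n}" and c: "fst y \<in> carrier H"
  shows "frac_form i (\<zero>\<^bsub>H\<^esub>, m) y = 0" "frac_form i y (\<zero>\<^bsub>H\<^esub>, m) = 0"
proof -
  have z: "0 \<odot>\<^bsub>H\<^esub> \<zero>\<^bsub>H\<^esub> = \<zero>\<^bsub>H\<^esub>"
    by (rule vec_eqI) (simp_all add: cinner_simps)
  show "frac_form i (\<zero>\<^bsub>H\<^esub>, m) y = 0"
    using frac_form_lin(2)[OF i zero_carrier zero_carrier c, of 0 m "snd y"] by (simp add: z)
  then show "frac_form i y (\<zero>\<^bsub>H\<^esub>, m) = 0"
    using frac_form_lin(3)[OF i c zero_carrier zero_carrier, of "snd y" m] by simp
qed

sublocale F: semi_inner_product fracs form frac_add frac_scl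
proof
  show "fracs \<noteq> {}" unfolding fracs_def using zero_carrier by (auto intro!: exI[of _ "\<lambda>_. (\<zero>\<^bsub>H\<^esub>, 0)"])
  fix x y assume x: "x \<in> fracs" and y: "y \<in> fracs"
  show "frac_add x y \<in> fracs"
    using x y by (auto simp: fracs_def frac_add_def omit_pow_carrier carrier_intros)
  show "form x y = cnj (form y x)"
    unfolding form_def cnj_sum using x y
    by (intro sum.cong refl) (metis (mono_tags, lifting) fracs_def frac_form_lin(3) mem_Collect_eq prod.collapse)
  show "form (frac_add x y) z = form x z + form y z" if "z \<in> fracs" for z
    unfolding form_def sum.distrib[symmetric] frac_add_def
  proof (rule sum.cong[OF refl])
    fix i assume i: "i \<in> {1..n}"
    then show "frac_form i ((omit i ^^ snd (y i)) (fst (x i)) \<oplus>\<^bsub>H\<^esub> (omit i ^^ snd (x i)) (fst (y i)),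
        snd (x i) + snd (y i)) (z i) = frac_form i (x i) (z i) + frac_form i (y i) (z i)"
      using frac_form_lin(1)[OF i, of "fst (x i)" "fst (y i)" "fst (z i)" "snd (y i)" "snd (x i)" "snd (z i)"]
        x y that by (simp add: fracs_def)
  qed
next
  fix x c assume x: "x \<in> fracs"
  show "frac_scl c x \<in> fracs"
    using x by (auto simp: fracs_def frac_scl_def carrier_intros)
  show "form (frac_scl c x) z = c * form x z" if "z \<in> fracs" for z
    unfolding form_def sum_distrib_left frac_scl_def
  proof (rule sum.cong[OF refl])
    fix i assume i: "i \<in> {1..n}"
    then show "frac_form i (c \<odot>\<^bsub>H\<^esub> fst (x i), snd (x i)) (z i) = c * frac_form i (x i) (z i)"
      using frac_form_lin(2)[OF i, of "fst (x i)" "fst (x i)" "fst (z i)" c "snd (x i)" "snd (z i)"]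
        x that by (simp add: fracs_def)
  qed
  show "0 \<le> Re (form x x)"
    unfolding form_def Re_sum
  proof (rule sum_nonneg)
    fix i assume i: "i \<in> {1..n}"
    then show "0 \<le> Re (frac_form i (x i) (x i))"
      using frac_form_lin(4)[OF i, of "fst (x i)" "fst (x i)" "fst (x i)" "snd (x i)"]
        x by (simp add: fracs_def)
  qed
qed

lemma fracsD: "\<lbrakk>x \<in> fracs; i \<in> {1..n}\<rbrakk> \<Longrightarrow> fst (x i) \<in> carrier H"
  by (simp add: fracs_def)

lemma sqdist_form:
  "F.sqdist x y = (\<Sum>i\<in>{1..n}. Re (frac_form i (x i) (x i)) - 2 * Re (frac_form i (x i) (y i)) +
    Re (frac_form i (y i) (y i)))"
  by (simp add: F.sqdist_def form_def sum.distrib sum_subtractf sum_distrib_left)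

text \<open>For equal denominators the powers of \<open>omit i\<close> cancel, so the distance is
  that of the numerators for \<open>defect i\<close>, which the norm dominates.\<close>

lemma frac_sqdist:
  assumes i: "i \<in> {1..n}" and c: "h \<in> carrier H" "g \<in> carrier H"
  shows "Re (frac_form i (h, m) (h, m)) - 2 * Re (frac_form i (h, m) (g, m)) +
    Re (frac_form i (g, m) (g, m)) \<le> (hnorm H (h \<ominus>\<^bsub>H\<^esub> g))\<^sup>2"
proof -
  define u where "u = h \<oplus>\<^bsub>H\<^esub> (- 1) \<odot>\<^bsub>H\<^esub> g"
  have u: "u \<in> carrier H" "h \<ominus>\<^bsub>H\<^esub> g = u"
    using c by (auto intro!: vec_eqI simp: u_def cinner_simps)
  have "Re (defect i h g) = Re (defect i g h)"
    using defect_commute[OF i c(2) c(1)] by simp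
  moreover have "defect i u v = defect i h v - defect i g v" if "v \<in> carrier H" for v
    using i c that by (simp add: u_def defect_add_left defect_scale_left carrier_intros)
  moreover have "defect i v u = defect i v h - defect i v g" if "v \<in> carrier H" for v
    using calculation(2)[OF that] defect_commute[OF i _ that] c u(1)
    by (metis complex_cnj_diff)
  ultimately have "Re (defect i u u) = Re (defect i h h) - 2 * Re (defect i h g) + Re (defect i g g)"
    using u c by simp
  then show ?thesis
    using defect_bounds(2)[OF i u(1)] u(2) i c
    by (simp add: frac_form_def defect_omit_pow)
qed

lemma separable_completion: "separable_hilbert_space F.completion"
proof -
  interpret D: Metric_space "carrier H" "hdist H" by (rule hdist_metric)
  obtain C where C: "countable C" "C \<subseteq> carrier H" "D.mtopology closure_of C = carrier H"
    using separable by (auto simp: separable_space_def)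
  \<comment> \<open>Numerators come from the dense set while all exponents are allowed, so an
    approximant can keep the denominators of \<open>x\<close>. Fixing the values off
    \<open>{1..n}\<close> makes the set countable.\<close>
  define Z where "Z = Pi\<^sub>E {1..n} (\<lambda>_. C \<times> (UNIV :: nat set))"
  show ?thesis
  proof (rule F.separable_hilbert_space_completion[of Z])
    show "countable Z" unfolding Z_def using C(1) by (intro countable_PiE) auto
    show "Z \<subseteq> fracs" using C(2) by (force simp: Z_def fracs_def PiE_iff mem_Times_iff)
    fix x and e :: real assume x: "x \<in> fracs" and e: "e > 0"
    define r where "r = e / (real n + 1)"
    have r: "r > 0" using e by (simp add: r_def)
    have "\<exists>c\<in>C. (hnorm H (fst (x i) \<ominus>\<^bsub>H\<^esub> c))\<^sup>2 < r" if "i \<in> {1..n}" for i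
    proof -
      have "fst (x i) \<in> D.mtopology closure_of C" using C(3) fracsD[OF x that] by simp
      moreover have "sqrt r > 0" using r by simp
      ultimately obtain c where "c \<in> C" "c \<in> D.mball (fst (x i)) (sqrt r)"
        unfolding D.metric_closure_of by blast
      then have "hnorm H (fst (x i) \<ominus>\<^bsub>H\<^esub> c) < sqrt r" "0 \<le> hnorm H (fst (x i) \<ominus>\<^bsub>H\<^esub> c)"
        using hnorm_nonneg minus_carrier by (auto simp: D.in_mball hdist_def)
      then have "(hnorm H (fst (x i) \<ominus>\<^bsub>H\<^esub> c))\<^sup>2 < (sqrt r)\<^sup>2"
        by (intro power_strict_mono) auto
      then show ?thesis using \<open>c \<in> C\<close> r by auto
    qed
    then obtain c where c: "\<And>i. i \<in> {1..n} \<Longrightarrow> c i \<in> C"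
      "\<And>i. i \<in> {1..n} \<Longrightarrow> (hnorm H (fst (x i) \<ominus>\<^bsub>H\<^esub> c i))\<^sup>2 < r"
      by metis
    define z where "z = (\<lambda>i\<in>{1..n}. (c i, snd (x i)))"
    have "z \<in> Z" using c(1) by (auto simp: z_def Z_def)
    have "F.sqdist x z \<le> (\<Sum>i\<in>{1..n}. r)"
      unfolding sqdist_form
    proof (rule sum_mono)
      fix i assume i: "i \<in> {1..n}"
      have "c i \<in> carrier H" using c(1)[OF i] C(2) by blast
      then show "Re (frac_form i (x i) (x i)) - 2 * Re (frac_form i (x i) (z i)) +
          Re (frac_form i (z i) (z i)) \<le> r"
        using frac_sqdist[OF i fracsD[OF x i], of "c i" "snd (x i)"] c(2)[OF i] i by (simp add: z_def)
    qed
    also have "\<dots> = real n * r" by simp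
    also have "\<dots> < (real n + 1) * r" using r by simp
    also have "\<dots> = e" by (simp add: r_def)
    finally show "\<exists>z\<in>Z. F.sqdist x z < e" using \<open>z \<in> Z\<close> by blast
  qed
qed

end

context defect_tuple
begin

text \<open>On the \<open>i\<close>-th coordinate, \<open>op_U j\<close> is \<open>A j\<close> if \<open>i \<noteq> j\<close> and the inverse of \<open>omit i\<close> if
  \<open>i = j\<close>; so the product of all \<open>op_U j\<close> is the identity up to null vectors. The inverse of \<open>op_U j\<close>
  is \<open>op_V j\<close>.\<close>

definition op_U :: "nat \<Rightarrow> (nat \<Rightarrow> 'a \<times> nat) \<Rightarrow> nat \<Rightarrow> 'a \<times> nat" where
  "op_U j x i = (if i = j then (fst (x i), Suc (snd (x i))) else (A j (fst (x i)), snd (x i)))"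

text \<open>In coordinate \<open>j\<close> this undoes the division by \<open>omit j\<close>. In
  another coordinate \<open>i\<close> it inverts \<open>A j\<close>: the cofactor
  \<open>omit2 i j\<close> goes to the numerator and one more \<open>omit i\<close> to the
  denominator.\<close>

definition op_V :: "nat \<Rightarrow> (nat \<Rightarrow> 'a \<times> nat) \<Rightarrow> nat \<Rightarrow> 'a \<times> nat" where
  "op_V j x i = (if i = j then (omit j (fst (x i)), snd (x i))
    else (omit2 i j (fst (x i)), Suc (snd (x i))))"

definition op_P :: "nat set \<Rightarrow> (nat \<Rightarrow> 'a \<times> nat) \<Rightarrow> nat \<Rightarrow> 'a \<times> nat" where
  "op_P S x i = (if i \<in> S then x i else (\<zero>\<^bsub>H\<^esub>, 0))"

lemma op_closed:
  assumes "x \<in> fracs"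
  shows "j \<in> {1..n} \<Longrightarrow> op_U j x \<in> fracs" "op_V j x \<in> fracs" "op_P S x \<in> fracs"
  using assms A_lin(1) omit_lin(1) omit2_carrier zero_carrier
  by (auto simp: fracs_def op_U_def op_V_def op_P_def)

lemma form_cong:
  assumes "\<And>i. i \<in> {1..n} \<Longrightarrow> x i = y i"
  shows "form x z = form y z"
  using assms by (simp add: form_def)

lemma form_cancel:
  assumes "x \<in> fracs" "y \<in> fracs"
    and "\<And>i. i \<in> {1..n} \<Longrightarrow> x' i = (omit i (fst (x i)), Suc (snd (x i)))"
  shows "form x' y = form x y"
  unfolding form_def
proof (rule sum.cong[OF refl])
  fix i assume i: "i \<in> {1..n}"
  then show "frac_form i (x' i) (y i) = frac_form i (x i) (y i)"
    using frac_form_cancel[OF i fracsD[OF assms(1) i] fracsD[OF assms(2) i]] assms(3) by simp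
qed

text \<open>In every coordinate the composite multiplies the numerator by \<open>omit i\<close> and
  raises the exponent by one: the fraction is expanded, hence equal to the original up to a null
  vector.\<close>

lemma form_UV:
  assumes "j \<in> {1..n}" "x \<in> fracs" "y \<in> fracs"
  shows "form (op_U j (op_V j x)) y = form x y"
  by (rule form_cancel[OF assms(2,3)])
    (use assms omit2_commute[of j] omit2_A[of j] fracsD[OF assms(2)] in \<open>auto simp: op_U_def op_V_def\<close>)

lemma form_VU:
  assumes "j \<in> {1..n}" "x \<in> fracs" "y \<in> fracs"
  shows "form (op_V j (op_U j x)) y = form x y"
  by (rule form_cancel[OF assms(2,3)])
    (use assms omit2_A[of j] fracsD[OF assms(2)] in \<open>auto simp: op_U_def op_V_def\<close>)

lemma frac_form_UV:
  assumes j: "j \<in> {1..n}" and i: "i \<in> {1..n}" and x: "x \<in> fracs" and y: "y \<in> fracs"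
  shows "frac_form i (op_U j x i) (y i) = frac_form i (x i) (op_V j y i)"
proof (cases "i = j")
  case True
  then show ?thesis by (simp add: op_U_def op_V_def frac_form_def funpow_swap1)
next
  case False
  note c = fracsD[OF x i] fracsD[OF y i]
  \<comment> \<open>This exposes \<open>omit2 i j\<close> as a factor of the first argument on the
    right-hand side; the second argument contains it through \<open>op_V\<close>, and
    \<open>defect_omit2\<close> cancels the pair.\<close>
  have "(omit i ^^ Suc (snd (y i))) (fst (x i)) = omit2 i j ((omit i ^^ snd (y i)) (A j (fst (x i))))"
    using c j False omit2_A[of j i "fst (x i)"] A_lin(1)[OF j c(1)]
    by (simp add: omit_pow_omit2[symmetric] funpow_swap1)
  then show ?thesis
    using c j i False A_lin(1)[OF j c(1)]
    by (simp add: op_U_def op_V_def frac_form_def omit_pow_omit2 defect_omit2 omit_pow_carrier del: funpow.simps)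
qed

lemma form_adjoint:
  assumes "j \<in> {1..n}" "x \<in> fracs" "y \<in> fracs"
  shows "form (op_U j x) y = form x (op_V j y)" "form (op_V j x) y = form x (op_U j y)"
proof -
  have *: "form (op_U j x) y = form x (op_V j y)" if "x \<in> fracs" "y \<in> fracs" for x y
    unfolding form_def by (rule sum.cong[OF refl]) (rule frac_form_UV[OF assms(1) _ that])
  show "form (op_U j x) y = form x (op_V j y)" by (rule *[OF assms(2,3)])
  show "form (op_V j x) y = form x (op_U j y)"
    using *[OF assms(3,2)] F.form_commute[OF op_closed(2)[OF assms(2)] assms(3)]
      F.form_commute[OF assms(2) op_closed(1)[OF assms(3,1)]] by simp
qed

lemma formal_adjoint_UV:
  assumes "j \<in> {1..n}"
  shows "F.formal_adjoint (op_U j) (op_V j)" "F.formal_adjoint (op_V j) (op_U j)"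
proof -
  have "form (op_U j x) (op_U j y) = form x y" if "x \<in> fracs" "y \<in> fracs" for x y
    using that assms form_adjoint(2)[OF assms op_closed(1), symmetric] form_VU op_closed by simp
  moreover have "form (op_V j x) (op_V j y) = form x y" if "x \<in> fracs" "y \<in> fracs" for x y
    using that assms form_adjoint(1)[OF assms op_closed(2), symmetric] form_UV op_closed by simp
  ultimately show "F.formal_adjoint (op_U j) (op_V j)" "F.formal_adjoint (op_V j) (op_U j)"
    using assms form_adjoint op_closed by (auto simp: F.formal_adjoint_def F.sqdist_def)
qed

lemma form_P:
  assumes "x \<in> fracs" "y \<in> fracs"
  shows "form (op_P S x) y = (\<Sum>i\<in>{1..n} \<inter> S. frac_form i (x i) (y i))"
    "form x (op_P S y) = (\<Sum>i\<in>{1..n} \<inter> S. frac_form i (x i) (y i))"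
  unfolding form_def sum.inter_restrict[OF finite_atLeastAtMost]
  by (rule sum.cong; use assms fracsD in \<open>auto simp: op_P_def frac_form_zero\<close>)+

lemma formal_adjoint_P: "F.formal_adjoint (op_P S) (op_P S)"
  unfolding F.formal_adjoint_def
proof (intro conjI ballI)
  fix x y assume x: "x \<in> fracs" and y: "y \<in> fracs"
  show "form (op_P S x) y = form x (op_P S y)"
    using x y by (simp add: form_P)
  show "F.sqdist (op_P S x) (op_P S y) \<le> F.sqdist x y"
    unfolding sqdist_form
  proof (rule sum_mono)
    fix i assume i: "i \<in> {1..n}"
    have "0 \<le> Re (frac_form i (x i) (x i)) - 2 * Re (frac_form i (x i) (y i)) +
        Re (frac_form i (y i) (y i))"
    proof -
      \<comment> \<open>Tuples supported in the single coordinate \<open>i\<close> turn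
        nonnegativity of the total distance into nonnegativity of its \<open>i\<close>-th
        term.\<close>
      have ei: "(\<lambda>k. if k = i then x i else (\<zero>\<^bsub>H\<^esub>, 0)) \<in> fracs" "(\<lambda>k. if k = i then y i else (\<zero>\<^bsub>H\<^esub>, 0)) \<in> fracs"
        using x y zero_carrier by (auto simp: fracs_def)
      from F.sqdist_nonneg[OF this] show ?thesis
        unfolding sqdist_form using i
        by (subst (asm) sum.remove[of _ i]) (auto simp: frac_form_zero zero_carrier)
    qed
    then show "Re (frac_form i (op_P S x i) (op_P S x i)) - 2 * Re (frac_form i (op_P S x i) (op_P S y i)) +
        Re (frac_form i (op_P S y i) (op_P S y i)) \<le>
      Re (frac_form i (x i) (x i)) - 2 * Re (frac_form i (x i) (y i)) + Re (frac_form i (y i) (y i))"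
      using i by (simp add: op_P_def frac_form_zero zero_carrier)
  qed
qed (auto intro: op_closed)

text \<open>\<open>F.lift\<close> turns a map into the extension of its formal adjoint, hence the exchange of \<open>U\<close>
  and \<open>V\<close>.\<close>

definition mod_V :: "nat \<Rightarrow> ((nat \<Rightarrow> 'a \<times> nat) \<Rightarrow> complex) \<Rightarrow> (nat \<Rightarrow> 'a \<times> nat) \<Rightarrow> complex" where
  "mod_V j = F.lift (op_U j)"

definition mod_U :: "nat \<Rightarrow> ((nat \<Rightarrow> 'a \<times> nat) \<Rightarrow> complex) \<Rightarrow> (nat \<Rightarrow> 'a \<times> nat) \<Rightarrow> complex" where
  "mod_U j = F.lift (op_V j)"

definition mod_P :: "nat set \<Rightarrow> ((nat \<Rightarrow> 'a \<times> nat) \<Rightarrow> complex) \<Rightarrow> (nat \<Rightarrow> 'a \<times> nat) \<Rightarrow> complex" where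
  "mod_P S = F.lift (op_P S)"

lemma completion_eqI:
  assumes "\<phi> \<in> carrier F.completion" "\<psi> \<in> carrier F.completion" "\<And>x. x \<in> fracs \<Longrightarrow> \<phi> x = \<psi> x"
  shows "\<phi> = \<psi>"
proof
  fix x show "\<phi> x = \<psi> x"
    using assms(3) F.representsD(4)[OF F.represents_form_rep[OF assms(1)]]
      F.representsD(4)[OF F.represents_form_rep[OF assms(2)]] by (cases "x \<in> fracs") simp_all
qed

lemma completion_cong:
  assumes "\<phi> \<in> carrier F.completion" "x \<in> fracs" "\<And>i. i \<in> {1..n} \<Longrightarrow> x i = y i"
  shows "\<phi> x = \<phi> y"
proof (rule F.completion_eval_cong[OF assms(1,2)])
  show "y \<in> fracs" using assms(2,3) by (simp add: fracs_def)
qed (use form_cong assms(3) in blast)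

text \<open>Each \<open>mod_V j\<close> moves the point of evaluation by \<open>op_U j\<close>. In
  coordinate \<open>i\<close> this applies all the \<open>A j\<close> except at
  \<open>j = i\<close>, where the exponent rises instead; at \<open>m = n\<close> every coordinate
  has been expanded by \<open>omit i\<close>.\<close>

lemma op_U_iter:
  assumes "i \<in> {1..n}" "x \<in> fracs" "\<phi> \<in> carrier F.completion" "m \<le> n"
  obtains y where "y \<in> fracs" "tuple_prod m mod_V \<phi> x = \<phi> y"
    "\<And>i. i \<in> {1..n} \<Longrightarrow> y i = (tuple_prod m (A(i := id)) (fst (x i)), snd (x i) + (if i \<le> m then 1 else 0))"
  using assms
proof (induction m arbitrary: \<phi> thesis)
  case 0
  then show ?case by (intro "0.prems"(1)[of x]) auto
next
  case (Suc m)
  then have m: "Suc m \<in> {1..n}" "m \<le> n" by auto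
  have \<phi>: "mod_V (Suc m) \<phi> \<in> carrier F.completion"
    unfolding mod_V_def
    by (rule linear_operatorD(1)[OF F.linear_lift[OF formal_adjoint_UV(2)]]) (use m Suc.prems in auto)
  obtain y where y: "y \<in> fracs" "tuple_prod m mod_V (mod_V (Suc m) \<phi>) x = mod_V (Suc m) \<phi> y"
    "\<And>i. i \<in> {1..n} \<Longrightarrow> y i = (tuple_prod m (A(i := id)) (fst (x i)), snd (x i) + (if i \<le> m then 1 else 0))"
    using Suc.IH[OF _ Suc.prems(2,3) \<phi> m(2)] by blast
  have "A (Suc m) (tuple_prod m (A(i := id)) (fst (x i))) =
      tuple_prod m (A(i := id)) (A (Suc m) (fst (x i)))" if i: "i \<in> {1..n}" for i
    by (rule tuple_prod_commute[where S = "carrier H", symmetric])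
      (use A_upd_commute(1) A_upd_carrier(1) m fracsD[OF Suc.prems(3) i] in auto)
  then have "op_U (Suc m) y i = (tuple_prod (Suc m) (A(i := id)) (fst (x i)),
      snd (x i) + (if i \<le> Suc m then 1 else 0))" if "i \<in> {1..n}" for i
    using y(3)[OF that] that by (auto simp: op_U_def)
  moreover have "tuple_prod (Suc m) mod_V \<phi> x = \<phi> (op_U (Suc m) y)"
    using y(1,2) by (simp add: mod_V_def F.lift_def)
  ultimately show ?case
    using Suc.prems(1) op_closed(1)[OF y(1) m(1)] by blast
qed

lemma bcl_model_completion:
  assumes "n \<ge> 1"
  shows "bcl_model F.completion n mod_V mod_U mod_P"
proof -
  interpret C: separable_hilbert_space F.completion by (rule separable_completion)
  note V_lin = F.linear_lift[OF formal_adjoint_UV(2), folded mod_V_def]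
    and U_lin = F.linear_lift[OF formal_adjoint_UV(1), folded mod_U_def]
    and P_lin = F.linear_lift[OF formal_adjoint_P, folded mod_P_def]
  note [simp] = linear_operatorD(1)[OF V_lin] linear_operatorD(1)[OF U_lin] linear_operatorD(1)[OF P_lin]
  have val: "mod_V j \<phi> x = \<phi> (op_U j x)" "mod_U j \<phi> x = \<phi> (op_V j x)" "mod_P S \<phi> x = \<phi> (op_P S x)"
    if "x \<in> fracs" for \<phi> x j S
    using that by (simp_all add: mod_V_def mod_U_def mod_P_def F.lift_def)
  show ?thesis
  proof
    fix i assume i: "i \<in> {1..n}"
    show "linear_operator F.completion F.completion (mod_V i)" by (rule V_lin[OF i])
    show "linear_operator F.completion F.completion (mod_U i)" by (rule U_lin[OF i])
    fix \<phi> assume \<phi>: "\<phi> \<in> carrier F.completion"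
    show "mod_U i (mod_V i \<phi>) = \<phi>"
    proof (rule completion_eqI)
      fix x assume x: "x \<in> fracs"
      have "\<phi> (op_U i (op_V i x)) = \<phi> x"
        by (rule F.completion_eval_cong[OF \<phi>]) (use x i form_UV op_closed in auto)
      then show "mod_U i (mod_V i \<phi>) x = \<phi> x" using x i by (simp add: val op_closed)
    qed (use \<phi> i in simp_all)
    show "mod_V i (mod_U i \<phi>) = \<phi>"
    proof (rule completion_eqI)
      fix x assume x: "x \<in> fracs"
      have "\<phi> (op_V i (op_U i x)) = \<phi> x"
        by (rule F.completion_eval_cong[OF \<phi>]) (use x i form_VU op_closed in auto)
      then show "mod_V i (mod_U i \<phi>) x = \<phi> x" using x i by (simp add: val op_closed(1)[OF x i])
    qed (use \<phi> i in simp_all)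
    show "cinner F.completion (mod_V i \<phi>) \<psi> = cinner F.completion \<phi> (mod_U i \<psi>)"
      if "\<psi> \<in> carrier F.completion" for \<psi>
      unfolding mod_V_def mod_U_def
      by (rule F.cinner_lift[OF formal_adjoint_UV(2)[OF i] formal_adjoint_UV(1)[OF i] \<phi> that])
    show "mod_V i (mod_V j \<phi>) = mod_V j (mod_V i \<phi>)" if j: "j \<in> {1..n}" for j
    proof (rule completion_eqI)
      fix x assume x: "x \<in> fracs"
      have "\<phi> (op_U j (op_U i x)) = \<phi> (op_U i (op_U j x))"
        by (rule completion_cong[OF \<phi>])
          (use x i j op_closed fracsD[OF x] A_commute in \<open>auto simp: op_U_def\<close>)
      then show "mod_V i (mod_V j \<phi>) x = mod_V j (mod_V i \<phi>) x"
        using x i j by (simp add: val op_closed(1)[OF x i] op_closed(1)[OF x j])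
    qed (use \<phi> i j in simp_all)
    show "mod_V i (mod_P S \<phi>) = mod_P S (mod_V i \<phi>)" for S
    proof (rule completion_eqI)
      fix x assume x: "x \<in> fracs"
      \<comment> \<open>Off \<open>S\<close> the two points carry different representatives of zero,
        \<open>(\<zero>, 0)\<close> and its image under \<open>op_U i\<close>, so they are compared
        through the form and not coordinate by coordinate.\<close>
      have "\<phi> (op_P S (op_U i x)) = \<phi> (op_U i (op_P S x))"
      proof (rule F.completion_eval_cong[OF \<phi>])
        fix z assume z: "z \<in> fracs"
        have "form (op_P S (op_U i x)) z = (\<Sum>k\<in>{1..n} \<inter> S. frac_form k (op_U i x k) (z k))"
          by (rule form_P) (use op_closed x z i in auto)
        also have "\<dots> = (\<Sum>k\<in>{1..n} \<inter> S. frac_form k (x k) (op_V i z k))"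
          by (rule sum.cong) (use frac_form_UV i x z in auto)
        also have "\<dots> = form (op_P S x) (op_V i z)"
          by (rule form_P[symmetric]) (use op_closed x z i in auto)
        also have "\<dots> = form (op_U i (op_P S x)) z"
          by (rule form_adjoint[symmetric]) (use op_closed x z i in auto)
        finally show "form (op_P S (op_U i x)) z = form (op_U i (op_P S x)) z" .
      qed (use op_closed x i in auto)
      then show "mod_V i (mod_P S \<phi>) x = mod_P S (mod_V i \<phi>) x"
        using x i by (simp add: val op_closed(3) op_closed(1)[OF x i])
    qed (use \<phi> i in simp_all)
  next
    fix S show "linear_operator F.completion F.completion (mod_P S)" by (rule P_lin)
    fix \<phi> assume \<phi>: "\<phi> \<in> carrier F.completion"
    show "cinner F.completion (mod_P S \<phi>) \<psi> = cinner F.completion \<phi> (mod_P S \<psi>)"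
      if "\<psi> \<in> carrier F.completion" for \<psi>
      unfolding mod_P_def by (rule F.cinner_lift[OF formal_adjoint_P formal_adjoint_P \<phi> that])
    show "mod_P S (mod_P R \<phi>) = mod_P (S \<inter> R) \<phi>" for R
    proof (rule completion_eqI)
      fix x assume x: "x \<in> fracs"
      have "\<phi> (op_P R (op_P S x)) = \<phi> (op_P (S \<inter> R) x)"
        by (rule completion_cong[OF \<phi>]) (use x op_closed in \<open>auto simp: op_P_def\<close>)
      then show "mod_P S (mod_P R \<phi>) x = mod_P (S \<inter> R) \<phi> x" using x by (simp add: val op_closed)
    qed (use \<phi> in simp_all)
    show "mod_P (S \<union> R) \<phi> = mod_P S \<phi> \<oplus>\<^bsub>F.completion\<^esub> mod_P R \<phi>" if "S \<inter> R = {}" for R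
    proof (rule completion_eqI)
      show "mod_P S \<phi> \<oplus>\<^bsub>F.completion\<^esub> mod_P R \<phi> \<in> carrier F.completion"
        using \<phi> by (simp add: C.carrier_intros)
      fix x assume x: "x \<in> fracs"
      have "\<phi> (op_P (S \<union> R) x) = \<phi> (frac_add (op_P S x) (op_P R x))"
      proof (rule F.completion_eval_cong[OF \<phi>])
        fix z assume z: "z \<in> fracs"
        have "form (op_P (S \<union> R) x) z = form (op_P S x) z + form (op_P R x) z"
          unfolding form_P(1)[OF x z] Int_Un_distrib by (rule sum.union_disjoint) (use that in auto)
        then show "form (op_P (S \<union> R) x) z = form (frac_add (op_P S x) (op_P R x)) z"
          using x z by (simp add: F.form_add_left op_closed)
      qed (use x op_closed F.add_closed in auto)
      then show "mod_P (S \<union> R) \<phi> x = (mod_P S \<phi> \<oplus>\<^bsub>F.completion\<^esub> mod_P R \<phi>) x"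
        using x \<phi> by (simp add: val F.completion_sel(3) F.completion_eval_add op_closed)
    qed (use \<phi> in simp_all)
    show "mod_P S \<phi> = \<phi>" if "{1..n} \<subseteq> S"
    proof (rule completion_eqI)
      fix x assume x: "x \<in> fracs"
      have "\<phi> (op_P S x) = \<phi> x"
        by (rule completion_cong[OF \<phi>]) (use x op_closed that in \<open>auto simp: op_P_def\<close>)
      then show "mod_P S \<phi> x = \<phi> x" using x by (simp add: val)
    qed (use \<phi> in simp_all)
    show "tuple_prod n mod_V \<phi> = \<phi>"
    proof (rule completion_eqI)
      show "tuple_prod n mod_V \<phi> \<in> carrier F.completion"
        by (rule tuple_prod_carrier) (use \<phi> in simp_all)
      fix x assume x: "x \<in> fracs"
      obtain y where y: "y \<in> fracs" "tuple_prod n mod_V \<phi> x = \<phi> y"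
        "\<And>i. i \<in> {1..n} \<Longrightarrow> y i = (tuple_prod n (A(i := id)) (fst (x i)), snd (x i) + (if i \<le> n then 1 else 0))"
        using op_U_iter[of 1 x \<phi> n] x \<phi> assms by auto
      \<comment> \<open>Here \<open>y\<close> is \<open>x\<close> with every fraction expanded by
        \<open>omit i\<close>; this is why the inverse of \<open>S_j\<close> is the right choice for
        \<open>U_j\<close> on the \<open>j\<close>-th summand.\<close>
      have "\<phi> y = \<phi> x"
      proof (rule F.completion_eval_cong[OF \<phi> y(1) x])
        fix z assume "z \<in> fracs"
        with x show "form y z = form x z"
          by (rule form_cancel) (use y(3) in \<open>auto simp: omit_def\<close>)
      qed
      then show "tuple_prod n mod_V \<phi> x = \<phi> x" using y(2) by simp
    qed (rule \<phi>)
  qed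
qed

text \<open>The map \<open>Q\<close> of the overview: the diagonal tuple with all denominators
  trivial.\<close>

definition defect_map :: "'a \<Rightarrow> (nat \<Rightarrow> 'a \<times> nat) \<Rightarrow> complex" where
  "defect_map h = F.embed (\<lambda>_. (h, 0))"

lemma const_fracs: "h \<in> carrier H \<Longrightarrow> (\<lambda>_. (h, 0)) \<in> fracs"
  by (simp add: fracs_def)

lemma linear_defect_map: "linear_operator H F.completion defect_map"
proof (rule linear_operatorI)
  show "defect_map h \<in> carrier F.completion" if "h \<in> carrier H" for h
    unfolding defect_map_def by (rule F.embed_carrier[OF const_fracs[OF that]])
  show "defect_map (h \<oplus>\<^bsub>H\<^esub> g) = defect_map h \<oplus>\<^bsub>F.completion\<^esub> defect_map g"
    if "h \<in> carrier H" "g \<in> carrier H" for h g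
  proof
    fix x show "defect_map (h \<oplus>\<^bsub>H\<^esub> g) x = (defect_map h \<oplus>\<^bsub>F.completion\<^esub> defect_map g) x"
      using that fracsD[of x]
      by (simp add: defect_map_def F.embed_def F.completion_sel(3) form_def frac_form_def
          omit_pow_lin defect_add_left omit_pow_carrier sum.distrib[symmetric])
  qed
  show "defect_map (c \<odot>\<^bsub>H\<^esub> h) = c \<odot>\<^bsub>F.completion\<^esub> defect_map h"
    if "h \<in> carrier H" for h c
  proof
    fix x show "defect_map (c \<odot>\<^bsub>H\<^esub> h) x = (c \<odot>\<^bsub>F.completion\<^esub> defect_map h) x"
      using that fracsD[of x]
      by (simp add: defect_map_def F.embed_def F.completion_sel(4) form_def frac_form_def
          omit_pow_lin defect_scale_left omit_pow_carrier sum_distrib_left)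
  qed
qed

text \<open>\<open>I - T T\<^sup>*\<close> telescopes into the sum of the defects of the factors of \<open>T = T 1 \<cdots> T n\<close>, since
  \<open>A j\<close> preserves the defect forms with index different from \<open>j\<close>.\<close>

lemma sum_defect:
  assumes "m \<le> n" "h \<in> carrier H"
  shows "(\<Sum>i\<in>{1..m}. Re (defect i h h)) = (hnorm H h)\<^sup>2 - (hnorm H (tuple_prod m A h))\<^sup>2"
  using assms
proof (induction m arbitrary: h)
  case (Suc m)
  then have m: "Suc m \<in> {1..n}" "m \<le> n" by auto
  note Ah = A_lin(1)[OF m(1) Suc.prems(2)]
  have "(\<Sum>i\<in>{1..m}. Re (defect i h h)) = (\<Sum>i\<in>{1..m}. Re (defect i (A (Suc m) h) (A (Suc m) h)))"
    by (rule sum.cong) (use m Suc.prems defect_A in auto)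
  also have "\<dots> = (hnorm H (A (Suc m) h))\<^sup>2 - (hnorm H (tuple_prod (Suc m) A h))\<^sup>2"
    using Suc.IH[OF m(2) Ah] by simp
  finally show ?case
    using Suc.prems(2) Ah by (simp add: defect_def norm_sq)
qed simp

lemma defect_map_norm:
  assumes "h \<in> carrier H"
  shows "(hnorm F.completion (defect_map h))\<^sup>2 = (hnorm H h)\<^sup>2 - (hnorm H (tuple_prod n A h))\<^sup>2"
proof -
  interpret C: separable_hilbert_space F.completion by (rule separable_completion)
  note c = const_fracs[OF assms]
  have "(hnorm F.completion (defect_map h))\<^sup>2 = Re (form (\<lambda>_. (h, 0)) (\<lambda>_. (h, 0)))"
    using c F.embed_carrier[OF c] unfolding defect_map_def
    by (simp add: C.norm_sq F.cinner_embed) (simp add: F.embed_def)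
  also have "\<dots> = (\<Sum>i\<in>{1..n}. Re (defect i h h))"
    by (simp add: form_def frac_form_def)
  finally show ?thesis using sum_defect[OF order_refl assms] by simp
qed

text \<open>With \<open>mod_U j\<close> and the projections moved to the argument \<open>x\<close>,
  the coordinates other than \<open>j\<close> are covered by \<open>frac_form_UV\<close>. In
  coordinate \<open>j\<close> the product of all the \<open>A i\<close> is \<open>omit j\<close>
  after \<open>A j\<close>, and this \<open>omit j\<close> cancels against the one that
  \<open>op_V j\<close> puts into the numerator of \<open>x\<close>.\<close>

lemma defect_map_A:
  assumes j: "j \<in> {1..n}" and h: "h \<in> carrier H"
  shows "defect_map (A j h) = mod_U j (mod_P (- {j}) (defect_map h) \<oplus>\<^bsub>F.completion\<^esub>
    mod_P {j} (defect_map (tuple_prod n A h)))"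
proof
  fix x
  show "defect_map (A j h) x = mod_U j (mod_P (- {j}) (defect_map h) \<oplus>\<^bsub>F.completion\<^esub>
    mod_P {j} (defect_map (tuple_prod n A h))) x"
  proof (cases "x \<in> fracs")
    case True
    have Rh: "tuple_prod n A h \<in> carrier H"
      by (rule tuple_prod_carrier) (use A_lin(1) h in auto)
    note V = op_closed(2)[OF True]
    have "form (\<lambda>_. (A j h, 0)) x = (\<Sum>i\<in>{1..n} \<inter> - {j}. frac_form i (A j h, 0) (x i)) +
        (\<Sum>i\<in>{1..n} \<inter> {j}. frac_form i (A j h, 0) (x i))"
      unfolding form_def by (subst sum.union_disjoint[symmetric]) (auto intro!: sum.cong)
    also have "(\<Sum>i\<in>{1..n} \<inter> - {j}. frac_form i (A j h, 0) (x i)) =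
        (\<Sum>i\<in>{1..n} \<inter> - {j}. frac_form i (h, 0) (op_V j x i))"
    proof (rule sum.cong[OF refl])
      fix i assume "i \<in> {1..n} \<inter> - {j}"
      then show "frac_form i (A j h, 0) (x i) = frac_form i (h, 0) (op_V j x i)"
        using frac_form_UV[OF j _ const_fracs[OF h] True, of i] by (auto simp: op_U_def)
    qed
    also have "\<dots> = form (\<lambda>_. (h, 0)) (op_P (- {j}) (op_V j x))"
      by (rule form_P(2)[OF const_fracs[OF h] V, symmetric])
    also have "(\<Sum>i\<in>{1..n} \<inter> {j}. frac_form i (A j h, 0) (x i)) =
        (\<Sum>i\<in>{1..n} \<inter> {j}. frac_form i (tuple_prod n A h, 0) (op_V j x i))"
    proof (rule sum.cong[OF refl])
      fix i assume "i \<in> {1..n} \<inter> {j}"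
      then have "i = j" by simp
      have "(omit j ^^ snd (x j)) (omit j (A j h)) = omit j ((omit j ^^ snd (x j)) (A j h))"
        by (simp add: funpow_swap1)
      then show "frac_form i (A j h, 0) (x i) = frac_form i (tuple_prod n A h, 0) (op_V j x i)"
        using omit_A[OF j h, symmetric] fracsD[OF True j] A_lin(1)[OF j h] j unfolding \<open>i = j\<close>
        by (simp add: frac_form_def op_V_def defect_omit omit_pow_carrier)
    qed
    also have "\<dots> = form (\<lambda>_. (tuple_prod n A h, 0)) (op_P {j} (op_V j x))"
      by (rule form_P(2)[OF const_fracs[OF Rh] V, symmetric])
    finally show ?thesis
      using True V op_closed(3)[OF V]
      by (simp add: defect_map_def mod_U_def mod_P_def F.lift_def F.completion_sel(3) F.embed_def)
  next
    case False
    then show ?thesis by (simp add: defect_map_def mod_U_def F.lift_def F.embed_def)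
  qed
qed

end

section \<open>The dilation\<close>

text \<open>Polarization: norms of sums determine the real parts, and replacing \<open>x\<close> by
  \<open>\<i> x\<close> gives the imaginary parts.\<close>

lemma isometry_cinner:
  assumes "inner_product_space H" "inner_product_space K" and V: "hilbert_isometry H K V"
    and x: "x \<in> carrier H" and y: "y \<in> carrier H"
  shows "cinner K (V x) (V y) = cinner H x y"
proof -
  interpret H: inner_product_space H by fact
  interpret K: inner_product_space K by fact
  have lin: "linear_operator H K V" and norm: "\<And>x. x \<in> carrier H \<Longrightarrow> hnorm K (V x) = hnorm H x"
    using V by (auto simp: hilbert_isometry_def)
  note lin = linear_operatorD[OF lin]
  have Re: "Re (cinner K (V x) (V y)) = Re (cinner H x y)" if "x \<in> carrier H" for x
  proof -
    have "(hnorm K (V x \<oplus>\<^bsub>K\<^esub> V y))\<^sup>2 = (hnorm H (x \<oplus>\<^bsub>H\<^esub> y))\<^sup>2"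
      using norm[of "x \<oplus>\<^bsub>H\<^esub> y"] that y by (simp add: lin H.carrier_intros)
    then show ?thesis
      using that y by (simp add: K.norm_add_sq H.norm_add_sq lin norm)
  qed
  show ?thesis
    using Re[OF x] Re[of "\<i> \<odot>\<^bsub>H\<^esub> x"] x y
    by (intro complex_eqI) (simp_all add: lin H.scale_closed H.cinner_scale_left K.cinner_scale_left)
qed

text \<open>The completion consists of functionals on tuples of fractions, whereas the coefficient
  space has to live in the type of complex sequences. All axioms of the model survive conjugation by
  a unitary.\<close>

lemma (in bcl_model) transport:
  fixes K :: "'b cinner_space" and J :: "'a \<Rightarrow> 'b"
  assumes K: "hilbert_space K" and J: "hilbert_isometry H K J" and surj: "J ` carrier H = carrier K"
  defines "G \<equiv> inv_into (carrier H) J"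
  shows "bcl_model K n (\<lambda>i x. J (V i (G x))) (\<lambda>i x. J (U i (G x))) (\<lambda>S x. J (P S (G x)))"
    and "x \<in> carrier H \<Longrightarrow> G (J x) = x"
proof -
  interpret K: hilbert_space K by fact
  have lin: "linear_operator H K J" and norm: "\<And>x. x \<in> carrier H \<Longrightarrow> hnorm K (J x) = hnorm H x"
    using J by (auto simp: hilbert_isometry_def)
  note J_lin [simp] = linear_operatorD[OF lin]
  have J_cinner [simp]: "cinner K (J x) (J y) = cinner H x y" if "x \<in> carrier H" "y \<in> carrier H" for x y
    by (rule isometry_cinner[OF inner_product_space_axioms K.inner_product_space_axioms J that])
  have inj: "inj_on J (carrier H)"
  proof
    fix x y assume "x \<in> carrier H" "y \<in> carrier H" "J x = J y"
    then show "x = y" by (intro vec_eqI) (metis J_cinner)+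
  qed
  then show GJ [simp]: "x \<in> carrier H \<Longrightarrow> G (J x) = x" for x
    by (simp add: G_def)
  have G [simp]: "G y \<in> carrier H" "J (G y) = y" if "y \<in> carrier K" for y
    using that surj by (auto simp: G_def inv_into_into f_inv_into_f)
  have lift: "linear_operator K K (\<lambda>x. J (A (G x)))" if A: "linear_operator H H A" for A
  proof (rule linear_operatorI)
    note A_lin [simp] = linear_operatorD[OF A]
    fix x y assume "x \<in> carrier K" "y \<in> carrier K"
    then have "G (x \<oplus>\<^bsub>K\<^esub> y) = G x \<oplus>\<^bsub>H\<^esub> G y"
      using GJ[of "G x \<oplus>\<^bsub>H\<^esub> G y"] by (simp add: carrier_intros)
    then show "J (A (G (x \<oplus>\<^bsub>K\<^esub> y))) = J (A (G x)) \<oplus>\<^bsub>K\<^esub> J (A (G y))"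
      using \<open>x \<in> carrier K\<close> \<open>y \<in> carrier K\<close> by simp
  next
    note A_lin [simp] = linear_operatorD[OF A]
    fix c x assume "x \<in> carrier K"
    then have "G (c \<odot>\<^bsub>K\<^esub> x) = c \<odot>\<^bsub>H\<^esub> G x"
      using GJ[of "c \<odot>\<^bsub>H\<^esub> G x"] by (simp add: carrier_intros)
    then show "J (A (G (c \<odot>\<^bsub>K\<^esub> x))) = c \<odot>\<^bsub>K\<^esub> J (A (G x))"
      using \<open>x \<in> carrier K\<close> by simp
  qed (simp add: linear_operatorD[OF A])
  have J_cinner_left: "cinner K (J x) y = cinner H x (G y)" "cinner K y (J x) = cinner H (G y) x"
    if "x \<in> carrier H" "y \<in> carrier K" for x y
    using J_cinner[of x "G y"] J_cinner[of "G y" x] that by simp_all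
  show "bcl_model K n (\<lambda>i x. J (V i (G x))) (\<lambda>i x. J (U i (G x))) (\<lambda>S x. J (P S (G x)))"
  proof
    fix i assume i: "i \<in> {1..n}"
    note [simp] = V_lin(1)[OF i] U_lin(1)[OF i] P_lin(1)
    show "linear_operator K K (\<lambda>x. J (V i (G x)))" "linear_operator K K (\<lambda>x. J (U i (G x)))"
      by (intro lift V_linear U_linear i)+
    fix x assume x: "x \<in> carrier K"
    show "cinner K (J (V i (G x))) y = cinner K x (J (U i (G y)))" if "y \<in> carrier K" for y
      using i x that by (simp add: J_cinner_left V_adjoint)
    show "J (U i (G (J (V i (G x))))) = x" "J (V i (G (J (U i (G x))))) = x"
      "J (V i (G (J (P S (G x))))) = J (P S (G (J (V i (G x)))))" for S
      using x by (simp_all add: U_V[OF i] V_U[OF i] V_P[OF i])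
    show "J (V i (G (J (V j (G x))))) = J (V j (G (J (V i (G x)))))" if "j \<in> {1..n}" for j
      using x V_lin(1)[OF that] by (simp add: V_commute[OF i that])
  next
    fix S show "linear_operator K K (\<lambda>x. J (P S (G x)))" by (intro lift P_linear)
    note [simp] = P_lin(1)
    fix x assume x: "x \<in> carrier K"
    show "cinner K (J (P S (G x))) y = cinner K x (J (P S (G y)))" if "y \<in> carrier K" for y
      using x that by (simp add: J_cinner_left P_adjoint)
    show "J (P S (G (J (P R (G x))))) = J (P (S \<inter> R) (G x))" for R
      using x by (simp add: P_P)
    show "J (P (S \<union> R) (G x)) = J (P S (G x)) \<oplus>\<^bsub>K\<^esub> J (P R (G x))" if "S \<inter> R = {}" for R
      using x by (simp add: P_Un[OF that])
    show "J (P S (G x)) = x" if "{1..n} \<subseteq> S"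
      using x by (simp add: P_full[OF that])
    have "tuple_prod m (\<lambda>i x. J (V i (G x))) x = J (tuple_prod m V (G x))" if "m \<le> n" "x \<in> carrier K" for m x
      using that
    proof (induction m arbitrary: x)
      case (Suc m)
      then show ?case using V_lin(1)[of "Suc m" "G x"] by simp
    qed simp
    from this[OF order_refl x] show "tuple_prod n (\<lambda>i x. J (V i (G x))) x = x"
      using x by (simp add: V_prod)
  qed
qed

context defect_tuple
begin

theorem dilation:
  assumes "n \<ge> 1" and pure: "\<And>h. h \<in> carrier H \<Longrightarrow> (\<lambda>k. hnorm H ((tuple_prod n A ^^ k) h)) \<longlonglongrightarrow> 0"
  obtains E :: "(nat \<Rightarrow> complex) cinner_space" and W \<Phi>
  where "separable_hilbert_space E" "hilbert_isometry H (hardy E) W" "BCL_tuple n E \<Phi>"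
    "(\<lambda>i. mult_op (\<Phi> i)) \<in> class_B0 n (hardy E)"
    "\<And>i h. \<lbrakk>i \<in> {1..n}; h \<in> carrier H\<rbrakk> \<Longrightarrow> W (A i h) = adj (hardy E) (mult_op (\<Phi> i)) (W h)"
proof -
  interpret C: bcl_model F.completion n mod_V mod_U mod_P
    by (rule bcl_model_completion[OF assms(1)])
  obtain E :: "(nat \<Rightarrow> complex) cinner_space" and J where E: "separable_hilbert_space E"
    and J: "hilbert_isometry F.completion E J" "J ` carrier F.completion = carrier E"
    using separable_hilbert_space_representable[OF separable_completion] by blast
  interpret E: separable_hilbert_space E by (rule E)
  define G where "G = inv_into (carrier F.completion) J"
  note transport = C.transport[OF E.hilbert_space_axioms J, folded G_def]
  interpret M: bcl_model E n "\<lambda>i x. J (mod_V i (G x))" "\<lambda>i x. J (mod_U i (G x))" "\<lambda>S x. J (mod_P S (G x))"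
    by (rule transport)
  note Q_lin = linear_operatorD[OF linear_defect_map]
  have Jl: "linear_operator F.completion E J" and Jn: "\<And>x. x \<in> carrier F.completion \<Longrightarrow> hnorm E (J x) = hnorm F.completion x"
    using J(1) by (auto simp: hilbert_isometry_def)
  note J_lin = linear_operatorD[OF Jl]
  define R where "R = tuple_prod n A"
  have R: "contraction H R"
    unfolding R_def by (rule tuple_prod_contraction) (rule A_contraction)
  note Rc = contractionD(2)[OF R]
  obtain W where W: "hilbert_isometry H (hardy E) W"
    "\<And>i h. \<lbrakk>i \<in> {1..n}; h \<in> carrier H\<rbrakk> \<Longrightarrow> W (A i h) = adj (hardy E) (mult_op (M.symbol i)) (W h)"
  proof (rule M.isometric_embedding[of H A R "\<lambda>h. J (defect_map h)"])
    show "inner_product_space H" by (rule inner_product_space_axioms)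
    show "linear_operator H H R" by (rule contractionD(1)[OF R])
    show "linear_operator H E (\<lambda>h. J (defect_map h))"
      by (rule linear_operatorI) (simp_all add: Q_lin J_lin)
    fix h assume h: "h \<in> carrier H"
    show "(\<lambda>k. hnorm H ((R ^^ k) h)) \<longlonglongrightarrow> 0" unfolding R_def by (rule pure[OF h])
    show "(hnorm E (J (defect_map h)))\<^sup>2 = (hnorm H h)\<^sup>2 - (hnorm H (R h))\<^sup>2"
      using defect_map_norm[OF h] h by (simp add: Jn Q_lin R_def)
    fix i assume i: "i \<in> {1..n}"
    show "A i h \<in> carrier H" by (rule A_lin(1)[OF i h])
    show "R (A i h) = A i (R h)"
      unfolding R_def by (rule tuple_prod_commute[where S = "carrier H"]) (use A_lin(1) A_commute i h in auto)
    show "J (defect_map (A i h)) = J (mod_U i (G (J (mod_P (- {i}) (G (J (defect_map h)))) \<oplus>\<^bsub>E\<^esub>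
        J (mod_P {i} (G (J (defect_map (R h))))))))"
      using h i defect_map_A[OF i h]
      by (simp add: transport(2) Q_lin Rc C.P_lin C.carrier_intros J_lin(2)[symmetric] R_def[symmetric])
  qed blast
  show ?thesis
    by (rule that[OF E W(1) M.BCL_tuple_symbol M.class_B0_symbol W(2)])
qed

end

text \<open>Adjoints reverse the order of a product. The adjoints commute as the operators do, so
  each new factor can be carried through the others to its proper end.\<close>

lemma (in hilbert_space) adj_tuple_prod:
  assumes T: "\<And>i. i \<in> {1..n} \<Longrightarrow> contraction H (T i)" and "commuting_tuple n H T"
  shows "\<lbrakk>i \<in> {1..n}; j \<in> {1..n}; x \<in> carrier H\<rbrakk> \<Longrightarrow>
      adj H (T i) (adj H (T j) x) = adj H (T j) (adj H (T i) x)"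
    and "x \<in> carrier H \<Longrightarrow> adj H (tuple_prod n T) x = tuple_prod n (\<lambda>i. adj H (T i)) x"
proof -
  note Tc = contractionD(2)[OF T] and adj = adj_contraction[OF T]
  show comm: "adj H (T i) (adj H (T j) x) = adj H (T j) (adj H (T i) x)"
    if "i \<in> {1..n}" "j \<in> {1..n}" "x \<in> carrier H" for i j x
  proof (rule vec_eqI)
    fix u assume u: "u \<in> carrier H"
    have "T i (T j u) = T j (T i u)"
      using assms(2) that u by (simp add: commuting_tuple_def)
    then show "cinner H (adj H (T i) (adj H (T j) x)) u = cinner H (adj H (T j) (adj H (T i) x)) u"
      using that u cinner_adj_left[OF T] by (simp add: adj Tc)
  qed (use that adj in auto)
  have car: "tuple_prod m (\<lambda>i. adj H (T i)) x \<in> carrier H" if "m \<le> n" "x \<in> carrier H" for m x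
    by (rule tuple_prod_carrier) (use that adj in auto)
  have "cinner H (tuple_prod m T u) x = cinner H u (tuple_prod m (\<lambda>i. adj H (T i)) x)"
    if "m \<le> n" "x \<in> carrier H" "u \<in> carrier H" for m x u
    using that
  proof (induction m arbitrary: u)
    case (Suc m)
    then have m: "Suc m \<in> {1..n}" "m \<le> n" by auto
    have "cinner H (tuple_prod (Suc m) T u) x = cinner H (T (Suc m) u) (tuple_prod m (\<lambda>i. adj H (T i)) x)"
      using Suc.IH[OF m(2) Suc.prems(2) Tc[OF m(1) Suc.prems(3)]] by simp
    also have "\<dots> = cinner H u (adj H (T (Suc m)) (tuple_prod m (\<lambda>i. adj H (T i)) x))"
      by (rule adj(2)[OF m(1) car[OF m(2) Suc.prems(2)] Suc.prems(3)])
    also have "adj H (T (Suc m)) (tuple_prod m (\<lambda>i. adj H (T i)) x) =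
        tuple_prod m (\<lambda>i. adj H (T i)) (adj H (T (Suc m)) x)"
      by (rule tuple_prod_commute[where S = "carrier H", symmetric]) (use m adj comm Suc.prems in auto)
    finally show ?case by simp
  qed simp
  then show "adj H (tuple_prod n T) x = tuple_prod n (\<lambda>i. adj H (T i)) x" if "x \<in> carrier H"
    using that car by (intro adj_eqI) auto
qed

text \<open>Pairing the operator identity with \<open>y\<close> and moving every \<open>T i\<close>
  across as an adjoint leaves four inner products; they rearrange to the invariance of the
  \<open>i\<close>-th defect form under the \<open>j\<close>-th adjoint.\<close>

lemma defect_tuple_adj:
  assumes "separable_hilbert_space H" and T: "T \<in> class_B0 n H"
  shows "defect_tuple H n (\<lambda>i. adj H (T i))"
proof -
  interpret separable_hilbert_space H by fact
  have contr: "\<And>i. i \<in> {1..n} \<Longrightarrow> contraction H (T i)" and comm: "commuting_tuple n H T"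
    using T by (auto simp: class_B0_def)
  note Tc = contractionD(2)[OF contr] and adj = adj_contraction[OF contr]
  have adj_comm: "adj H (T i) (adj H (T j) x) = adj H (T j) (adj H (T i) x)"
    if "i \<in> {1..n}" "j \<in> {1..n}" "x \<in> carrier H" for i j x
    by (rule adj_tuple_prod(1)[OF contr comm that])
  show ?thesis
  proof
    fix i j x y
    assume i: "i \<in> {1..n}" and j: "j \<in> {1..n}" and ij: "i \<noteq> j" and x: "x \<in> carrier H" and y: "y \<in> carrier H"
    have "x \<ominus>\<^bsub>H\<^esub> T i (adj H (T i) x) \<ominus>\<^bsub>H\<^esub> T j (adj H (T j) x)
          \<oplus>\<^bsub>H\<^esub> T i (T j (adj H (T i) (adj H (T j) x))) = \<zero>\<^bsub>H\<^esub>"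
      using T i j ij x by (simp add: class_B0_def)
    then have "cinner H (x \<ominus>\<^bsub>H\<^esub> T i (adj H (T i) x) \<ominus>\<^bsub>H\<^esub> T j (adj H (T j) x)
          \<oplus>\<^bsub>H\<^esub> T i (T j (adj H (T i) (adj H (T j) x)))) y = 0"
      using y by (simp add: cinner_zero_left)
    then have "cinner H x y - cinner H (adj H (T i) x) (adj H (T i) y) -
        cinner H (adj H (T j) x) (adj H (T j) y) +
        cinner H (adj H (T i) (adj H (T j) x)) (adj H (T j) (adj H (T i) y)) = 0"
      using i j x y by (simp add: cinner_simps Tc adj)
    then show "cinner H (adj H (T j) x) (adj H (T j) y) -
        cinner H (adj H (T i) (adj H (T j) x)) (adj H (T i) (adj H (T j) y)) =
      cinner H x y - cinner H (adj H (T i) x) (adj H (T i) y)"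
      using adj_comm[OF i j y] by (simp add: algebra_simps)
  qed (use contraction_adj contr adj_comm in auto)
qed

theorem theorem3p2:
  fixes H :: "'a cinner_space" and n :: nat and T :: "nat \<Rightarrow> 'a \<Rightarrow> 'a"
  assumes "separable_hilbert_space H"
    and "n \<ge> 2"
    and "T \<in> class_B0 n H"
  shows "\<exists>(E :: (nat \<Rightarrow> complex) cinner_space) V \<Phi>.
    separable_hilbert_space E \<and>
    hilbert_isometry H (hardy E) V \<and>
    BCL_tuple n E \<Phi> \<and>
    (\<lambda>i. mult_op (\<Phi> i)) \<in> class_B0 n (hardy E) \<and>
    (\<forall>i\<in>{1..n}. \<forall>h\<in>carrier H. V (adj H (T i) h) = adj (hardy E) (mult_op (\<Phi> i)) (V h))"
proof -
  interpret D: defect_tuple H n "\<lambda>i. adj H (T i)"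
    by (rule defect_tuple_adj[OF assms(1,3)])
  have contr: "\<And>i. i \<in> {1..n} \<Longrightarrow> contraction H (T i)" and comm: "commuting_tuple n H T"
    and pure: "pure_contraction H (tuple_prod n T)"
    using assms(3) by (auto simp: class_B0_def)
  have "(\<lambda>k. hnorm H ((tuple_prod n (\<lambda>i. adj H (T i)) ^^ k) h)) \<longlonglongrightarrow> 0" if h: "h \<in> carrier H" for h
  proof -
    have adj: "adj H (tuple_prod n T) x = tuple_prod n (\<lambda>i. adj H (T i)) x" if "x \<in> carrier H" for x
      by (rule D.adj_tuple_prod(2)[OF contr comm that])
    \<comment> \<open>The adjoint of the product and the product of the adjoints are known to agree
      on the carrier only, so the induction carries membership along with equality of the
      iterates.\<close>
    have "(adj H (tuple_prod n T) ^^ k) h \<in> carrier H \<and>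
        (tuple_prod n (\<lambda>i. adj H (T i)) ^^ k) h = (adj H (tuple_prod n T) ^^ k) h" for k
    proof (induction k)
      case (Suc k)
      then have "adj H (tuple_prod n T) ((adj H (tuple_prod n T) ^^ k) h) \<in> carrier H"
        by (intro D.adj_contraction tuple_prod_contraction contr) auto
      with Suc show ?case using adj by simp
    qed (use h in simp)
    then show ?thesis using pure h by (simp add: pure_contraction_def)
  qed
  moreover have "n \<ge> 1" using assms(2) by simp
  ultimately obtain E :: "(nat \<Rightarrow> complex) cinner_space" and V \<Phi>
    where "separable_hilbert_space E" "hilbert_isometry H (hardy E) V" "BCL_tuple n E \<Phi>"
      "(\<lambda>i. mult_op (\<Phi> i)) \<in> class_B0 n (hardy E)"
      "\<And>i h. \<lbrakk>i \<in> {1..n}; h \<in> carrier H\<rbrakk> \<Longrightarrow> V (adj H (T i) h) = adj (hardy E) (mult_op (\<Phi> i)) (V h)"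
    using D.dilation by blast
  then show ?thesis by blast
qed

end
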